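(* Let $h\ge 1$ be a fixed integer, and let $\mathcal B_h$, $\mathcal R_h$, $B_h(x)$, $R_h(x)$ be as defined in the context. Then $$\mathcal R_h\subseteq\mathcal B_h,\qquad R_h(x)\ll_h\frac{x}{(\log x)^2}.$$ Moreover, as $x\to\infty$, $$0\le B_h(x)-R_h(x)\le x\exp\!\left(-\left(\frac1{\sqrt6}+o_h(1)\right)\sqrt{\log x\,\log\log x}\right).$$
   Context: $\mathbb N=\{1,2,\ldots\}$; $\sigma(n)=\sum_{d\mid n}d$; $I(n)=\sigma(n)/n$; $(a,b)$ denotes the greatest common divisor. Put $$\mathcal B_h=\{n\in\mathbb N:\sigma(n)\mid\sigma(n+h)\},\qquad B_h(x)=\#(\mathcal B_h\cap[1,x]),$$ $$\mathcal V_h=\left\{v\in\mathbb N: v\ge2,\ \frac{I(v)}{I(v+h)}\in\mathbb N\right\}.$$ For $v\ge2$ put $\delta_v=(v,h)$, $a_v=v/\delta_v$, $b_v=(v+h)/\delta_v$, and for integers $L\ge1$ put $p_{v,L}=a_vL-1$, $q_{v,L}=b_vL-1$. Let $\mathcal R_h$ be the set of all integers $n=(v+h)p_{v,L}$ with $v\in\mathcal V_h$ and $L\ge1$ such that $p_{v,L}$ and $q_{v,L}$ are both prime, $(p_{v,L},v+h)=1$ and $(q_{v,L},v)=1$. Put $R_h(x)=\#(\mathcal R_h\cap[1,x])$. The notation $f(x)\ll_h g(x)$ means $|f(x)|\le C_h\,g(x)$ for all sufficiently large $x$ (in terms of $h$), with $C_h$ depending only on $h$; $o_h(1)$ denotes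 a function of $x$ (depending on $h$) tending to $0$ as $x\to\infty$ for fixed $h$. *)

theory Defs
  imports
    Complex_Main
    "HOL-Computational_Algebra.Primes"
    "HOL-Library.Landau_Symbols"
begin

(* The junk value divisor_sum 0 = 0 is never used: all arguments below are positive. *)
definition divisor_sum :: "nat \<Rightarrow> nat" where
  "divisor_sum n = (\<Sum>d | d dvd n. d)"

definition abundancy :: "nat \<Rightarrow> real" where
  "abundancy n = real (divisor_sum n) / real n"

definition B_set :: "nat \<Rightarrow> nat set" where
  "B_set h = {n. n \<ge> 1 \<and> divisor_sum n dvd divisor_sum (n + h)}"

definition V_set :: "nat \<Rightarrow> nat set" where
  "V_set h = {v. v \<ge> 2 \<and> (\<exists>k::nat. k \<ge> 1 \<and> abundancy v / abundancy (v + h) = real k)}"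

definition a_coeff :: "nat \<Rightarrow> nat \<Rightarrow> nat" where
  "a_coeff h v = v div gcd v h"

definition b_coeff :: "nat \<Rightarrow> nat \<Rightarrow> nat" where
  "b_coeff h v = (v + h) div gcd v h"

(* For v, L >= 1 both products are at least 1, so the subtractions on nat do not truncate. *)
definition p_val :: "nat \<Rightarrow> nat \<Rightarrow> nat \<Rightarrow> nat" where
  "p_val h v L = a_coeff h v * L - 1"

definition q_val :: "nat \<Rightarrow> nat \<Rightarrow> nat \<Rightarrow> nat" where
  "q_val h v L = b_coeff h v * L - 1"

definition R_set :: "nat \<Rightarrow> nat set" where
  "R_set h = {(v + h) * p_val h v L | v L.
     v \<in> V_set h \<and> L \<ge> 1 \<and> prime (p_val h v L) \<and> prime (q_val h v L) \<and>
     coprime (p_val h v L) (v + h) \<and> coprime (q_val h v L) v}"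

definition count_upto :: "nat set \<Rightarrow> real \<Rightarrow> nat" where
  "count_upto A x = card {n \<in> A. 1 \<le> n \<and> real n \<le> x}"

definition B_count :: "nat \<Rightarrow> real \<Rightarrow> real" where
  "B_count h x = real (count_upto (B_set h) x)"

definition R_count :: "nat \<Rightarrow> real \<Rightarrow> real" where
  "R_count h x = real (count_upto (R_set h) x)"

end

(*
Write n = m p and n + h = m' q with primes p, q > y = exp (sqrt (log x loglog x)); the n for which
n or n + h is y-smooth, or divisible by the square of a prime > y, are few (Rankin). If
sigma(n + h) = k sigma(n), then eliminating q shows that either m = m' + h, in which case n lies in
R_h, or the smaller of the two primes, say p, satisfies p + 1 | k sigma(m') (m' + h - m) with a
nonzero right-hand side. Let d = gcd(p + 1, k sigma(m')).
  If d > sqrt y, then p = -1 modulo a large divisor of sigma(m'); these n are counted using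
n = 0 mod p, n = -h mod m', together with an average of sum_{d | sigma(m)} d^(-1/10) over m.
  If d <= sqrt y, write p + 1 = d e and m = m' + h + e t. Then m' divides e (t p + h d), so that n is
determined by d, e, t and a divisor of this number; the divisor function is estimated on average
over t when p is small, and pointwise when p is large.
  Every contribution is at most x exp (-0.42 sqrt (log x loglog x)), and 0.42 > 1 / sqrt 6, so the
o(1) term may be taken to be 0. The bound for R_h(x) is Selberg's sieve for the pair (a L - 1, b L - 1).
*)
theory Submission
  imports Defs "HOL-Analysis.Analysis" "HOL-Number_Theory.Cong" "HOL-Real_Asymp.Real_Asymp"
    "HOL-Computational_Algebra.Squarefree"
begin


text \<open>Every saving here is smaller than any power of x. That is the obstacle: the pointwise
  bound n^\<epsilon> for the number of divisors is admissible only where a comparable power is saved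
  elsewhere. Hence divisors of sigma(m') are averaged over m', with a damping that keeps the average
  at exp (O (sqrt (ln x))), and an average over t needs a range of t of at least the order of the
  square root of the numbers involved. For large p this range is too short, but then e > p / d is a
  power of x up to the factor sqrt y, and the sum of e^(-2) pays for the pointwise bound.

  The smaller of the two primes is taken because the modulus p m' then stays below the length of the
  interval, so that a residue class costs only its density.

  Constants: Rankin's trick permits a saving y^(-c) with any c < 1/2, and sums run at exponent 9/10
  give the sets on either side of the threshold sqrt y a saving y^(-9/20). The choice c = 9/20
  equalises them; the distance to 0.42 absorbs logarithms and factors exp (O (sqrt (ln x))).\<close>

section \<open>Elementary sums and counting in a residue class\<close>

lemma harm_le_one_plus_ln:
  assumes "n \<ge> (1::nat)"
  shows "(\<Sum>i=1..n. 1 / real i) \<le> 1 + ln (real n)"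
  using assms
proof (induction n rule: dec_induct)
  case (step n)
  have "ln (real n / real (Suc n)) \<le> real n / real (Suc n) - 1"
    using step by (intro ln_le_minus_one) auto
  also have "\<dots> = - 1 / real (Suc n)" by (simp add: field_simps)
  finally have "1 / real (Suc n) \<le> ln (real (Suc n)) - ln (real n)"
    using step by (simp add: ln_div)
  with step show ?case by simp
qed simp

lemma harm_le_one_plus_ln_real:
  assumes "x \<ge> (1::real)" and "\<And>i. i \<in> A \<Longrightarrow> i \<ge> (1::nat) \<and> real i \<le> x"
  shows "(\<Sum>i\<in>A. 1 / real i) \<le> 1 + ln x"
proof -
  have sub: "A \<subseteq> {1..nat \<lfloor>x\<rfloor>}" using assms by (auto simp: le_nat_floor)
  have "(\<Sum>i\<in>A. 1 / real i) \<le> (\<Sum>i=1..nat \<lfloor>x\<rfloor>. 1 / real i)"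
    using sub by (intro sum_mono2) auto
  also have "\<dots> \<le> 1 + ln (real (nat \<lfloor>x\<rfloor>))"
    using assms(1) by (intro harm_le_one_plus_ln) (simp add: le_nat_floor)
  also have "\<dots> \<le> 1 + ln x" using assms(1)
    by (smt (verit) le_nat_floor ln_mono of_nat_1 of_nat_floor of_nat_le_iff)
  finally show ?thesis .
qed

text \<open>The bound is explicit in s because s later tends to 0: it is 1 / ln y for the primes and
  1 / sqrt (ln X) for the divisor averages. This is the integral test, made into an induction by
  carrying the tail N^(-s) / s.\<close>

lemma sum_powr_le:
  fixes s :: real
  assumes "s > 0" "finite A" "0 \<notin> A"
  shows "(\<Sum>n\<in>A. real n powr (-(1 + s))) \<le> 1 + 1 / s"
proof -
  have *: "(\<Sum>n=1..N. real n powr (-(1+s))) \<le> 1 + 1/s - real N powr (-s) / s" if "N \<ge> 1" for N :: nat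
    using that
  proof (induction N rule: dec_induct)
    case (step N)
    obtain z where z: "z > real N" "z < real (Suc N)"
      "real (Suc N) powr (-s) - real N powr (-s) = (real (Suc N) - real N) * ((-s) * z powr (-s - 1))"
    proof -
      have "\<exists>z>real N. z < real (Suc N) \<and> real (Suc N) powr (-s) - real N powr (-s) =
          (real (Suc N) - real N) * ((-s) * z powr (-s - 1))"
        using step by (intro MVT2) (auto intro!: derivative_eq_intros)
      thus ?thesis using that by blast
    qed
    have "real (Suc N) powr (-(1+s)) \<le> z powr (-s - 1)"
    proof -
      have "real (Suc N) powr (-s - 1) \<le> z powr (-s - 1)"
        using z(1,2) step(1) assms(1) by (intro powr_mono2') auto
      moreover have "-(1 + s) = -s - 1" by simp
      ultimately show ?thesis by (simp only:)
    qed
    also have "\<dots> = (real N powr (-s) - real (Suc N) powr (-s)) / s"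
      using z(3) assms by (simp add: field_simps)
    finally show ?case using step by (simp add: diff_divide_distrib)
  qed (use assms in simp)
  show ?thesis
  proof (cases "A = {}")
    case False
    define N where "N = Max A"
    have sub: "A \<subseteq> {1..N}" using assms False unfolding N_def
      by (auto simp: Suc_le_eq intro: Max_ge gr0I)
    have "N \<ge> 1" using sub False by fastforce
    have "(\<Sum>n\<in>A. real n powr (-(1 + s))) \<le> (\<Sum>n=1..N. real n powr (-(1 + s)))"
      using sub by (intro sum_mono2) auto
    also have "\<dots> \<le> 1 + 1/s - real N powr (-s) / s" using * \<open>N \<ge> 1\<close> by blast
    also have "\<dots> \<le> 1 + 1/s" using assms by simp
    finally show ?thesis .
  qed (use assms in simp)
qed

text \<open>The class enters only through pairwise differences, so no residue has to be computed
  when it comes from simultaneous congruences. The quotients by M of the distances to the least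
  element are distinct.\<close>

lemma card_residue_class_le:
  fixes A :: "nat set" and X :: real
  assumes "M \<ge> (1::nat)" "X \<ge> 0" "\<And>a. a \<in> A \<Longrightarrow> a \<ge> 1 \<and> real a \<le> X"
    and "\<And>a b. a \<in> A \<Longrightarrow> b \<in> A \<Longrightarrow> int M dvd int a - int b"
  shows "real (card A) \<le> X / real M + 1"
proof (cases "A = {}")
  case True
  then show ?thesis using assms by simp
next
  case False
  have sub: "A \<subseteq> {1..nat \<lfloor>X\<rfloor>}" using assms(3) by (auto simp: le_nat_floor)
  hence fin: "finite A" using finite_subset by blast
  define a0 where "a0 = Min A"
  have a0: "a0 \<in> A" "\<And>a. a \<in> A \<Longrightarrow> a0 \<le> a" using fin False by (auto simp: a0_def)
  have inj: "inj_on (\<lambda>a. (a - a0) div M) A"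
  proof (rule inj_onI)
    fix a b assume ab: "a \<in> A" "b \<in> A" "(a - a0) div M = (b - a0) div M"
    have "M dvd a - a0" "M dvd b - a0" using assms(4) a0 ab
      by (metis of_nat_diff of_nat_dvd_iff)+
    hence "a - a0 = b - a0" using ab(3) by (metis dvd_mult_div_cancel)
    thus "a = b" using a0 ab by (metis le_add_diff_inverse2)
  qed
  have "(\<lambda>a. (a - a0) div M) ` A \<subseteq> {0..nat \<lfloor>X\<rfloor> div M}"
  proof (intro image_subsetI)
    fix a assume "a \<in> A"
    hence "a \<le> nat \<lfloor>X\<rfloor>" using sub by (meson atLeastAtMost_iff subsetD)
    hence "a - a0 \<le> nat \<lfloor>X\<rfloor>" by (rule le_trans[OF diff_le_self])
    thus "(a - a0) div M \<in> {0..nat \<lfloor>X\<rfloor> div M}" by (simp add: div_le_mono)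
  qed
  from card_mono[OF _ this] card_image[OF inj] have "card A \<le> nat \<lfloor>X\<rfloor> div M + 1" by simp
  hence "real (card A) \<le> real (nat \<lfloor>X\<rfloor> div M) + 1" by linarith
  also have "real (nat \<lfloor>X\<rfloor> div M) \<le> real (nat \<lfloor>X\<rfloor>) / real M"
    by (rule of_nat_div_le_of_nat)
  also have "\<dots> \<le> X / real M" using assms by (intro divide_right_mono) auto
  finally show ?thesis by simp
qed

section \<open>Divisor functions\<close>

definition tau :: "nat \<Rightarrow> nat" where "tau n = card {d. d dvd n}"

lemma tau_mult_le:
  assumes "m > 0" "n > 0"
  shows "tau (m * n) \<le> tau m * tau n"
proof -
  have "{d. d dvd m * n} \<subseteq> (\<lambda>(a, b). a * b) ` ({d. d dvd m} \<times> {d. d dvd n})"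
    by (auto elim!: dvd_productE)
  hence "tau (m * n) \<le> card ({d. d dvd m} \<times> {d. d dvd n})"
    unfolding tau_def using assms by (intro surj_card_le) auto
  thus ?thesis by (simp add: tau_def card_cartesian_product)
qed

lemma tau_prime_power: "prime p \<Longrightarrow> tau (p ^ a) = a + 1"
proof -
  assume p: "prime p"
  have "{d. d dvd p ^ a} = (\<lambda>i. p ^ i) ` {..a}" 
    using p by (auto simp: divides_primepow_nat)
  moreover have "inj_on (\<lambda>i. p ^ i) {..a}" using p
    by (auto intro!: inj_onI simp: prime_power_inj)
  ultimately show ?thesis by (simp add: tau_def card_image)
qed

text \<open>Compare a + 1 with p^(\<epsilon> a) one prime at a time: if p >= K then p^\<epsilon> >=
  2, and a + 1 <= 2^a suffices; each smaller prime costs at most the factor C. The induction strips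
  the whole power of one prime.\<close>

lemma tau_bound_aux:
  fixes \<epsilon> :: real and K :: nat
  assumes e: "\<epsilon> > 0" and K: "real K powr \<epsilon> \<ge> 2" and C: "C = 1 + 1 / (\<epsilon> * ln 2)"
  shows "n > 0 \<Longrightarrow> real (tau n) \<le> real n powr \<epsilon> * C ^ card {p \<in> prime_factors n. p < K}"
proof (induction n rule: less_induct)
  case (less n)
  have C1: "C \<ge> 1" using e by (simp add: C)
  show ?case
  proof (cases "n = 1")
    case True
    then show ?thesis by (simp add: tau_def)
  next
    case False
    then obtain p where p: "prime p" "p dvd n" by (metis prime_factor_nat)
    define a where "a = multiplicity p n"
    obtain m where m: "n = p ^ a * m" "\<not> p dvd m"
      using multiplicity_decompose'[of n p] less.prems p
      unfolding a_def by (metis not_prime_unit bot_nat_0.not_eq_extremum)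
    have a0: "a > 0" using p less.prems by (simp add: a_def prime_multiplicity_gt_zero_iff)
    have m0: "m > 0" using m less.prems by (metis gr0I mult_0_right)
    have p2: "p \<ge> 2" using p prime_ge_2_nat by blast
    have mn: "m < n" using m a0 m0 p2
      by (metis One_nat_def Suc_le_eq less_le_trans mult.commute n_less_m_mult_n numeral_2_eq_2 one_less_power prime_gt_1_nat p(1))
    have pf: "prime_factors n = insert p (prime_factors m)"
      using m m0 p a0 by (auto simp: prime_factors_product prime_factorization_prime_power)
    have pn: "p \<notin> prime_factors m" using m by auto
    have np: "real n powr \<epsilon> = real p powr (\<epsilon> * real a) * real m powr \<epsilon>"
      using p2 by (simp add: m powr_mult powr_powr mult.commute flip: powr_realpow)
    have key: "real (a + 1) \<le> real p powr (\<epsilon> * a) * (if p < K then C else 1)"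
    proof (cases "p < K")
      case True
      \<comment> \<open>The inequality u <= exp u - 1 at u = a \<epsilon> ln 2 bounds a by
        2^(\<epsilon> a) / (\<epsilon> ln 2), which is the origin of C.\<close>
      have "real a * (\<epsilon> * ln 2) \<le> exp (real a * (\<epsilon> * ln 2)) - 1"
        using exp_ge_add_one_self[of "real a * (\<epsilon> * ln 2)"] by linarith
      moreover have "exp (real a * (\<epsilon> * ln 2)) = 2 powr (\<epsilon> * a)" by (simp add: powr_def mult_ac)
      ultimately have "real a * (\<epsilon> * ln 2) \<le> 2 powr (\<epsilon> * a)" by linarith
      hence "real a \<le> 2 powr (\<epsilon> * a) / (\<epsilon> * ln 2)" using e by (simp add: field_simps)
      moreover have "1 \<le> 2 powr (\<epsilon> * a)" using e by (simp add: ge_one_powr_ge_zero)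
      ultimately have "real (a + 1) \<le> 2 powr (\<epsilon> * a) * C" by (simp add: C algebra_simps)
      also have "\<dots> \<le> real p powr (\<epsilon> * a) * C"
        using p2 e C1 by (intro mult_right_mono powr_mono2) auto
      finally show ?thesis using True by simp
    next
      case False
      have "real (a + 1) \<le> 2 ^ a" by (induction a) auto
      also have "\<dots> \<le> (real p powr \<epsilon>) ^ a"
      proof (rule power_mono)
        have "real K powr \<epsilon> \<le> real p powr \<epsilon>" using False e by (intro powr_mono2) auto
        thus "2 \<le> real p powr \<epsilon>" using K by linarith
      qed simp
      also have "\<dots> = real p powr (\<epsilon> * a)" using p2 by (simp add: powr_powr flip: powr_realpow)
      finally show ?thesis using False by simp
    qed
    have card: "C ^ card {q \<in> prime_factors n. q < K} = (if p < K then C else 1) * C ^ card {q \<in> prime_factors m. q < K}"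
    proof -
      have "{q \<in> prime_factors n. q < K} = (if p < K then insert p {q \<in> prime_factors m. q < K} else {q \<in> prime_factors m. q < K})"
        using pf by auto
      thus ?thesis using pn by simp
    qed
    have "real (tau n) \<le> real (a + 1) * real (tau m)"
      using tau_mult_le[of "p^a" m] m0 p tau_prime_power[OF p(1), of a] prime_gt_0_nat[OF p(1)] 
      by (simp add: m(1) flip: of_nat_mult of_nat_Suc)
    also have "\<dots> \<le> (real p powr (\<epsilon> * a) * (if p < K then C else 1)) * (real m powr \<epsilon> * C ^ card {q \<in> prime_factors m. q < K})"
      using key less.IH[OF mn m0] C1 by (intro mult_mono) auto
    also have "\<dots> = real n powr \<epsilon> * C ^ card {p \<in> prime_factors n. p < K}"
      unfolding card np by simp
    finally show ?thesis .
  qed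
qed

lemma tau_bound:
  fixes \<epsilon> :: real
  assumes "\<epsilon> > 0"
  obtains C where "C \<ge> 1" "\<And>n. n > 0 \<Longrightarrow> real (tau n) \<le> C * real n powr \<epsilon>"
proof -
  define K where "K = nat \<lceil>2 powr (1 / \<epsilon>)\<rceil>"
  define C where "C = 1 + 1 / (\<epsilon> * ln 2)"
  have C1: "C \<ge> 1" using assms by (simp add: C_def)
  have "2 = (2 powr (1/\<epsilon>)) powr \<epsilon>" using assms by (simp add: powr_powr)
  also have "\<dots> \<le> real K powr \<epsilon>" unfolding K_def using assms
    by (intro powr_mono2) (auto simp: real_nat_ceiling_ge)
  finally have K: "real K powr \<epsilon> \<ge> 2" .
  show ?thesis
  proof (rule that[of "C ^ K"])
    fix n :: nat assume n: "n > 0"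
    have "card {p \<in> prime_factors n. p < K} \<le> card {..<K}" by (intro card_mono) auto
    hence "C ^ card {p \<in> prime_factors n. p < K} \<le> C ^ K" using C1 by (intro power_increasing) auto
    thus "real (tau n) \<le> C ^ K * real n powr \<epsilon>"
      using tau_bound_aux[OF assms K C_def n] 
      by (smt (verit) mult.commute mult_left_mono powr_ge_zero)
  qed (use C1 in simp)
qed


section \<open>The sum of divisors and its damped variant\<close>

lemma divisor_sum_mult:
  assumes "coprime m n" "m > 0" "n > 0"
  shows "divisor_sum (m * n) = divisor_sum m * divisor_sum n"
proof -
  have "bij_betw (\<lambda>(a, b). a * b) ({d. d dvd m} \<times> {d. d dvd n}) {d. d dvd m * n}"
    unfolding bij_betw_def
  proof
    show "inj_on (\<lambda>(a, b). a * b) ({d. d dvd m} \<times> {d. d dvd n})"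
    proof (rule inj_onI, clarsimp)
      fix a b a' b' assume A: "a dvd m" "b dvd n" "a' dvd m" "b' dvd n" "a * b = a' * b'"
      have "coprime a b'" "coprime a' b" using A assms by (meson coprime_divisors)+
      hence "a dvd a'" "a' dvd a" using A(5)
        by (metis coprime_dvd_mult_left_iff dvd_triv_left)+
      hence "a = a'" by (simp add: dvd_antisym)
      moreover have "a > 0" using A assms by (auto intro: gr0I)
      ultimately show "a = a' \<and> b = b'" using A by simp
    qed
    show "(\<lambda>(a, b). a * b) ` ({d. d dvd m} \<times> {d. d dvd n}) = {d. d dvd m * n}"
      by (auto elim!: dvd_productE intro: mult_dvd_mono)
  qed
  hence "(\<Sum>d | d dvd m * n. d) = (\<Sum>(a,b)\<in>{d. d dvd m} \<times> {d. d dvd n}. a * b)"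
    using sum.reindex_bij_betw[of "\<lambda>(a, b). a * b" _ _ "\<lambda>d. d"] by (metis (no_types, lifting) case_prod_unfold sum.cong)
  thus ?thesis by (simp add: divisor_sum_def sum_product sum.cartesian_product)
qed

lemma divisor_sum_prime: "prime p \<Longrightarrow> divisor_sum p = p + 1"
proof -
  assume p: "prime p"
  have "{d. d dvd p} = {1, p}" using p by (auto simp: prime_nat_iff)
  thus ?thesis using p prime_gt_1_nat[OF p] by (simp add: divisor_sum_def)
qed

lemma divisor_sum_ge: "n > 0 \<Longrightarrow> divisor_sum n \<ge> n"
  unfolding divisor_sum_def by (rule member_le_sum) auto

lemma divisor_sum_pos: "n > 0 \<Longrightarrow> divisor_sum n > 0"
  using divisor_sum_ge[of n] by linarith

lemma sum_divisors_inverse: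
  fixes f :: "nat \<Rightarrow> 'a :: comm_monoid_add"
  assumes "n > (0::nat)"
  shows "(\<Sum>d | d dvd n. f (n div d)) = (\<Sum>d | d dvd n. f d)"
  by (rule sum.reindex_bij_witness[of _ "\<lambda>d. n div d" "\<lambda>d. n div d"]) (use assms in auto)

text \<open>Sending d to n / d turns sigma(n) / n into the sum of 1 / d over the divisors, part of a
  harmonic sum. This is what makes the quotient k of the two divisor sums logarithmic.\<close>

lemma divisor_sum_le:
  assumes "n \<ge> 1"
  shows "real (divisor_sum n) \<le> real n * (1 + ln (real n))"
proof -
  have "real (divisor_sum n) = (\<Sum>d | d dvd n. real (n div d))"
    using assms by (subst sum_divisors_inverse) (auto simp: divisor_sum_def)
  also have "\<dots> = real n * (\<Sum>d | d dvd n. 1 / real d)"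
    by (simp add: sum_distrib_left real_of_nat_div)
  also have "\<dots> \<le> real n * (1 + ln (real n))"
    using assms by (intro mult_left_mono harm_le_one_plus_ln_real) (auto intro: dvd_imp_le gr0I simp: Suc_le_eq)
  finally show ?thesis .
qed

lemma divisor_sum_prime_power_le:
  assumes "prime p"
  shows "divisor_sum (p ^ a) \<le> 2 * p ^ a"
proof -
  have eq: "{d. d dvd p ^ a} = (\<lambda>i. p ^ i) ` {..a}" 
    using assms by (auto simp: divides_primepow_nat)
  have inj: "inj_on (\<lambda>i. p ^ i) {..a}" using assms
    by (auto intro!: inj_onI simp: prime_power_inj)
  have "divisor_sum (p ^ a) = (\<Sum>i\<le>a. p ^ i)"
    unfolding divisor_sum_def eq by (subst sum.reindex[OF inj]) simp
  moreover have "(\<Sum>i\<le>a. p ^ i) \<le> 2 * p ^ a"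
  proof (induction a)
    case (Suc a)
    have "2 * p ^ a \<le> p * p ^ a" by (intro mult_right_mono prime_ge_2_nat[OF assms]) simp
    with Suc have "(\<Sum>i\<le>a. p ^ i) \<le> p * p ^ a" by linarith
    thus ?case by simp
  qed simp
  ultimately show ?thesis by simp
qed

text \<open>The divisor sum with a negative exponent, a damped count of divisors. For fixed
  \<epsilon> > 0 its average over integers is bounded, which is what the Euler product of
  \<open>sigma_neg \<epsilon> (divisor_sum m)\<close> requires at the primes.\<close>

definition sigma_neg :: "real \<Rightarrow> nat \<Rightarrow> real" where
  "sigma_neg \<epsilon> n = (\<Sum>d | d dvd n. real d powr (-\<epsilon>))"

lemma sigma_neg_nonneg: "sigma_neg \<epsilon> n \<ge> 0"
  by (auto simp: sigma_neg_def intro: sum_nonneg)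

lemma sigma_neg_mult_le:
  assumes "m > 0" "n > 0"
  shows "sigma_neg \<epsilon> (m * n) \<le> sigma_neg \<epsilon> m * sigma_neg \<epsilon> n"
proof -
  have sub: "{d. d dvd m * n} \<subseteq> (\<lambda>(a, b). a * b) ` ({d. d dvd m} \<times> {d. d dvd n})"
    by (auto elim!: dvd_productE)
  have "sigma_neg \<epsilon> (m * n) \<le> (\<Sum>d\<in>(\<lambda>(a, b). a * b) ` ({d. d dvd m} \<times> {d. d dvd n}). real d powr (-\<epsilon>))"
    unfolding sigma_neg_def using assms by (intro sum_mono2 sub) auto
  also have "\<dots> \<le> (\<Sum>x\<in>{d. d dvd m} \<times> {d. d dvd n}. real (fst x * snd x) powr (-\<epsilon>))"
    using assms by (intro order.trans[OF sum_image_le]) (auto simp: case_prod_unfold)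
  also have "\<dots> = sigma_neg \<epsilon> m * sigma_neg \<epsilon> n"
    by (simp add: sigma_neg_def sum_product sum.cartesian_product powr_mult case_prod_unfold)
  finally show ?thesis .
qed

lemma sigma_neg_le_tau:
  assumes "\<epsilon> \<ge> 0" "n > 0"
  shows "sigma_neg \<epsilon> n \<le> real (tau n)"
proof -
  have "sigma_neg \<epsilon> n \<le> (\<Sum>d | d dvd n. 1)" unfolding sigma_neg_def
  proof (rule sum_mono)
    fix d assume "d \<in> {d. d dvd n}"
    hence "real d \<ge> 1" using assms by (auto intro: gr0I simp: Suc_le_eq)
    thus "real d powr (-\<epsilon>) \<le> 1" using assms powr_mono[of "-\<epsilon>" 0 "real d"] by simp
  qed
  thus ?thesis by (simp add: tau_def)
qed

section \<open>Euler products and Rankin's trick\<close>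

text \<open>Submultiplicativity is what the intended g provides: \<open>divisor_sum\<close> is
  multiplicative, but its values at coprime arguments may share factors, so \<open>sigma_neg\<close>
  of them satisfies only an inequality. The cap A on the exponents keeps every sum finite. The
  induction on P splits off the full power of one prime.\<close>

lemma sum_le_euler_product:
  fixes g :: "nat \<Rightarrow> real"
  assumes fin: "finite P" and pr: "\<And>p. p \<in> P \<Longrightarrow> prime p"
    and g0: "\<And>n. g n \<ge> 0" and g1: "g 1 \<le> 1"
    and sub: "\<And>p a m. prime p \<Longrightarrow> a > 0 \<Longrightarrow> m > 0 \<Longrightarrow> \<not> p dvd m \<Longrightarrow> g (p ^ a * m) \<le> g (p ^ a) * g m"
  shows "\<lbrakk>finite S; \<And>n. n \<in> S \<Longrightarrow> n > 0; \<And>n. n \<in> S \<Longrightarrow> prime_factors n \<subseteq> P;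
          \<And>n p. n \<in> S \<Longrightarrow> p \<in> P \<Longrightarrow> multiplicity p n \<le> A\<rbrakk> \<Longrightarrow>
         (\<Sum>n\<in>S. g n) \<le> (\<Prod>p\<in>P. 1 + (\<Sum>a=1..A. g (p ^ a)))"
  using fin pr
proof (induction P arbitrary: S rule: finite_induct)
  case empty
  have "S \<subseteq> {1}" using empty by (force simp: prime_factorization_empty_iff)
  hence "(\<Sum>n\<in>S. g n) \<le> (\<Sum>n\<in>{1}. g n)" by (intro sum_mono2 g0) auto
  thus ?case using g1 by simp
next
  case (insert p P)
  have p: "prime p" using insert.prems by simp
  define T where "T = (\<lambda>n. n div p ^ multiplicity p n) ` S"
  have T: "finite T" using insert.prems by (simp add: T_def)
  have dec: "n = p ^ multiplicity p n * (n div p ^ multiplicity p n)" 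
    "\<not> p dvd n div p ^ multiplicity p n" "n div p ^ multiplicity p n > 0" if "n \<in> S" for n
  proof -
    have n0: "n > 0" using insert.prems that by blast
    show "n = p ^ multiplicity p n * (n div p ^ multiplicity p n)"
      by (simp add: multiplicity_dvd)
    show "\<not> p dvd n div p ^ multiplicity p n"
      using multiplicity_decompose[of n p] n0 not_prime_unit[of p] p by blast
    then show "n div p ^ multiplicity p n > 0" by (auto intro: gr0I)
  qed
  have IH: "(\<Sum>m\<in>T. g m) \<le> (\<Prod>p\<in>P. 1 + (\<Sum>a=1..A. g (p ^ a)))"
  proof (rule insert.IH)
    fix m assume "m \<in> T"
    then obtain n where n: "n \<in> S" "m = n div p ^ multiplicity p n" by (auto simp: T_def)
    have mn: "m dvd n" "n > 0" using dec[OF n(1)] n insert.prems(2) by (metis dvd_triv_right) (use n insert.prems(2) in blast)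
    show "m > 0" using dec[OF n(1)] n by simp
    show "prime_factors m \<subseteq> P"
    proof
      fix q assume q: "q \<in> prime_factors m"
      hence "q \<in> prime_factors n" using mn by (auto dest: dvd_trans simp: prime_factors_dvd)
      moreover have "q \<noteq> p" using q dec[OF n(1)] n by (auto simp: prime_factors_dvd)
      ultimately show "q \<in> P" using insert.prems(3)[OF n(1)] by auto
    qed
    fix q assume "q \<in> P"
    have "multiplicity q m \<le> multiplicity q n" using mn by (intro dvd_imp_multiplicity_le) auto
    thus "multiplicity q m \<le> A" using insert.prems(4)[OF n(1), of q] \<open>q \<in> P\<close> by simp
  qed (use T insert.prems in auto)
  have "(\<Sum>n\<in>S. g n) \<le> (\<Sum>n\<in>(\<lambda>(a, m). p ^ a * m) ` ({0..A} \<times> T). g n)"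
  proof -
    have "S \<subseteq> (\<lambda>(a, m). p ^ a * m) ` ({0..A} \<times> T)"
    proof
      fix n assume n: "n \<in> S"
      have "(multiplicity p n, n div p ^ multiplicity p n) \<in> {0..A} \<times> T"
        using n insert.prems(4)[OF n, of p] by (auto simp: T_def)
      thus "n \<in> (\<lambda>(a, m). p ^ a * m) ` ({0..A} \<times> T)" using dec(1)[OF n] by (force simp: image_iff)
    qed
    thus ?thesis using T g0 by (intro sum_mono2) auto
  qed
  also have "\<dots> \<le> (\<Sum>(a, m)\<in>{0..A} \<times> T. g (p ^ a * m))"
    using T g0 by (intro order.trans[OF sum_image_le]) (auto simp: case_prod_unfold)
  also have "\<dots> \<le> (\<Sum>(a, m)\<in>{0..A} \<times> T. (if a = 0 then 1 else g (p ^ a)) * g m)"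
  proof (rule sum_mono, clarify)
    fix a m assume "m \<in> T"
    hence "m > 0" "\<not> p dvd m" using dec by (auto simp: T_def)
    thus "g (p ^ a * m) \<le> (if a = 0 then 1 else g (p ^ a)) * g m" using sub[OF p, of a m] by simp
  qed
  also have "\<dots> = (\<Sum>a=0..A. if a = 0 then 1 else g (p ^ a)) * (\<Sum>m\<in>T. g m)"
    by (simp add: sum_product sum.cartesian_product)
  also have "(\<Sum>a=0..A. if a = 0 then 1 else g (p ^ a)) = 1 + (\<Sum>a=1..A. g (p ^ a))"
    by (simp add: sum.atLeast_Suc_atMost)
  also have "(1 + (\<Sum>a=1..A. g (p ^ a))) * (\<Sum>m\<in>T. g m) \<le> (1 + (\<Sum>a=1..A. g (p ^ a))) * (\<Prod>p\<in>P. 1 + (\<Sum>a=1..A. g (p ^ a)))"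
    using IH g0 by (intro mult_left_mono) (auto intro!: add_nonneg_nonneg sum_nonneg)
  finally show ?case using insert.hyps by simp
qed

lemma prime_factors_Prod_primes:
  assumes "finite X" "\<And>p. p \<in> X \<Longrightarrow> prime (p::nat)"
  shows "prime_factors (\<Prod>X) = X"
proof -
  have "0 \<notin> X" using assms(2)[of 0] by auto
  hence "prime_factors (\<Prod>X) = (\<Union>p\<in>X. prime_factors p)" using assms(1) by (subst prime_factors_prod) auto
  also have "\<dots> = (\<Union>p\<in>X. {p})" using assms(2) by (intro SUP_cong refl prime_prime_factors) auto
  finally show ?thesis by simp
qed

text \<open>This lets finite sets of primes stand for squarefree integers, so that sums over
  \<open>Pow P\<close> can be compared with sums over integers.\<close>

lemma inj_on_Prod_primes:
  assumes "finite P" "\<And>p. p \<in> P \<Longrightarrow> prime (p::nat)"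
  shows "inj_on (\<lambda>X. \<Prod>X) (Pow P)"
proof (rule inj_onI)
  fix X Y assume XY: "X \<in> Pow P" "Y \<in> Pow P" "\<Prod>X = \<Prod>Y"
  have "prime_factors (\<Prod>Z) = Z" if "Z \<in> Pow P" for Z
    using that finite_subset[of Z P] assms by (intro prime_factors_Prod_primes) auto
  thus "X = Y" using XY by metis
qed

text \<open>Comparing the finite product of \<open>1 + p\<^bsup>-s\<^esup>\<close> with \<open>\<zeta>(s)\<close> at \<open>s = 1 + 1 / ln y\<close>.\<close>
lemma sum_primes_inverse_le:
  fixes y :: real
  assumes "y > 1"
  shows "(\<Sum>p | prime p \<and> real p \<le> y. 1 / real p) \<le> 5 * ln (1 + ln y)"
proof -
  define P where "P = {p::nat. prime p \<and> real p \<le> y}"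
  define s where "s = 1 / ln y"
  have s: "s > 0" using assms by (simp add: s_def)
  have sub: "P \<subseteq> {..nat \<lfloor>y\<rfloor>}" by (auto simp: P_def le_nat_floor)
  have fin: "finite P" using finite_subset[OF sub] by simp
  define u where "u = (\<lambda>p::nat. real p powr (-(1 + s)))"
  have pP: "prime p" "real p \<le> y" "real p \<ge> 2" if "p \<in> P" for p using that prime_ge_2_nat[of p]
    by (auto simp: P_def)
  have u01: "0 \<le> u p" "u p \<le> 1" if "p \<in> P" for p
    using pP[OF that] s powr_mono[of "-(1+s)" 0 "real p"] by (auto simp: u_def)
  have inj: "inj_on (\<lambda>X. \<Prod>X) (Pow P)" using fin pP(1) by (rule inj_on_Prod_primes)
  have "(\<Prod>p\<in>P. 1 + u p) = (\<Sum>X\<in>Pow P. \<Prod>p\<in>X. u p)"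
    using prod_add[OF fin, of u "\<lambda>_. 1"] by (simp add: add.commute)
  also have "\<dots> = (\<Sum>X\<in>Pow P. real (\<Prod>X) powr (-(1+s)))"
    by (intro sum.cong refl) (simp add: u_def prod_powr_distrib)
  also have "\<dots> = (\<Sum>n\<in>(\<lambda>X. \<Prod>X) ` Pow P. real n powr (-(1+s)))"
    by (subst sum.reindex[OF inj]) simp
  also have "\<dots> \<le> 1 + 1 / s"
  proof (rule sum_powr_le[OF s])
    show "0 \<notin> (\<lambda>X. \<Prod>X) ` Pow P"
    proof
      assume "0 \<in> (\<lambda>X. \<Prod>X) ` Pow P"
      then obtain X where X: "X \<subseteq> P" "\<Prod>X = 0" by auto
      hence "0 \<in> X" using finite_subset[OF X(1) fin] by simp
      thus False using X(1) pP(1)[of 0] by auto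
    qed
  qed (use fin in simp)
  finally have prod_le: "(\<Prod>p\<in>P. 1 + u p) \<le> 1 + ln y" by (simp add: s_def)
  have "2 powr (\<Sum>p\<in>P. u p) = (\<Prod>p\<in>P. 2 powr u p)" by (simp add: powr_sum fin)
  also have "\<dots> \<le> (\<Prod>p\<in>P. 1 + u p)"
  proof (rule prod_mono, safe)
    fix p assume p: "p \<in> P"
    \<comment> \<open>Convexity bounds exp by its chord over [0, ln 2], hence 2^u <= 1 + u on
      [0, 1]. An upper bound for the product thus controls the sum of the \<open>u p\<close>, at the
      price of 1 / ln 2.\<close>
    have "exp (u p * ln 2) \<le> (1 - u p) * exp 0 + u p * exp (ln 2)"
      using convex_onD[OF exp_convex, of "u p" 0 "ln 2"] u01[OF p] by simp
    thus "2 powr u p \<le> 1 + u p" by (simp add: powr_def)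
  qed simp
  finally have "2 powr (\<Sum>p\<in>P. u p) \<le> 1 + ln y" using prod_le by linarith
  hence "ln (2 powr (\<Sum>p\<in>P. u p)) \<le> ln (1 + ln y)" using assms by (subst ln_le_cancel_iff) (auto simp: add_pos_pos)
  hence A: "(\<Sum>p\<in>P. u p) * ln 2 \<le> ln (1 + ln y)" by (simp add: ln_powr)
  have "(\<Sum>p\<in>P. 1 / real p) \<le> (\<Sum>p\<in>P. exp 1 * u p)"
  proof (rule sum_mono)
    fix p assume p: "p \<in> P"
    \<comment> \<open>For p <= y the factor p^s is at most y^s = e, so the exponent 1 + s may be
      lowered to 1. The constant 5 covers e / ln 2.\<close>
    have "real p powr s \<le> y powr s" using pP[OF p] s by (intro powr_mono2) auto
    also have "y powr s = exp 1" using assms by (simp add: powr_def s_def)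
    finally have "real p powr s \<le> exp 1" .
    moreover have "1 / real p = real p powr s * u p"
      using pP[OF p] by (simp add: u_def powr_add[symmetric] powr_minus_divide)
    ultimately show "1 / real p \<le> exp 1 * u p" using u01[OF p] by (simp add: mult_right_mono)
  qed
  also have "\<dots> = exp 1 * (\<Sum>p\<in>P. u p)" by (simp add: sum_distrib_left)
  also have "\<dots> \<le> (5 * ln 2) * (\<Sum>p\<in>P. u p)"
  proof (rule mult_right_mono)
    have "exp 1 \<le> (272 / 100::real)" using e_less_272 by linarith
    thus "exp 1 \<le> (5 * ln 2 :: real)" using ln2_ge_two_thirds by linarith
  qed (use u01 in \<open>auto intro: sum_nonneg\<close>)
  also have "\<dots> \<le> 5 * ln (1 + ln y)" using A by (simp add: mult_ac)
  finally show ?thesis by (simp add: P_def)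
qed


lemma prime_factors_le:
  assumes "n \<in> S" "\<And>n. n \<in> S \<Longrightarrow> n > (0::nat) \<and> real n \<le> X"
  shows "prime_factors n \<subseteq> {p. prime p \<and> real p \<le> X}"
proof
  fix p assume p: "p \<in> prime_factors n"
  hence "p \<le> n" using assms by (auto intro: dvd_imp_le)
  thus "p \<in> {p. prime p \<and> real p \<le> X}" using assms p by fastforce
qed

lemma multiplicity_le_self:
  assumes "prime p" "n > (0::nat)"
  shows "multiplicity p n \<le> n"
proof -
  have "multiplicity p n < p ^ multiplicity p n"
    using prime_gt_1_nat[OF assms(1)] by (intro power_gt_expt) simp
  also have "\<dots> \<le> n" using assms by (intro dvd_imp_le multiplicity_dvd) auto
  finally show ?thesis by simp
qed

lemma finite_nat_le_real: "finite {n::nat. P n \<and> real n \<le> x}"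
  by (rule finite_subset[of _ "{..nat \<lfloor>x\<rfloor>}"]) (auto simp: le_nat_floor)

lemma geometric_tail_le:
  fixes q :: real
  assumes "0 \<le> q" "q < 1"
  shows "(\<Sum>a=k..A. q ^ a) \<le> q ^ k / (1 - q)"
proof (cases "k \<le> A")
  case True
  have "(\<Sum>a=k..A. q ^ a) = (q ^ k - q ^ Suc A) / (1 - q)"
    using sum_gp[of q k A] True assms by auto
  also have "\<dots> \<le> q ^ k / (1 - q)" using assms by (intro divide_right_mono) auto
  finally show ?thesis .
qed (use assms in simp)

section \<open>Counting smooth numbers\<close>

definition smooth :: "real \<Rightarrow> nat \<Rightarrow> bool" where
  "smooth y n \<longleftrightarrow> (\<forall>p. prime p \<longrightarrow> p dvd n \<longrightarrow> real p \<le> y)"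

text \<open>Rankin's trick.\<close>
lemma card_smooth_le:
  fixes X y \<eta> :: real
  assumes X: "X \<ge> 1" and y: "y > 1" and eta: "0 \<le> \<eta>" "\<eta> \<le> 1 / 2"
  shows "real (card {n. n \<ge> 1 \<and> smooth y n \<and> real n \<le> X})
           \<le> X powr (1 - \<eta>) * exp (20 * y powr \<eta> * ln (1 + ln y))"
proof -
  define \<sigma> where "\<sigma> = 1 - \<eta>"
  have s: "\<sigma> \<ge> 1/2" "\<sigma> \<le> 1" using eta by (auto simp: \<sigma>_def)
  define S where "S = {n. n \<ge> 1 \<and> smooth y n \<and> real n \<le> X}"
  define P where "P = {p::nat. prime p \<and> real p \<le> y}"
  have finS: "finite S" by (rule finite_subset[OF _ finite_nat_le_real[of "\<lambda>_. True" X]]) (auto simp: S_def)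
  have finP: "finite P" unfolding P_def by (rule finite_nat_le_real)
  define g where "g = (\<lambda>n::nat. real n powr (-\<sigma>))"
  have g0: "g n \<ge> 0" for n by (simp add: g_def)
  define A where "A = nat \<lfloor>X\<rfloor>"
  have "X powr (-\<sigma>) * real (card S) = (\<Sum>n\<in>S. X powr (-\<sigma>))" by simp
  also have "\<dots> \<le> (\<Sum>n\<in>S. g n)"
    unfolding g_def using s by (intro sum_mono powr_mono2') (auto simp: S_def)
  also have "\<dots> \<le> (\<Prod>p\<in>P. 1 + (\<Sum>a=1..A. g (p ^ a)))"
  proof (rule sum_le_euler_product[OF finP _ g0])
    fix n assume n: "n \<in> S"
    show "prime_factors n \<subseteq> P" using n by (auto simp: S_def P_def smooth_def)
    fix p assume "p \<in> P"
    hence "multiplicity p n \<le> n" using n by (intro multiplicity_le_self) (auto simp: P_def S_def)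
    thus "multiplicity p n \<le> A" using n by (auto simp: S_def A_def le_nat_floor)
  qed (use finS in \<open>auto simp: P_def S_def g_def powr_mult\<close>)
  also have "\<dots> \<le> (\<Prod>p\<in>P. exp (4 * real p powr (-\<sigma>)))"
  proof (rule prod_mono, safe)
    fix p assume "p \<in> P"
    hence p: "real p \<ge> 2" using prime_ge_2_nat[of p] by (auto simp: P_def)
    define q where "q = real p powr (-\<sigma>)"
    show "0 \<le> 1 + (\<Sum>a=1..A. g (p ^ a))" using g0 by (simp add: add_nonneg_nonneg sum_nonneg)
    \<comment> \<open>Since \<sigma> >= 1/2, every ratio is at most 1 / sqrt 2 < 3/4, so the
      geometric series costs the uniform factor 1 / (1 - 3/4) = 4.\<close>
    have q: "0 \<le> q" "q \<le> 3/4"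
    proof -
      have "q \<le> 2 powr (-\<sigma>)" unfolding q_def using p s by (intro powr_mono2') auto
      also have "\<dots> \<le> 2 powr (-(1/2))" using s by (intro powr_mono) auto
      also have "\<dots> = 1 / sqrt 2" by (simp add: powr_minus powr_half_sqrt field_simps)
      also have "\<dots> \<le> 3/4"
      proof -
        have "4/3 \<le> sqrt (2::real)" by (rule real_le_rsqrt) (simp add: power2_eq_square)
        thus ?thesis by (simp add: field_simps)
      qed
      finally show "q \<le> 3/4" .
    qed (simp add: q_def)
    have "(\<Sum>a=1..A. g (p ^ a)) = (\<Sum>a=1..A. q ^ a)"
    proof (rule sum.cong)
      fix a
      show "g (p ^ a) = q ^ a" using p
        by (simp add: g_def q_def powr_powr mult.commute flip: powr_realpow)
    qed simp
    also have "\<dots> \<le> q / (1 - q)" using geometric_tail_le[of q 1 A] q by simp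
    also have "\<dots> \<le> 4 * q"
    proof -
      have "q \<le> 4 * q * (1 - q)" using q mult_left_mono[of 1 "4 * (1 - q)" q] by (simp add: algebra_simps)
      thus ?thesis using q by (simp add: field_simps)
    qed
    finally have "1 + (\<Sum>a=1..A. g (p ^ a)) \<le> 1 + 4 * q" by simp
    also have "\<dots> \<le> exp (4 * q)" by (rule exp_ge_add_one_self)
    finally show "1 + (\<Sum>a=1..A. g (p ^ a)) \<le> exp (4 * real p powr (-\<sigma>))" by (simp add: q_def)
  qed
  also have "\<dots> = exp (4 * (\<Sum>p\<in>P. real p powr (-\<sigma>)))" by (simp add: exp_sum finP sum_distrib_left)
  also have "\<dots> \<le> exp (4 * (y powr \<eta> * (5 * ln (1 + ln y))))"
  proof -
    have "(\<Sum>p\<in>P. real p powr (-\<sigma>)) \<le> (\<Sum>p\<in>P. y powr \<eta> * (1 / real p))"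
    proof (rule sum_mono)
      fix p assume "p \<in> P"
      hence p: "real p \<ge> 2" "real p \<le> y" using prime_ge_2_nat[of p] by (auto simp: P_def)
      \<comment> \<open>Bounding p^\<eta> by y^\<eta> reduces the sum to that of 1 / p; the
        constants 4 and 5 multiply to 20.\<close>
      have "real p powr (-\<sigma>) = real p powr \<eta> * (1 / real p)"
        using p by (simp add: \<sigma>_def powr_diff)
      also have "\<dots> \<le> y powr \<eta> * (1 / real p)" using p eta by (intro mult_right_mono powr_mono2) auto
      finally show "real p powr (-\<sigma>) \<le> y powr \<eta> * (1 / real p)" .
    qed
    also have "\<dots> = y powr \<eta> * (\<Sum>p\<in>P. 1 / real p)" by (simp add: sum_distrib_left)
    also have "\<dots> \<le> y powr \<eta> * (5 * ln (1 + ln y))"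
      using sum_primes_inverse_le[OF y] by (intro mult_left_mono) (auto simp: P_def)
    finally show ?thesis by simp
  qed
  finally have "X powr (-\<sigma>) * real (card S) \<le> exp (20 * y powr \<eta> * ln (1 + ln y))"
    by (simp add: mult_ac)
  hence "X powr \<sigma> * (X powr (-\<sigma>) * real (card S)) \<le> X powr \<sigma> * exp (20 * y powr \<eta> * ln (1 + ln y))"
    by (intro mult_left_mono) auto
  thus ?thesis using X by (simp add: S_def \<sigma>_def mult.assoc[symmetric] powr_add[symmetric])
qed

section \<open>Divisors of sigma(m), on average over m\<close>

text \<open>At a prime p the Euler factor contains \<open>sigma_neg \<epsilon> (p + 1)\<close>. The
  sum is extended from primes to integers n; writing n + 1 = d j and summing over the pairs (d, j)
  separates the variables. The resulting 1 / \<eta> is affordable because its exponential is later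
  balanced against X^\<eta>. The factor 4 bounds 2^(1 + \<eta>) and comes from n >= (n + 1) /
  2.\<close>

lemma sum_sigma_neg_shift_le:
  fixes \<epsilon> \<eta> :: real
  assumes e: "\<epsilon> > 0" and eta: "0 < \<eta>" "\<eta> \<le> 1" and fin: "finite A" "\<And>n. n \<in> A \<Longrightarrow> n \<ge> 1"
  shows "(\<Sum>n\<in>A. sigma_neg \<epsilon> (n + 1) * real n powr (-(1 + \<eta>))) \<le> 4 * (1 + 1 / \<epsilon>) * (1 + 1 / \<eta>)"
proof -
  define N where "N = Max (insert 1 A) + 1"
  have N: "n + 1 \<le> N" if "n \<in> A" for n using that fin by (simp add: N_def)
  define F where "F = (\<lambda>(d, j). real d powr (-(1+\<epsilon>)) * real j powr (-(1+\<eta>)))"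
  have "(\<Sum>n\<in>A. sigma_neg \<epsilon> (n + 1) * real n powr (-(1 + \<eta>)))
      \<le> (\<Sum>n\<in>A. \<Sum>d | d dvd n + 1. 4 * F (d, (n + 1) div d))"
  proof (rule sum_mono)
    fix n assume n: "n \<in> A"
    have n1: "real n \<ge> 1" using fin(2)[OF n] by simp
    have "real n powr (-(1+\<eta>)) \<le> (real (n + 1) / 2) powr (-(1+\<eta>))"
      using n1 eta by (intro powr_mono2') auto
    also have "\<dots> = 2 powr (1+\<eta>) * real (n+1) powr (-(1+\<eta>))"
    proof -
      have "(x / 2) powr (-k) = 2 powr k * x powr (-k)" if "x > 0" for x k :: real
        using that by (simp add: powr_divide powr_minus field_simps)
      from this[of "real (n+1)" "1+\<eta>"] show ?thesis by simp
    qed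
    also have "\<dots> \<le> 2 powr 2 * real (n+1) powr (-(1+\<eta>))"
      using eta by (intro mult_right_mono powr_mono) auto
    finally have *: "real n powr (-(1+\<eta>)) \<le> 4 * real (n+1) powr (-(1+\<eta>))" by simp
    have "sigma_neg \<epsilon> (n + 1) * real n powr (-(1 + \<eta>)) \<le> sigma_neg \<epsilon> (n+1) * (4 * real (n+1) powr (-(1+\<eta>)))"
      by (intro mult_left_mono * sigma_neg_nonneg)
    also have "\<dots> = (\<Sum>d | d dvd n + 1. 4 * (real d powr (-\<epsilon>) * real (n+1) powr (-(1+\<eta>))))"
      by (simp add: sigma_neg_def sum_distrib_left sum_distrib_right mult_ac)
    also have "\<dots> \<le> (\<Sum>d | d dvd n + 1. 4 * F (d, (n + 1) div d))"
    proof (rule sum_mono)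
      fix d assume "d \<in> {d. d dvd n + 1}"
      then obtain j where j: "n + 1 = d * j" by auto
      hence dj: "d \<ge> 1" "j \<ge> 1" by (cases d; cases j; simp)+
      have "real (n+1) powr (-(1+\<eta>)) = real d powr (-(1+\<eta>)) * real j powr (-(1+\<eta>))"
        by (simp only: j of_nat_mult powr_mult)
      also have "\<dots> \<le> real d powr (-1) * real j powr (-(1+\<eta>))"
        using dj eta by (intro mult_right_mono powr_mono) auto
      finally have "real d powr (-\<epsilon>) * real (n+1) powr (-(1+\<eta>)) \<le> 
            real d powr (-\<epsilon>) * (real d powr (-1) * real j powr (-(1+\<eta>)))" by (intro mult_left_mono) auto
      also have "\<dots> = F (d, (n + 1) div d)"
      proof -
        have "(n + 1) div d = j" using j dj by simp
        moreover have "real d powr (-\<epsilon>) * real d powr (-1) = real d powr (-(1+\<epsilon>))"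
          by (simp only: powr_add[symmetric]) (simp add: add.commute[of _ "-\<epsilon>"] algebra_simps)
        ultimately show ?thesis by (simp only: F_def case_prod_conv mult.assoc[symmetric])
      qed
      finally show "4 * (real d powr (-\<epsilon>) * real (n+1) powr (-(1+\<eta>))) \<le> 4 * F (d, (n + 1) div d)" by simp
    qed
    finally show "sigma_neg \<epsilon> (n + 1) * real n powr (-(1 + \<eta>)) \<le> (\<Sum>d | d dvd n + 1. 4 * F (d, (n + 1) div d))" .
  qed
  also have "\<dots> = (\<Sum>(n, d)\<in>Sigma A (\<lambda>n. {d. d dvd n + 1}). 4 * F (d, (n + 1) div d))"
    using fin by (subst sum.Sigma) auto
  also have "\<dots> = (\<Sum>dj\<in>(\<lambda>(n, d). (d, (n + 1) div d)) ` Sigma A (\<lambda>n. {d. d dvd n + 1}). 4 * F dj)"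
  proof (subst sum.reindex)
    show "inj_on (\<lambda>(n, d). (d, (n + 1) div d)) (Sigma A (\<lambda>n. {d. d dvd n + 1}))"
      by (rule inj_onI) (auto elim!: dvdE split: if_splits)
  qed (auto intro!: sum.cong)
  also have "\<dots> \<le> (\<Sum>dj\<in>{1..N} \<times> {1..N}. 4 * F dj)"
  proof (rule sum_mono2)
    show "(\<lambda>(n, d). (d, (n + 1) div d)) ` Sigma A (\<lambda>n. {d. d dvd n + 1}) \<subseteq> {1..N} \<times> {1..N}"
    proof clarify
      fix n d assume n: "n \<in> A" and d: "d dvd n + 1"
      then obtain j where j: "n + 1 = d * j" by auto
      hence dj: "d \<ge> 1" "j \<ge> 1" by (cases d; cases j; simp)+
      have "d \<le> n + 1" "j \<le> n + 1" using j dj by simp_all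
      moreover have "(n + 1) div d = j" using j dj by simp
      ultimately show "d \<in> {1..N} \<and> (n + 1) div d \<in> {1..N}" using dj N[OF n] by simp
    qed
  qed (auto simp: F_def)
  also have "\<dots> = 4 * ((\<Sum>d=1..N. real d powr (-(1+\<epsilon>))) * (\<Sum>j=1..N. real j powr (-(1+\<eta>))))"
  proof -
    have "(\<Sum>dj\<in>{1..N} \<times> {1..N}. F dj) = (\<Sum>d=1..N. real d powr (-(1+\<epsilon>))) * (\<Sum>j=1..N. real j powr (-(1+\<eta>)))"
      by (simp only: F_def sum_product sum.cartesian_product)
    thus ?thesis by (simp only: sum_distrib_left[symmetric])
  qed
  also have "\<dots> \<le> 4 * ((1 + 1/\<epsilon>) * (1 + 1/\<eta>))"
    using e eta by (intro mult_left_mono mult_mono sum_powr_le) (auto intro: sum_nonneg)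
  finally show ?thesis by (simp only: mult.assoc)
qed

text \<open>Rankin's trick once more, at the exponent \<open>1 + 1 / \<surd>(ln X)\<close>.\<close>
lemma sum_sigma_neg_divisor_sum_le:
  fixes \<epsilon> :: real
  assumes e: "\<epsilon> > 0"
  obtains C where "C \<ge> 0" 
    "\<And>X. X \<ge> exp 1 \<Longrightarrow> (\<Sum>m | m \<ge> 1 \<and> real m \<le> X. sigma_neg \<epsilon> (divisor_sum m) / real m) \<le> exp (C * sqrt (ln X))"
proof -
  obtain C1 where C1: "C1 \<ge> 1" "\<And>n. n > 0 \<Longrightarrow> real (tau n) \<le> C1 * real n powr (1/4)"
    using tau_bound[of "1/4"] by auto
  define C2 where "C2 = 2 * C1 * (1 / (1 - 2 powr (-3/4)))"
  define C where "C = 1 + (4 * (1 + 1/\<epsilon>)) * 2 + C2 * 3"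
  have q0: "2 powr (-3/4) < (1::real)" using powr_less_mono[of "-3/4" 0 "2::real"] by simp
  have C2: "C2 \<ge> 0" using C1 q0 by (simp add: C2_def)
  show ?thesis
  proof (rule that[of C])
    show "C \<ge> 0" using e C2 by (simp add: C_def)
    fix X :: real assume X: "X \<ge> exp 1"
    have lnX: "ln X \<ge> 1" using X by (simp add: ln_ge_iff less_le_trans[OF exp_gt_zero])
    have X0: "X > 0" "X \<ge> 1" using X by (auto intro: less_le_trans[OF exp_gt_zero]) (smt (verit) exp_ge_add_one_self)
    define r where "r = sqrt (ln X)"
    have r: "r \<ge> 1" using lnX by (simp add: r_def)
    \<comment> \<open>Rankin's trick costs X^\<eta> = exp (\<eta> r^2) and the Euler product exp (O
      (1 / \<eta>)); the two balance at \<eta> = 1 / r.\<close>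
    define \<eta> where "\<eta> = 1 / r"
    have eta: "0 < \<eta>" "\<eta> \<le> 1" using r by (auto simp: \<eta>_def)
    define S where "S = {m::nat. m \<ge> 1 \<and> real m \<le> X}"
    define P where "P = {p::nat. prime p \<and> real p \<le> X}"
    have finS: "finite S" unfolding S_def by (rule finite_nat_le_real)
    have finP: "finite P" unfolding P_def by (rule finite_nat_le_real)
    define g where "g = (\<lambda>n. sigma_neg \<epsilon> (divisor_sum n) * real n powr (-(1 + \<eta>)))"
    have g0: "g n \<ge> 0" for n by (simp add: g_def sigma_neg_nonneg)
    define A where "A = nat \<lfloor>X\<rfloor>"
    have A1: "A \<ge> 1" using X0 by (simp add: A_def le_nat_floor)
    have "(\<Sum>m\<in>S. sigma_neg \<epsilon> (divisor_sum m) / real m) \<le> (\<Sum>m\<in>S. X powr \<eta> * g m)"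
    proof (rule sum_mono)
      fix m assume "m \<in> S"
      hence m: "real m \<ge> 1" "real m \<le> X" by (auto simp: S_def)
      have "1 / real m = real m powr \<eta> * real m powr (-(1+\<eta>))"
        using m by (simp add: powr_add[symmetric] powr_minus field_simps)
      also have "\<dots> \<le> X powr \<eta> * real m powr (-(1+\<eta>))"
        using m eta by (intro mult_right_mono powr_mono2) auto
      finally have "sigma_neg \<epsilon> (divisor_sum m) * (1 / real m) \<le> sigma_neg \<epsilon> (divisor_sum m) * (X powr \<eta> * real m powr (-(1+\<eta>)))"
        by (intro mult_left_mono sigma_neg_nonneg)
      thus "sigma_neg \<epsilon> (divisor_sum m) / real m \<le> X powr \<eta> * g m" by (simp add: g_def mult_ac)
    qed
    also have "\<dots> = X powr \<eta> * (\<Sum>m\<in>S. g m)" by (simp add: sum_distrib_left)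
    also have "(\<Sum>m\<in>S. g m) \<le> (\<Prod>p\<in>P. 1 + (\<Sum>a=1..A. g (p ^ a)))"
    proof (rule sum_le_euler_product[OF finP _ g0])
      fix n assume n: "n \<in> S"
      show "prime_factors n \<subseteq> P" unfolding P_def by (rule prime_factors_le[OF n]) (auto simp: S_def)
      fix p assume "p \<in> P"
      hence "multiplicity p n \<le> n" using n by (intro multiplicity_le_self) (auto simp: P_def S_def)
      thus "multiplicity p n \<le> A" using n by (auto simp: S_def A_def le_nat_floor)
    next
      fix p a m :: nat assume A: "prime p" "a > 0" "m > 0" "\<not> p dvd m"
      have "coprime (p ^ a) m" using A by (simp add: prime_imp_coprime)
      hence "divisor_sum (p ^ a * m) = divisor_sum (p ^ a) * divisor_sum m"
        using A by (intro divisor_sum_mult) (auto simp: prime_gt_0_nat)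
      hence "sigma_neg \<epsilon> (divisor_sum (p ^ a * m)) \<le> sigma_neg \<epsilon> (divisor_sum (p ^ a)) * sigma_neg \<epsilon> (divisor_sum m)"
        using A by (simp add: sigma_neg_mult_le divisor_sum_pos prime_gt_0_nat)
      hence "sigma_neg \<epsilon> (divisor_sum (p ^ a * m)) * (real (p ^ a) powr (-(1+\<eta>)) * real m powr (-(1+\<eta>)))
        \<le> sigma_neg \<epsilon> (divisor_sum (p ^ a)) * sigma_neg \<epsilon> (divisor_sum m) * (real (p ^ a) powr (-(1+\<eta>)) * real m powr (-(1+\<eta>)))"
        by (intro mult_right_mono) auto
      thus "g (p ^ a * m) \<le> g (p ^ a) * g m" unfolding g_def of_nat_mult powr_mult by (simp only: mult_ac)
    next
      have "divisor_sum 1 = 1" by (simp add: divisor_sum_def)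
      thus "g 1 \<le> 1" by (simp add: g_def sigma_neg_def)
    qed (use finS in \<open>auto simp: P_def S_def\<close>)
    also have "\<dots> \<le> (\<Prod>p\<in>P. exp (g p + C2 * real p powr (-(3/2))))"
    proof (rule prod_mono, safe)
      fix p assume "p \<in> P"
      hence pr: "prime p" and p: "real p \<ge> 2" using prime_ge_2_nat[of p] by (auto simp: P_def)
      show "0 \<le> 1 + (\<Sum>a=1..A. g (p ^ a))" using g0 by (simp add: add_nonneg_nonneg sum_nonneg)
      define q where "q = real p powr (-(3/4))"
      have q: "0 \<le> q" "q \<le> 2 powr (-3/4)" using p by (auto simp: q_def intro!: powr_mono2')
      \<comment> \<open>For a >= 2 the pointwise divisor bound is enough: the exponent 1/4 gives
        p^(-3a/4), and from a = 2 on these sum to O (p^(-3/2)), which converges over p. Only a = 1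
        needs the average over p + 1.\<close>
      have gpa: "g (p ^ a) \<le> 2 * C1 * q ^ a" for a
      proof -
        have pa: "real p ^ a \<ge> 1" using p by simp
        have "sigma_neg \<epsilon> (divisor_sum (p ^ a)) \<le> real (tau (divisor_sum (p ^ a)))"
          using e p by (intro sigma_neg_le_tau divisor_sum_pos) auto
        also have "\<dots> \<le> C1 * real (divisor_sum (p ^ a)) powr (1/4)"
          using p by (intro C1 divisor_sum_pos) auto
        also have "\<dots> \<le> C1 * (2 * real p ^ a) powr (1/4)"
        proof -
          have "real (divisor_sum (p ^ a)) \<le> real (2 * p ^ a)"
            using divisor_sum_prime_power_le[OF pr, of a] of_nat_le_iff by blast
          thus ?thesis using C1 by (intro mult_left_mono powr_mono2) auto
        qed
        also have "\<dots> \<le> C1 * (2 * (real p ^ a) powr (1/4))"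
        proof -
          have "2 powr (1/4) \<le> 2 powr (1::real)" by (intro powr_mono) auto
          thus ?thesis using C1 by (simp add: powr_mult mult_right_mono)
        qed
        finally have "g (p ^ a) \<le> C1 * (2 * (real p ^ a) powr (1/4)) * (real p ^ a) powr (-(1+\<eta>))"
          unfolding g_def by (simp add: mult_right_mono)
        also have "\<dots> \<le> C1 * (2 * (real p ^ a) powr (1/4)) * (real p ^ a) powr (-1)"
          using C1 pa eta by (intro mult_left_mono powr_mono) auto
        also have "\<dots> = 2 * C1 * ((real p ^ a) powr (1/4) * (real p ^ a) powr (-1))" by simp
        also have "(real p ^ a) powr (1/4) * (real p ^ a) powr (-1) = (real p ^ a) powr (-(3/4))"
          by (simp only: powr_add[symmetric]) simp
        also have "\<dots> = q ^ a" using p by (simp add: q_def powr_powr mult.commute flip: powr_realpow)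
        finally show ?thesis .
      qed
      have "(\<Sum>a=1..A. g (p ^ a)) = g p + (\<Sum>a=2..A. g (p ^ a))"
        using A1 by (simp add: sum.atLeast_Suc_atMost numeral_2_eq_2)
      also have "(\<Sum>a=2..A. g (p ^ a)) \<le> (\<Sum>a=2..A. 2 * C1 * q ^ a)" by (intro sum_mono gpa)
      also have "\<dots> = 2 * C1 * (\<Sum>a=2..A. q ^ a)" by (simp add: sum_distrib_left)
      also have "\<dots> \<le> 2 * C1 * (q ^ 2 / (1 - q))"
        using q q0 C1 by (intro mult_left_mono geometric_tail_le) auto
      also have "\<dots> \<le> 2 * C1 * (q ^ 2 / (1 - 2 powr (-3/4)))"
        using q q0 C1 by (intro mult_left_mono divide_left_mono) auto
      also have "\<dots> = C2 * q ^ 2" by (simp add: C2_def)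
      also have "q ^ 2 = real p powr (-(3/2))" using p by (simp add: q_def power2_eq_square powr_add[symmetric])
      finally have "1 + (\<Sum>a=1..A. g (p ^ a)) \<le> 1 + (g p + C2 * real p powr (-(3/2)))" by simp
      also have "\<dots> \<le> exp (g p + C2 * real p powr (-(3/2)))" by (rule exp_ge_add_one_self)
      finally show "1 + (\<Sum>a=1..A. g (p ^ a)) \<le> exp (g p + C2 * real p powr (-(3/2)))" .
    qed
    also have "\<dots> = exp ((\<Sum>p\<in>P. g p) + C2 * (\<Sum>p\<in>P. real p powr (-(3/2))))"
      by (simp add: exp_sum finP sum_distrib_left sum.distrib flip: exp_sum)
    also have "\<dots> \<le> exp (4 * (1 + 1/\<epsilon>) * (1 + 1/\<eta>) + C2 * 3)"
    proof -
      have "(\<Sum>p\<in>P. g p) = (\<Sum>p\<in>P. sigma_neg \<epsilon> (p + 1) * real p powr (-(1 + \<eta>)))"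
        by (intro sum.cong refl) (auto simp: g_def P_def divisor_sum_prime)
      also have "\<dots> \<le> 4 * (1 + 1/\<epsilon>) * (1 + 1/\<eta>)"
        using prime_ge_1_nat by (intro sum_sigma_neg_shift_le e eta finP) (auto simp: P_def)
      finally have 1: "(\<Sum>p\<in>P. g p) \<le> 4 * (1 + 1/\<epsilon>) * (1 + 1/\<eta>)" .
      have "(\<Sum>p\<in>P. real p powr (-(1 + 1/2))) \<le> 1 + 1 / (1/2)"
        by (intro sum_powr_le finP) (auto simp: P_def)
      hence "C2 * (\<Sum>p\<in>P. real p powr (-(3/2))) \<le> C2 * 3"
        using C2 by (intro mult_left_mono) auto
      with 1 show ?thesis by simp
    qed
    finally have "(\<Sum>m\<in>S. sigma_neg \<epsilon> (divisor_sum m) / real m) \<le> X powr \<eta> * exp (4 * (1 + 1/\<epsilon>) * (1 + 1/\<eta>) + C2 * 3)"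
      by (simp add: mult_left_mono)
    also have "X powr \<eta> = exp r"
    proof -
      have "ln X = r * r" using lnX by (simp add: r_def)
      thus ?thesis using X0 r by (simp add: powr_def \<eta>_def)
    qed
    also have "exp r * exp (4 * (1 + 1/\<epsilon>) * (1 + 1/\<eta>) + C2 * 3) = exp (r + 4 * (1 + 1/\<epsilon>) * (1 + r) + C2 * 3)"
      by (simp add: exp_add \<eta>_def)
    also have "\<dots> \<le> exp (C * r)"
    proof -
      have "4 * (1 + 1/\<epsilon>) * (1 + r) \<le> 4 * (1 + 1/\<epsilon>) * (2 * r)" using r e by (intro mult_left_mono) auto
      moreover have "C2 * 3 \<le> C2 * 3 * r" using C2 r mult_left_mono[of 1 r "C2 * 3"] by simp
      ultimately have "r + 4 * (1 + 1/\<epsilon>) * (1 + r) + C2 * 3 \<le> C * r"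
        unfolding C_def by (simp add: algebra_simps)
      thus ?thesis by simp
    qed
    finally show "(\<Sum>m | m \<ge> 1 \<and> real m \<le> X. sigma_neg \<epsilon> (divisor_sum m) / real m) \<le> exp (C * sqrt (ln X))"
      by (simp add: S_def r_def)
  qed
qed


section \<open>Selberg's sieve\<close>

lemma sum_crt:
  fixes f k :: "nat \<Rightarrow> real"
  assumes "coprime m n" "m > 0" "n > 0"
  shows "(\<Sum>L<m * n. f (L mod m) * k (L mod n)) = (\<Sum>a<m. f a) * (\<Sum>b<n. k b)"
proof -
  let ?\<phi> = "\<lambda>L. (L mod m, L mod n)"
  have inj: "inj_on ?\<phi> {..<m * n}"
  proof (rule inj_onI)
    fix x y assume xy: "x \<in> {..<m * n}" "y \<in> {..<m * n}" "?\<phi> x = ?\<phi> y"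
    hence "[x = y] (mod m * n)" using assms(1) by (intro coprime_cong_mult_nat) (auto simp: cong_def)
    thus "x = y" using xy by (auto simp: cong_def)
  qed
  have "?\<phi> ` {..<m * n} = {..<m} \<times> {..<n}"
  proof (rule card_subset_eq)
    show "card (?\<phi> ` {..<m * n}) = card ({..<m} \<times> {..<n})"
      by (simp add: card_image[OF inj] card_cartesian_product)
  qed (use assms in auto)
  hence "(\<Sum>(a, b)\<in>{..<m} \<times> {..<n}. f a * k b) = (\<Sum>L<m * n. f (L mod m) * k (L mod n))"
    using sum.reindex[OF inj, of "\<lambda>(a, b). f a * k b"] by (simp add: case_prod_unfold)
  thus ?thesis by (simp add: sum_product sum.cartesian_product)
qed

lemma sum_crt_primes:
  fixes f :: "nat \<Rightarrow> nat \<Rightarrow> real"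
  assumes "finite S" "\<And>p. p \<in> S \<Longrightarrow> prime p"
  shows "(\<Sum>L<\<Prod>S. \<Prod>p\<in>S. f p (L mod p)) = (\<Prod>p\<in>S. \<Sum>a<p. f p a)"
  using assms
proof (induction S rule: finite_induct)
  case (insert q S)
  have cop: "coprime q (\<Prod>S)"
  proof (rule prod_coprime_right)
    fix p assume "p \<in> S"
    thus "coprime q p" using insert.hyps insert.prems by (intro primes_coprime) auto
  qed
  have pos: "q > 0" "\<Prod>S > 0" using insert.prems prime_gt_0_nat by (auto intro!: prod_pos)
  have "(\<Sum>L<\<Prod>(insert q S). \<Prod>p\<in>insert q S. f p (L mod p)) =
        (\<Sum>L<q * \<Prod>S. f q (L mod q) * (\<Prod>p\<in>S. f p ((L mod \<Prod>S) mod p)))"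
    using insert.hyps dvd_prodI[of S _ "\<lambda>x. x"] by (auto intro!: sum.cong prod.cong simp: mod_mod_cancel)
  also have "\<dots> = (\<Sum>a<q. f q a) * (\<Sum>b<\<Prod>S. \<Prod>p\<in>S. f p (b mod p))"
    by (rule sum_crt[OF cop pos])
  finally show ?case using insert by simp
qed simp

lemma sum_periodic:
  fixes F :: "nat \<Rightarrow> real"
  assumes per: "\<And>L. F (L + m) = F L" and bd: "\<And>L. \<bar>F L\<bar> \<le> 1" and m: "m > 0"
  shows "(\<Sum>L<N. F L) \<le> real (N div m) * (\<Sum>L<m. F L) + real m"
proof -
  have per': "F (k * m + L) = F L" for k L
  proof (induction k)
    case (Suc k)
    have "F (Suc k * m + L) = F ((k * m + L) + m)" by (simp add: add_ac)
    with Suc show ?case by (simp only: per)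
  qed simp
  have add: "(\<Sum>L<a + b. F L) = (\<Sum>L<a. F L) + (\<Sum>L<b. F (a + L))" for a b
    by (induction b) auto
  have split: "(\<Sum>L<k * m + r. F L) = real k * (\<Sum>L<m. F L) + (\<Sum>L<r. F L)" for k r
  proof -
    have "(\<Sum>L<k * m. F L) = real k * (\<Sum>L<m. F L)"
    proof (induction k)
      case (Suc k)
      have "(\<Sum>L<Suc k * m. F L) = (\<Sum>L<k * m + m. F L)" by (simp add: add.commute)
      also have "\<dots> = (\<Sum>L<k * m. F L) + (\<Sum>L<m. F L)" by (simp only: add per')
      finally show ?case using Suc by (simp add: algebra_simps)
    qed simp
    thus ?thesis by (simp add: add per')
  qed
  have "(\<Sum>L<N mod m. F L) \<le> (\<Sum>L<N mod m. 1)"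
    using bd by (intro sum_mono) (auto simp: abs_le_iff)
  also have "\<dots> \<le> real m" using m by simp
  finally show ?thesis using split[of "N div m" "N mod m"] by simp
qed

text \<open>\<open>\<Omega> p\<close> is the set of residues removed modulo p. Removing at most half
  of them keeps \<open>g p\<close> at most 1 and hence all values of \<open>w\<close> and
  \<open>W\<close> bounded by 1, which controls incomplete periods.\<close>

locale residue_sieve =
  fixes P :: "nat set" and \<Omega> :: "nat \<Rightarrow> nat set"
  assumes fin: "finite P" and pr: "\<And>p. p \<in> P \<Longrightarrow> prime p"
    and Om: "\<And>p. p \<in> P \<Longrightarrow> \<Omega> p \<subseteq> {..<p}"
    and card_Om: "\<And>p. p \<in> P \<Longrightarrow> 2 * card (\<Omega> p) \<le> p"
begin

text \<open>Selberg's weight \<rho>(p) / (p - \<rho>(p)), where \<rho>(p) counts the removed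
  residues.\<close>

definition g :: "nat \<Rightarrow> real" where
  "g p = real (card (\<Omega> p)) / (real p - real (card (\<Omega> p)))"

text \<open>The indicator of the removed residues, centred and rescaled: once the value on
  \<open>\<Omega> p\<close> is -1, mean zero forces the value \<open>g p\<close> elsewhere, and the
  mean square is then \<open>g p\<close> as well.\<close>

definition w :: "nat \<Rightarrow> nat \<Rightarrow> real" where
  "w p L = (if L mod p \<in> \<Omega> p then -1 else g p)"

definition W :: "nat set \<Rightarrow> nat \<Rightarrow> real" where
  "W S L = (\<Prod>p\<in>S. w p L)"

lemma g_bounds: "p \<in> P \<Longrightarrow> 0 \<le> g p \<and> g p \<le> 1"
  using card_Om[of p] pr[of p] prime_gt_0_nat[of p] by (auto simp: g_def field_simps)

lemma sum_w:
  assumes "p \<in> P"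
  shows "(\<Sum>a<p. w p a) = 0" "(\<Sum>a<p. (w p a)\<^sup>2) = real p * g p"
proof -
  let ?k = "real (card (\<Omega> p))"
  have split: "{..<p} = \<Omega> p \<union> ({..<p} - \<Omega> p)" using Om[OF assms] by auto
  have finO: "finite (\<Omega> p)" using Om[OF assms] finite_subset by blast
  have le: "card (\<Omega> p) \<le> p" using card_Om[OF assms] by simp
  have c: "real (card ({..<p} - \<Omega> p)) = real p - ?k"
    using card_Diff_subset[OF finO Om[OF assms]] le by simp
  have pk: "real p - ?k > 0" using card_Om[OF assms] pr[OF assms] prime_gt_0_nat[of p] by linarith
  have gk: "(real p - ?k) * g p = ?k" using pk by (simp add: g_def)
  have sum_eq: "(\<Sum>a<p. F (w p a)) = ?k * F (-1) + (real p - ?k) * F (g p)" for F :: "real \<Rightarrow> real"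
  proof -
    have "(\<Sum>a<p. F (w p a)) = (\<Sum>a\<in>\<Omega> p. F (w p a)) + (\<Sum>a\<in>{..<p} - \<Omega> p. F (w p a))"
      by (subst split, subst sum.union_disjoint) (use finO in auto)
    also have "(\<Sum>a\<in>\<Omega> p. F (w p a)) = (\<Sum>a\<in>\<Omega> p. F (-1))"
      using Om[OF assms] by (intro sum.cong) (auto simp: w_def)
    also have "(\<Sum>a\<in>{..<p} - \<Omega> p. F (w p a)) = (\<Sum>a\<in>{..<p} - \<Omega> p. F (g p))"
      by (intro sum.cong) (auto simp: w_def)
    finally show ?thesis by (simp add: c)
  qed
  show "(\<Sum>a<p. w p a) = 0" using sum_eq[of "\<lambda>x. x"] gk by simp
  have "(\<Sum>a<p. (w p a)\<^sup>2) = ?k + (real p - ?k) * g p * g p" 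
    using sum_eq[of "\<lambda>x. x\<^sup>2"] by (simp add: power2_eq_square)
  also have "\<dots> = (real p - ?k) * g p + ?k * g p" unfolding gk by simp
  also have "\<dots> = real p * g p" by (simp add: algebra_simps)
  finally show "(\<Sum>a<p. (w p a)\<^sup>2) = real p * g p" .
qed

lemma abs_W_le: "S \<subseteq> P \<Longrightarrow> \<bar>W S L\<bar> \<le> 1"
  unfolding W_def abs_prod using g_bounds by (intro prod_le_1) (auto simp: w_def)

lemma W_add_period: "(\<And>p. p \<in> S \<Longrightarrow> p dvd m) \<Longrightarrow> W S (L + m) = W S L"
  unfolding W_def w_def by (intro prod.cong refl) (metis mod_add_right_eq add.right_neutral dvd_imp_mod_0)

text \<open>By the Chinese remainder theorem the sum factors over the primes of S \<union> T. A
  prime lying in exactly one of the two sets contributes the vanishing sum of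
  \<open>w p\<close>.\<close>

lemma sum_W_full_period:
  assumes "S \<subseteq> P" "T \<subseteq> P"
  shows "(\<Sum>L<\<Prod>(S \<union> T). W S L * W T L) = (if S = T then real (\<Prod>S) * (\<Prod>p\<in>S. g p) else 0)"
proof -
  have finST: "finite S" "finite T" using assms fin finite_subset by blast+
  define f where "f = (\<lambda>p a. (if p \<in> S then w p a else 1) * (if p \<in> T then w p a else 1))"
  have w_mod: "w p (L mod p) = w p L" for p L by (simp add: w_def)
  have "W S L * W T L = (\<Prod>p\<in>S \<union> T. f p (L mod p))" for L
  proof -
    have "W S L = (\<Prod>p\<in>S \<union> T. if p \<in> S then w p (L mod p) else 1)"
      unfolding W_def using finST by (subst prod.inter_restrict[symmetric]) (auto simp: w_mod Int_absorb1)
    moreover have "W T L = (\<Prod>p\<in>S \<union> T. if p \<in> T then w p (L mod p) else 1)"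
      unfolding W_def using finST by (subst prod.inter_restrict[symmetric]) (auto simp: w_mod Int_absorb1)
    ultimately show ?thesis by (simp add: f_def prod.distrib)
  qed
  hence "(\<Sum>L<\<Prod>(S \<union> T). W S L * W T L) = (\<Sum>L<\<Prod>(S \<union> T). \<Prod>p\<in>S \<union> T. f p (L mod p))" by simp
  also have "\<dots> = (\<Prod>p\<in>S \<union> T. \<Sum>a<p. f p a)"
    using assms finST by (intro sum_crt_primes) (auto intro: pr)
  also have "\<dots> = (if S = T then real (\<Prod>S) * (\<Prod>p\<in>S. g p) else 0)"
  proof (cases "S = T")
    case True
    have "(\<Prod>p\<in>S. \<Sum>a<p. f p a) = (\<Prod>p\<in>S. real p * g p)"
      using assms True sum_w(2) by (intro prod.cong refl) (auto simp: f_def power2_eq_square)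
    thus ?thesis using True by (simp add: prod.distrib)
  next
    case False
    then obtain p where p: "p \<in> S \<union> T" "\<not> (p \<in> S \<and> p \<in> T)" by blast
    have "p \<in> P" using p assms by blast
    hence "(\<Sum>a<p. f p a) = 0" using p sum_w(1) by (auto simp: f_def)
    thus ?thesis using False finST p(1) by (subst prod_zero) auto
  qed
  finally show ?thesis .
qed

definition index_sets :: "real \<Rightarrow> nat set set" where
  "index_sets z = {S. S \<subseteq> P \<and> real (\<Prod>S) \<le> z}"

text \<open>Selberg's sum of the multiplicative extension of g over squarefree integers up to z with
  all prime factors in P. Its reciprocal is the density in the sieve bound.\<close>

definition mass :: "real \<Rightarrow> real" where
  "mass z = (\<Sum>S\<in>index_sets z. \<Prod>p\<in>S. g p)"

lemma index_sets: "finite (index_sets z)" "S \<in> index_sets z \<Longrightarrow> finite S"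
    "S \<in> index_sets z \<Longrightarrow> p \<in> S \<Longrightarrow> prime p"
    "z \<ge> 1 \<Longrightarrow> real (card (index_sets z)) \<le> z"
proof -
  have sub: "index_sets z \<subseteq> Pow P" by (auto simp: index_sets_def)
  show fi: "finite (index_sets z)" using finite_subset[OF sub] fin by simp
  show fS: "S \<in> index_sets z \<Longrightarrow> finite S" using finite_subset[OF _ fin] sub by blast
  show pS: "S \<in> index_sets z \<Longrightarrow> p \<in> S \<Longrightarrow> prime p" using pr sub by blast
  assume z: "z \<ge> 1"
  have inj: "inj_on (\<lambda>S. \<Prod>S) (index_sets z)"
    using inj_on_Prod_primes[OF fin pr] sub inj_on_subset by blast
  have "(\<lambda>S. \<Prod>S) ` index_sets z \<subseteq> {1..nat \<lfloor>z\<rfloor>}"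
  proof (rule image_subsetI)
    fix S assume S: "S \<in> index_sets z"
    have "\<Prod>S > 0" using S pr sub prime_gt_0_nat by (intro prod_pos) blast
    moreover have "\<Prod>S \<le> nat \<lfloor>z\<rfloor>" using S by (auto simp: index_sets_def intro: le_nat_floor)
    ultimately show "\<Prod>S \<in> {1..nat \<lfloor>z\<rfloor>}" by simp
  qed
  from card_mono[OF _ this] card_image[OF inj] have "card (index_sets z) \<le> nat \<lfloor>z\<rfloor>" by simp
  thus "real (card (index_sets z)) \<le> z" using z by linarith
qed

lemma mass_ge_1: "z \<ge> 1 \<Longrightarrow> mass z \<ge> 1"
proof -
  assume z: "z \<ge> 1"
  have "(\<Sum>S\<in>{{}}. \<Prod>p\<in>S. g p) \<le> mass z" unfolding mass_def
    using z g_bounds by (intro sum_mono2 index_sets prod_nonneg) (auto simp: index_sets_def)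
  thus ?thesis by simp
qed

text \<open>The functions \<open>W S\<close> are orthogonal over a full period, with square mean \<open>\<Prod>p\<in>S. g p\<close>,
  and their sum equals \<open>mass z\<close> at every unsifted \<open>L\<close>. Estimating the second moment of that sum
  gives Selberg's bound without choosing any sieve weights.\<close>
lemma card_unsifted_le:
  assumes z: "z \<ge> 1"
  shows "real (card {L. L < N \<and> (\<forall>p\<in>P. L mod p \<notin> \<Omega> p)}) \<le> real N / mass z + z ^ 4"
proof -
  let ?I = "index_sets z"
  define A where "A = {L. L < N \<and> (\<forall>p\<in>P. L mod p \<notin> \<Omega> p)}"
  have finA: "finite A" by (rule finite_subset[of _ "{..<N}"]) (auto simp: A_def)
  have "real (card A) * (mass z)\<^sup>2 = (\<Sum>L\<in>A. (\<Sum>S\<in>?I. W S L)\<^sup>2)"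
  proof -
    have "(\<Sum>S\<in>?I. W S L) = mass z" if "L \<in> A" for L
      unfolding mass_def W_def using that by (intro sum.cong prod.cong refl) (auto simp: w_def A_def index_sets_def)
    thus ?thesis by simp
  qed
  also have "\<dots> \<le> (\<Sum>L<N. (\<Sum>S\<in>?I. W S L)\<^sup>2)"
    by (rule sum_mono2) (auto simp: A_def)
  also have "\<dots> = (\<Sum>L<N. \<Sum>S\<in>?I. \<Sum>T\<in>?I. W S L * W T L)"
    by (simp add: power2_eq_square sum_product)
  also have "\<dots> = (\<Sum>S\<in>?I. \<Sum>L<N. \<Sum>T\<in>?I. W S L * W T L)" by (rule sum.swap)
  also have "\<dots> = (\<Sum>S\<in>?I. \<Sum>T\<in>?I. \<Sum>L<N. W S L * W T L)" by (intro sum.cong refl sum.swap)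
  also have "\<dots> \<le> (\<Sum>S\<in>?I. \<Sum>T\<in>?I. (if S = T then real N * (\<Prod>p\<in>S. g p) else 0) + z\<^sup>2)"
  proof (intro sum_mono)
    fix S T assume ST: "S \<in> ?I" "T \<in> ?I"
    hence sub: "S \<subseteq> P" "T \<subseteq> P" by (auto simp: index_sets_def)
    have finST: "finite S" "finite T" using ST index_sets by auto
    \<comment> \<open>The common period is the lcm of two integers up to z, hence at most z^2. An
      incomplete period costs at most that much for each of at most z^2 pairs, whence z^4.\<close>
    define m where "m = \<Prod>(S \<union> T)"
    have m0: "m > 0" unfolding m_def using ST index_sets(3) prime_gt_0_nat by (intro prod_pos) blast
    have S1: "\<Prod>S > 0" using ST index_sets(3) prime_gt_0_nat by (intro prod_pos) blast
    have gS: "(\<Prod>p\<in>S. g p) \<ge> 0" using sub g_bounds by (intro prod_nonneg) auto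
    have "m dvd \<Prod>S * \<Prod>T"
      unfolding m_def using finST prod.union_inter[of S T "\<lambda>x. x"] by (metis dvd_triv_left)
    hence "m \<le> \<Prod>S * \<Prod>T" using ST index_sets(3) prime_gt_0_nat
      by (intro dvd_imp_le) (auto intro!: prod_pos simp: S1)
    hence "real m \<le> real (\<Prod>S) * real (\<Prod>T)" by (metis of_nat_le_iff of_nat_mult)
    also have "\<dots> \<le> z * z" using ST z by (intro mult_mono) (auto simp: index_sets_def intro!: prod_nonneg)
    finally have mz: "real m \<le> z\<^sup>2" by (simp add: power2_eq_square)
    have "(\<Sum>L<N. W S L * W T L) \<le> real (N div m) * (\<Sum>L<m. W S L * W T L) + real m"
    proof (rule sum_periodic[OF _ _ m0])
      fix L
      show "W S (L + m) * W T (L + m) = W S L * W T L"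
      proof -
        have "p dvd m" if "p \<in> S \<union> T" for p
          unfolding m_def using finST that dvd_prodI[of "S \<union> T" p "\<lambda>x. x"] by simp
        thus ?thesis by (simp add: W_add_period)
      qed
      have "\<bar>W S L\<bar> * \<bar>W T L\<bar> \<le> 1 * 1" using sub by (intro mult_mono abs_W_le) auto
      thus "\<bar>W S L * W T L\<bar> \<le> 1" by (simp add: abs_mult)
    qed
    also have "(\<Sum>L<m. W S L * W T L) = (if S = T then real m * (\<Prod>p\<in>S. g p) else 0)"
      unfolding m_def using sum_W_full_period[OF sub] by simp
    also have "real (N div m) * \<dots> \<le> (if S = T then real N * (\<Prod>p\<in>S. g p) else 0)"
    proof -
      have "real (N div m) * real m \<le> real N"
        by (metis of_nat_le_iff of_nat_mult times_div_less_eq_dividend mult.commute)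
      thus ?thesis using gS by (auto simp: mult.assoc[symmetric] intro!: mult_right_mono)
    qed
    finally show "(\<Sum>L<N. W S L * W T L) \<le> (if S = T then real N * (\<Prod>p\<in>S. g p) else 0) + z\<^sup>2"
      using mz by simp
  qed
  also have "\<dots> = real N * mass z + (real (card ?I))\<^sup>2 * z\<^sup>2"
    by (simp add: sum.distrib index_sets mass_def sum_distrib_left power2_eq_square)
  also have "\<dots> \<le> real N * mass z + z\<^sup>2 * z\<^sup>2"
    using index_sets(4)[OF z] by (intro add_left_mono mult_right_mono power_mono) auto
  finally have *: "real (card A) * (mass z)\<^sup>2 \<le> real N * mass z + z ^ 4" by (simp add: power_add[symmetric])
  have m1: "mass z \<ge> 1" by (rule mass_ge_1[OF z])
  hence "real (card A) \<le> (real N * mass z + z ^ 4) / (mass z)\<^sup>2" using * by (simp add: pos_le_divide_eq)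
  also have "\<dots> = real N / mass z + z ^ 4 / (mass z)\<^sup>2" using m1 by (simp add: add_divide_distrib power2_eq_square)
  also have "\<dots> \<le> real N / mass z + z ^ 4 / 1"
    using m1 z by (intro add_left_mono divide_left_mono) auto
  finally show ?thesis by (simp add: A_def)
qed

end

section \<open>Lower bounds for the sieve mass through sums over squarefree integers\<close>

definition sqfree_sum :: "nat set \<Rightarrow> real \<Rightarrow> real" where
  "sqfree_sum P x = (\<Sum>S | S \<subseteq> P \<and> real (\<Prod>S) \<le> x. 1 / real (\<Prod>S))"

text \<open>Deleting p from a set keeps the product at most x and does not decrease the term, so the
  sets containing p contribute at most as much as those without it.\<close>

lemma sqfree_sum_insert_le:
  assumes "finite P" "p > 0" "\<And>q. q \<in> P \<Longrightarrow> q > 0"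
  shows "sqfree_sum (insert p P) x \<le> 2 * sqfree_sum P x"
proof -
  define I where "I = (\<lambda>P. {S. S \<subseteq> P \<and> real (\<Prod>S) \<le> x})"
  have fI: "finite (I P)" "finite (I (insert p P))"
    unfolding I_def using assms by auto
  show ?thesis
  proof (cases "p \<in> P")
    case True
    have "sqfree_sum P x \<ge> 0" unfolding sqfree_sum_def by (intro sum_nonneg) (simp add: prod_nonneg)
    thus ?thesis using True by (simp add: insert_absorb)
  next
    case False
    have "I (insert p P) \<subseteq> I P \<union> insert p ` I P"
    proof
      fix S assume S: "S \<in> I (insert p P)"
      show "S \<in> I P \<union> insert p ` I P"
      proof (cases "p \<in> S")
        case True
        have fS: "finite S" using S assms finite_subset unfolding I_def by blast
        have "\<Prod>S = p * \<Prod>(S - {p})" by (rule prod.remove[OF fS True])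
        hence "\<Prod>(S - {p}) \<le> \<Prod>S" using assms by simp
        hence "real (\<Prod>(S - {p})) \<le> real (\<Prod>S)" by (rule of_nat_mono)
        hence "real (\<Prod>(S - {p})) \<le> x" "S - {p} \<subseteq> P" using S False unfolding I_def by auto
        hence "S - {p} \<in> I P" unfolding I_def by blast
        thus ?thesis using True by (metis UnI2 imageI insert_Diff)
      qed (use S in \<open>auto simp: I_def\<close>)
    qed
    hence "sqfree_sum (insert p P) x \<le> (\<Sum>S\<in>I P \<union> insert p ` I P. 1 / real (\<Prod>S))"
      unfolding sqfree_sum_def using fI by (intro sum_mono2) (auto simp: I_def prod_nonneg)
    also have "\<dots> \<le> (\<Sum>S\<in>I P. 1 / real (\<Prod>S)) + (\<Sum>S\<in>insert p ` I P. 1 / real (\<Prod>S))"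
    proof -
      have "(\<Sum>S\<in>I P \<inter> insert p ` I P. 1 / real (\<Prod>S)) \<ge> 0" by (intro sum_nonneg) (simp add: prod_nonneg)
      thus ?thesis using fI by (subst sum_Un) auto
    qed
    also have "(\<Sum>S\<in>insert p ` I P. 1 / real (\<Prod>S)) \<le> (\<Sum>S\<in>I P. 1 / real (\<Prod>(insert p S)))"
      using fI by (intro order.trans[OF sum_image_le]) (auto simp: prod_nonneg)
    also have "\<dots> \<le> (\<Sum>S\<in>I P. 1 / real (\<Prod>S))"
    proof (rule sum_mono)
      fix S assume S: "S \<in> I P"
      have fS: "finite S" "p \<notin> S" using S assms finite_subset False unfolding I_def by blast+
      have pos: "\<Prod>S > 0" using S assms unfolding I_def by (intro prod_pos) auto
      have "\<Prod>S \<le> \<Prod>(insert p S)" using fS assms(2) by simp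
      hence le: "real (\<Prod>S) \<le> real (\<Prod>(insert p S))" by (rule of_nat_mono)
      have "real (\<Prod>S) > 0" using pos by (simp only: of_nat_0_less_iff)
      with le show "1 / real (\<Prod>(insert p S)) \<le> 1 / real (\<Prod>S)"
        by (intro frac_le) (simp_all only: order_refl zero_le_one)
    qed
    finally show ?thesis by (simp add: sqfree_sum_def I_def)
  qed
qed

text \<open>The price of not sieving by the primes in Q. The crude factor 2 per prime is later
  absorbed by the divisor bound, since Q will consist of prime factors of one integer M.\<close>

lemma sqfree_sum_remove_le:
  assumes "finite Q" "finite P" "\<And>q. q \<in> P \<union> Q \<Longrightarrow> q > 0"
  shows "sqfree_sum (P \<union> Q) x \<le> 2 ^ card Q * sqfree_sum P x"
  using assms(1,3)
proof (induction Q rule: finite_induct)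
  case (insert q Q)
  have "sqfree_sum (P \<union> insert q Q) x \<le> 2 * sqfree_sum (P \<union> Q) x"
    using sqfree_sum_insert_le[of "P \<union> Q" q x] insert assms(2) by auto
  also have "\<dots> \<le> 2 * (2 ^ card Q * sqfree_sum P x)" using insert by auto
  finally show ?case using insert.hyps by simp
qed simp

lemma Prod_prime_factors_squarefree:
  assumes "squarefree (n :: nat)"
  shows "\<Prod>(prime_factors n) = n"
proof -
  have "n \<noteq> 0" using assms by (intro notI) simp
  have "(\<Prod>p\<in>prime_factors n. p ^ multiplicity p n) = (\<Prod>p\<in>prime_factors n. p)"
  proof (rule prod.cong)
    fix p assume p: "p \<in> prime_factors n"
    hence "prime p" "p dvd n" by auto
    moreover have "\<not> p ^ 2 dvd n" using assms \<open>prime p\<close> by (auto dest: squarefreeD simp: prime_nat_iff)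
    ultimately have "multiplicity p n = 1"
      using \<open>n \<noteq> 0\<close> by (intro multiplicity_eqI) (auto simp: numeral_2_eq_2)
    thus "p ^ multiplicity p n = p" by simp
  qed simp
  thus ?thesis using prime_factorization_nat[of n] \<open>n \<noteq> 0\<close> by simp
qed

text \<open>Every n is uniquely a squarefree number times a square, so the harmonic sum up to x is
  at most the squarefree sum times the sum of 1 / k^2, which is at most 2.\<close>

lemma ln_le_sqfree_sum:
  assumes "x \<ge> 1"
  shows "ln x \<le> 2 * sqfree_sum {p. prime p \<and> real p \<le> x} x"
proof -
  define P where "P = {p::nat. prime p \<and> real p \<le> x}"
  have finP: "finite P" unfolding P_def by (rule finite_nat_le_real)
  define I where "I = {S. S \<subseteq> P \<and> real (\<Prod>S) \<le> x}"
  have fI: "finite I" unfolding I_def using finP by auto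
  define N where "N = nat \<lfloor>x\<rfloor>"
  have N1: "N \<ge> 1" using assms by (simp add: N_def le_nat_floor)
  define \<phi> where "\<phi> = (\<lambda>n::nat. (prime_factors (squarefree_part n), square_part n))"
  have Prod: "\<Prod>(prime_factors (squarefree_part n)) = squarefree_part n" for n :: nat
    by (rule Prod_prime_factors_squarefree[OF squarefree_squarefree_part])
  have Prod': "(\<Prod>p\<in>prime_factors (squarefree_part n). real p) = real (squarefree_part n)" for n :: nat
    by (subst (2) Prod[symmetric]) (simp only: of_nat_prod)
  have "ln x \<le> ln (real N + 1)" using assms by (subst ln_le_cancel_iff) (auto simp: N_def, linarith)
  also have "\<dots> \<le> (\<Sum>n=1..N. 1 / real n)"
    using ln_le_harm[of N] by (simp add: harm_def inverse_eq_divide)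
  also have "\<dots> = (\<Sum>n=1..N. (\<lambda>(S, k). 1 / real (\<Prod>S) * real k powr (-(1+1))) (\<phi> n))"
  proof (rule sum.cong)
    fix n assume n: "n \<in> {1..N}"
    have "real n = real (squarefree_part n) * (real (square_part n))\<^sup>2"
      by (metis squarefree_decompose of_nat_mult of_nat_power)
    moreover have "square_part n > 0" using n by (simp add: zero_less_iff_neq_zero)
    ultimately show "1 / real n = (\<lambda>(S, k). 1 / real (\<Prod>S) * real k powr (-(1+1))) (\<phi> n)"
      by (simp add: \<phi>_def Prod' powr_minus_divide powr_numeral)
  qed simp
  also have "\<dots> = (\<Sum>x\<in>\<phi> ` {1..N}. (\<lambda>(S, k). 1 / real (\<Prod>S) * real k powr (-(1+1))) x)"
  proof (rule sum.reindex[symmetric, unfolded o_def])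
    show "inj_on \<phi> {1..N}"
      by (rule inj_onI) (metis (no_types) \<phi>_def Prod prod.inject squarefree_decompose)
  qed
  also have "\<dots> \<le> (\<Sum>x\<in>I \<times> {1..N}. (\<lambda>(S, k). 1 / real (\<Prod>S) * real k powr (-(1+1))) x)"
  proof (rule sum_mono2)
    show "\<phi> ` {1..N} \<subseteq> I \<times> {1..N}"
    proof (rule image_subsetI)
      fix n assume n: "n \<in> {1..N}"
      have d1: "squarefree_part n dvd n" by (metis squarefree_decompose dvd_triv_left)
      have d2: "square_part n dvd n" by (metis squarefree_decompose dvd_triv_right dvd_mult_left power2_eq_square dvd_trans)
      have le: "squarefree_part n \<le> N" "square_part n \<le> N" 
        using d1 d2 n by (auto dest!: dvd_imp_le)
      have Nx: "real N \<le> x" using assms by (simp add: N_def)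
      have "prime_factors (squarefree_part n) \<subseteq> P"
      proof
        fix p assume p: "p \<in> prime_factors (squarefree_part n)"
        have "p \<le> squarefree_part n" using p by (auto intro!: dvd_imp_le intro: gr0I)
        thus "p \<in> P" using p le Nx by (auto simp: P_def)
      qed
      moreover have "square_part n \<noteq> 0" using n by simp
      hence "square_part n \<ge> 1" by linarith
      ultimately show "\<phi> n \<in> I \<times> {1..N}" using le Nx by (auto simp: \<phi>_def I_def Prod')
    qed
  qed (use fI in \<open>auto simp: prod_nonneg\<close>)
  also have "\<dots> = (\<Sum>S\<in>I. 1 / real (\<Prod>S)) * (\<Sum>k=1..N. real k powr (-(1+1)))"
    by (simp only: sum_product sum.cartesian_product)
  also have "\<dots> \<le> (\<Sum>S\<in>I. 1 / real (\<Prod>S)) * (1 + 1/1)"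
    by (intro mult_left_mono sum_powr_le sum_nonneg) (auto simp: prod_nonneg)
  finally show ?thesis by (simp add: sqfree_sum_def I_def P_def)
qed

text \<open>A pair of squarefree numbers is encoded by the set of their common primes and the two sets of
  the remaining ones; a set of \<open>k\<close> remaining primes is distributed in \<open>2^k\<close> ways.\<close>
lemma sqfree_sum_square_le:
  assumes finP: "finite P" and pr: "\<And>p. p \<in> P \<Longrightarrow> prime p" and x: "x \<ge> 1"
  shows "(sqfree_sum P x)\<^sup>2 \<le> 2 * (\<Sum>S | S \<subseteq> P \<and> real (\<Prod>S) \<le> x\<^sup>2. \<Prod>p\<in>S. 2 / real p)"
proof -
  define I where "I = {S. S \<subseteq> P \<and> real (\<Prod>S) \<le> x}"
  define J where "J = {S. S \<subseteq> P \<and> real (\<Prod>S) \<le> x\<^sup>2}"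
  have fI: "finite I" "finite J" unfolding I_def J_def using finP by auto
  have fS: "finite S" if "S \<subseteq> P" for S using that finP finite_subset by blast
  have pos: "\<Prod>S > 0" if "S \<subseteq> P" for S using that pr prime_gt_0_nat by (intro prod_pos) auto
  define K where "K = Sigma J (\<lambda>T. Pow T)"
  define F where "F = (\<lambda>(U::nat set, T::nat set, A::nat set). real (\<Prod>U) powr (-(1+1)) * (1 / real (\<Prod>T)))"
  define \<phi> where "\<phi> = (\<lambda>(S1::nat set, S2). (S1 \<inter> S2, (S1 \<union> S2) - (S1 \<inter> S2), S1 - S2))"
  have "(sqfree_sum P x)\<^sup>2 = (\<Sum>(S1, S2)\<in>I \<times> I. (1 / real (\<Prod>S1)) * (1 / real (\<Prod>S2)))"
    unfolding sqfree_sum_def power2_eq_square I_def sum_product sum.cartesian_product ..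
  also have "\<dots> = (\<Sum>s\<in>I \<times> I. F (\<phi> s))"
  proof (rule sum.cong, safe)
    fix S1 S2 assume "S1 \<in> I" "S2 \<in> I"
    hence s: "S1 \<subseteq> P" "S2 \<subseteq> P" by (auto simp: I_def)
    let ?U = "S1 \<inter> S2" let ?T = "(S1 \<union> S2) - (S1 \<inter> S2)"
    have "\<Prod>(S1 \<union> S2) * \<Prod>?U = \<Prod>S1 * \<Prod>S2" using fS s by (intro prod.union_inter) auto
    moreover have "\<Prod>(S1 \<union> S2) = \<Prod>?T * \<Prod>?U" using fS s by (intro prod.subset_diff) auto
    ultimately have "\<Prod>S1 * \<Prod>S2 = \<Prod>?T * (\<Prod>?U)\<^sup>2" by (simp add: power2_eq_square)
    hence "real (\<Prod>S1) * real (\<Prod>S2) = real (\<Prod>?T) * (real (\<Prod>?U))\<^sup>2"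
      by (metis of_nat_mult of_nat_power)
    hence "(1 / real (\<Prod>S1)) * (1 / real (\<Prod>S2)) = 1 / (real (\<Prod>?T) * (real (\<Prod>?U))\<^sup>2)" by simp
    also have "\<dots> = F (\<phi> (S1, S2))" using pos[of ?U] s
      by (simp add: F_def \<phi>_def powr_minus_divide prod_nonneg)
    finally show "1 / real (\<Prod>S1) * (1 / real (\<Prod>S2)) = F (\<phi> (S1, S2))" .
  qed
  also have "\<dots> = (\<Sum>s\<in>\<phi> ` (I \<times> I). F s)"
    by (subst sum.reindex) (auto intro!: inj_onI simp: \<phi>_def)
  also have "\<dots> \<le> (\<Sum>s\<in>Pow P \<times> K. F s)"
  proof (rule sum_mono2)
    have "\<forall>T\<in>J. finite (Pow T)" using fS by (auto simp: J_def)
    hence "finite K" unfolding K_def using fI by blast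
    thus "finite (Pow P \<times> K)" using finP by simp
    show "\<phi> ` (I \<times> I) \<subseteq> Pow P \<times> K"
    proof (rule image_subsetI, clarify)
      fix S1 S2 assume S: "S1 \<in> I" "S2 \<in> I"
      hence s: "S1 \<subseteq> P" "S2 \<subseteq> P" by (auto simp: I_def)
      let ?T = "(S1 \<union> S2) - (S1 \<inter> S2)"
      have "\<Prod>?T dvd \<Prod>(S1 \<union> S2)" using fS s by (intro prod_dvd_prod_subset) auto
      also have "\<Prod>(S1 \<union> S2) dvd \<Prod>S1 * \<Prod>S2" using fS s prod.union_inter[of S1 S2 "\<lambda>x. x"] by (metis dvd_triv_left)
      finally have "\<Prod>?T \<le> \<Prod>S1 * \<Prod>S2" using pos s by (intro dvd_imp_le) auto
      hence "real (\<Prod>?T) \<le> real (\<Prod>S1) * real (\<Prod>S2)" by (metis of_nat_le_iff of_nat_mult)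
      also have "\<dots> \<le> x * x" using S x by (intro mult_mono) (auto simp: I_def intro!: prod_nonneg)
      finally show "\<phi> (S1, S2) \<in> Pow P \<times> K" using s by (auto simp: \<phi>_def K_def J_def power2_eq_square)
    qed
    show "F s \<ge> 0" for s by (auto simp: F_def prod_nonneg split: prod.splits)
  qed
  also have "\<dots> = (\<Sum>U\<in>Pow P. real (\<Prod>U) powr (-(1+1))) * (\<Sum>(T, A)\<in>K. 1 / real (\<Prod>T))"
    by (simp add: F_def sum_product sum.cartesian_product case_prod_unfold)
  \<comment> \<open>The common primes occur squared, so they contribute a sum of 1 / n^2, at most 2;
    this is the leading 2 of the bound.\<close>
  also have "(\<Sum>U\<in>Pow P. real (\<Prod>U) powr (-(1+1))) = (\<Sum>n\<in>(\<lambda>U. \<Prod>U) ` Pow P. real n powr (-(1+1)))"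
    by (subst sum.reindex[OF inj_on_Prod_primes[OF finP pr]]) auto
  also have "\<dots> * (\<Sum>(T, A)\<in>K. 1 / real (\<Prod>T)) \<le> (1 + 1/1) * (\<Sum>(T, A)\<in>K. 1 / real (\<Prod>T))"
  proof (intro mult_right_mono sum_powr_le)
    show "0 \<notin> (\<lambda>U. \<Prod>U) ` Pow P"
    proof
      assume "0 \<in> (\<lambda>U. \<Prod>U) ` Pow P"
      then obtain U where "U \<in> Pow P" "0 = \<Prod>U" by (rule imageE)
      thus False using pos[of U] by (metis PowD less_irrefl)
    qed
    show "finite ((\<lambda>U. \<Prod>U) ` Pow P)" using finP by simp
    show "0 \<le> (\<Sum>(T, A)\<in>K. 1 / real (\<Prod>T))" by (intro sum_nonneg) (auto simp: prod_nonneg)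
  qed simp
  also have "(\<Sum>(T, A)\<in>K. 1 / real (\<Prod>T)) = (\<Sum>T\<in>J. \<Sum>A\<in>Pow T. 1 / real (\<Prod>T))"
    unfolding K_def using fI fS by (subst sum.Sigma) (auto simp: J_def)
  also have "\<dots> = (\<Sum>T\<in>J. \<Prod>p\<in>T. 2 / real p)"
    using fS by (intro sum.cong refl) (auto simp: J_def card_Pow prod_dividef)
  finally show ?thesis by (simp add: J_def)
qed


section \<open>The upper bound for \<open>R_count\<close>\<close>

text \<open>Distinct subsets of the prime factors have distinct products, all dividing M. This turns
  factors exponential in the number of prime divisors into small powers of M.\<close>

lemma two_pow_card_prime_factors_le_tau:
  assumes "M > 0"
  shows "2 ^ card (prime_factors M) \<le> tau M"
proof -
  have inj: "inj_on (\<lambda>X. \<Prod>X) (Pow (prime_factors M))"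
    by (rule inj_on_Prod_primes) auto
  have "(\<lambda>X. \<Prod>X) ` Pow (prime_factors M) \<subseteq> {d. d dvd M}"
  proof (rule image_subsetI)
    fix X assume X: "X \<in> Pow (prime_factors M)"
    have "\<Prod>X dvd (\<Prod>p\<in>prime_factors M. p)" using X by (intro prod_dvd_prod_subset) auto
    also have "(\<Prod>p\<in>prime_factors M. p) dvd (\<Prod>p\<in>prime_factors M. p ^ multiplicity p M)"
    proof (rule prod_dvd_prod)
      fix p assume "p \<in> prime_factors M"
      hence "multiplicity p M > 0" using assms by (simp add: prime_factors_multiplicity)
      thus "p dvd p ^ multiplicity p M" by (simp add: dvd_power)
    qed
    also have "\<dots> = M" using prime_factorization_nat[OF assms] by simp
    finally show "\<Prod>X \<in> {d. d dvd M}" by simp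
  qed
  from card_mono[OF _ this] show ?thesis
    using assms by (simp add: card_image[OF inj] card_Pow tau_def)
qed

lemma residue_inverse:
  assumes "prime (p::nat)" "\<not> p dvd a"
  obtains r where "r < p" "[a * r = 1] (mod p)" "\<And>s. s < p \<Longrightarrow> [a * s = 1] (mod p) \<Longrightarrow> s = r"
proof -
  have cop: "coprime a p" using prime_imp_coprime[OF assms] by (simp add: coprime_commute)
  obtain x where x: "[a * x = 1] (mod p)" using cong_solve_coprime_nat[OF cop] by auto
  have p0: "p > 0" using assms prime_gt_0_nat by blast
  show ?thesis
  proof (rule that[of "x mod p"])
    show "x mod p < p" using p0 by simp
    show *: "[a * (x mod p) = 1] (mod p)" using x by (simp add: cong_def mod_mult_right_eq)
    fix s assume s: "s < p" "[a * s = 1] (mod p)"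
    have "[a * s = a * (x mod p)] (mod p)" using s * by (metis cong_trans cong_sym)
    hence "[s = x mod p] (mod p)" using cop by (simp add: cong_mult_lcancel_nat)
    thus "s = x mod p" using s p0 by (simp add: cong_def)
  qed
qed

text \<open>Sieve by the primes p <= t not dividing M, removing the inverses of a and b modulo p:
  for L in one of these classes p divides a L - 1 or b L - 1. The classes are distinct since p does
  not divide b - a, and p >= 5 leaves at least half of the residues.\<close>

lemma card_prime_pairs_le:
  fixes a b M N :: nat and t :: real
  assumes ab: "a \<ge> 1" "b > a" and M: "M > 0"
    and ndvd: "\<And>p. prime p \<Longrightarrow> \<not> p dvd M \<Longrightarrow> p \<ge> 5 \<and> \<not> p dvd a \<and> \<not> p dvd b \<and> \<not> p dvd (b - a)"
    and t: "t > 1"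
  shows "real (card {L. 1 \<le> L \<and> L < N \<and> prime (a * L - 1) \<and> prime (b * L - 1)})
          \<le> t + 1 + t ^ 8 + 8 * 4 ^ card (prime_factors M) * real N / (ln t)\<^sup>2"
proof -
  define P where "P = {p. prime p \<and> real p \<le> t} - prime_factors M"
  define Q where "Q = {p. prime p \<and> real p \<le> t} \<inter> prime_factors M"
  define \<Omega> where "\<Omega> = (\<lambda>p. {r. r < p \<and> ([a * r = 1] (mod p) \<or> [b * r = 1] (mod p))})"
  have finP: "finite P" unfolding P_def by (intro finite_Diff finite_nat_le_real)
  have P: "prime p" "\<not> p dvd M" "real p \<le> t" if "p \<in> P" for p
    using that M by (auto simp: P_def prime_factors_dvd)
  have card2: "card (\<Omega> p) = 2" if pP: "p \<in> P" for p
  proof -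
    note nd = ndvd[OF P(1,2)[OF pP]]
    obtain r where r: "r < p" "[a * r = 1] (mod p)" "\<And>s. s < p \<Longrightarrow> [a * s = 1] (mod p) \<Longrightarrow> s = r"
      using residue_inverse[OF P(1)[OF pP], of a] nd by blast
    obtain s where s: "s < p" "[b * s = 1] (mod p)" "\<And>u. u < p \<Longrightarrow> [b * u = 1] (mod p) \<Longrightarrow> u = s"
      using residue_inverse[OF P(1)[OF pP], of b] nd by blast
    have "\<Omega> p \<subseteq> {r, s}" using r(3) s(3) unfolding \<Omega>_def by blast
    moreover have "{r, s} \<subseteq> \<Omega> p" using r(1,2) s(1,2) unfolding \<Omega>_def by blast
    ultimately have "\<Omega> p = {r, s}" by (rule equalityI)
    moreover have "r \<noteq> s"
    proof
      assume rs: "r = s"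
      have "[a * r = b * r] (mod p)" using r(2) s(2) rs by (metis cong_trans cong_sym)
      moreover have "coprime r p"
        using r(2) by (metis coprime_mult_left_iff cong_imp_coprime cong_sym coprime_1_left)
      ultimately have "[a = b] (mod p)" by (simp add: cong_mult_rcancel_nat)
      hence "[b = a] (mod p)" by (rule cong_sym)
      hence "p dvd b - a" using ab by (simp add: cong_altdef_nat)
      thus False using nd by blast
    qed
    ultimately show ?thesis by simp
  qed
  interpret residue_sieve P \<Omega>
  proof
    fix p assume p: "p \<in> P"
    show "2 * card (\<Omega> p) \<le> p" using card2[OF p] ndvd[OF P(1,2)[OF p]] by simp
  qed (use finP P in \<open>auto simp: \<Omega>_def\<close>)
  \<comment> \<open>The sieve level is t^2, because the square of the squarefree sum up to t is
    compared with a sum up to t^2; the error is (t^2)^4 = t^8.\<close>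
  have t2: "t\<^sup>2 \<ge> 1" using t by simp
  define k where "k = card (prime_factors M)"
  \<comment> \<open>Squaring realises the two removed classes per prime: the square of the sum of
    reciprocals is dominated by a sum with weights 2 / p, and 2 / p <= 2 / (p - 2) =
    \<open>g p\<close>.\<close>
  have mass: "(ln t)\<^sup>2 / (8 * 4 ^ k) \<le> mass (t\<^sup>2)"
  proof -
    have PQ: "P \<union> Q = {p. prime p \<and> real p \<le> t}" by (auto simp: P_def Q_def)
    have "ln t \<le> 2 * sqfree_sum (P \<union> Q) t" using ln_le_sqfree_sum[of t] t by (simp add: PQ)
    also have "sqfree_sum (P \<union> Q) t \<le> 2 ^ card Q * sqfree_sum P t"
      using prime_gt_0_nat by (intro sqfree_sum_remove_le finP) (auto simp: P_def Q_def)
    also have "\<dots> \<le> 2 ^ k * sqfree_sum P t"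
    proof (rule mult_right_mono)
      have "card Q \<le> k" unfolding k_def Q_def by (intro card_mono) auto
      thus "(2::real) ^ card Q \<le> 2 ^ k" by simp
      show "sqfree_sum P t \<ge> 0" unfolding sqfree_sum_def by (intro sum_nonneg) (simp add: prod_nonneg)
    qed
    finally have "ln t \<le> 2 * (2 ^ k * sqfree_sum P t)" by simp
    hence "(ln t)\<^sup>2 \<le> (2 * (2 ^ k * sqfree_sum P t))\<^sup>2" using t by (intro power_mono) auto
    also have "\<dots> = 4 * 4 ^ k * (sqfree_sum P t)\<^sup>2"
      by (simp add: power_mult_distrib power2_eq_square flip: power_mult_distrib)
    also have "\<dots> \<le> 4 * 4 ^ k * (2 * (\<Sum>S | S \<subseteq> P \<and> real (\<Prod>S) \<le> t\<^sup>2. \<Prod>p\<in>S. 2 / real p))"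
      using t P by (intro mult_left_mono sqfree_sum_square_le finP) auto
    also have "(\<Sum>S | S \<subseteq> P \<and> real (\<Prod>S) \<le> t\<^sup>2. \<Prod>p\<in>S. 2 / real p) \<le> mass (t\<^sup>2)"
      unfolding mass_def index_sets_def
    proof (intro sum_mono prod_mono conjI)
      fix S p assume "S \<in> {S. S \<subseteq> P \<and> real (\<Prod>S) \<le> t\<^sup>2}" "p \<in> S"
      hence p: "p \<in> P" by auto
      have "real p \<ge> 5" using ndvd[OF P(1,2)[OF p]] by simp
      thus "2 / real p \<le> g p" by (simp add: g_def card2[OF p] frac_le)
    qed auto
    finally show ?thesis by (simp add: field_simps)
  qed
  define A where "A = {L. 1 \<le> L \<and> L < N \<and> prime (a * L - 1) \<and> prime (b * L - 1)}"
  define U where "U = {L. L < N \<and> (\<forall>p\<in>P. L mod p \<notin> \<Omega> p)}"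
  \<comment> \<open>A prime value c L - 1 could itself be a sieving prime. Beyond L = t + 1 it
    exceeds t; the smaller L are counted trivially.\<close>
  have "A \<subseteq> {1..nat \<lfloor>t + 1\<rfloor>} \<union> U"
  proof
    fix L assume L: "L \<in> A"
    show "L \<in> {1..nat \<lfloor>t + 1\<rfloor>} \<union> U"
    proof (cases "real L \<le> t + 1")
      case True
      hence "L \<le> nat \<lfloor>t + 1\<rfloor>" by (rule le_nat_floor)
      thus ?thesis using L by (simp add: A_def)
    next
      case False
      have big: "real (c * L - 1) > t" if "c \<ge> 1" for c
      proof -
        have "L \<le> c * L" using that by simp
        hence "real L - 1 \<le> real (c * L - 1)" by linarith
        thus ?thesis using False by linarith
      qed
      have "L mod p \<notin> \<Omega> p" if p: "p \<in> P" for p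
      proof
        assume "L mod p \<in> \<Omega> p"
        then obtain c where c: "c = a \<or> c = b" "[c * (L mod p) = 1] (mod p)" by (auto simp: \<Omega>_def)
        have "c \<ge> 1" using c ab by auto
        have "[c * L = 1] (mod p)" using c(2) by (simp add: cong_def mod_mult_right_eq)
        hence "p dvd c * L - 1" using \<open>c \<ge> 1\<close> L by (simp add: cong_altdef_nat A_def)
        moreover have "prime (c * L - 1)" using c(1) L by (auto simp: A_def)
        ultimately have "p = c * L - 1" using P(1)[OF p] by (simp add: primes_dvd_imp_eq)
        thus False using P(3)[OF p] big[OF \<open>c \<ge> 1\<close>] by simp
      qed
      thus ?thesis using L by (auto simp: A_def U_def)
    qed
  qed
  moreover have "finite U" by (rule finite_subset[of _ "{..<N}"]) (auto simp: U_def)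
  ultimately have "card A \<le> card ({1..nat \<lfloor>t + 1\<rfloor>} \<union> U)" by (intro card_mono) auto
  also have "\<dots> \<le> nat \<lfloor>t + 1\<rfloor> + card U" by (rule order.trans[OF card_Un_le]) simp
  finally have "real (card A) \<le> (t + 1) + real (card U)" using t by linarith
  also have "real (card U) \<le> real N / mass (t\<^sup>2) + (t\<^sup>2) ^ 4"
    unfolding U_def by (rule card_unsifted_le[OF t2])
  also have "(t\<^sup>2) ^ 4 = t ^ 8" by (simp flip: power_mult)
  also have "real N / mass (t\<^sup>2) \<le> real N / ((ln t)\<^sup>2 / (8 * 4 ^ k))"
  proof -
    have "(ln t)\<^sup>2 / (8 * 4 ^ k) > 0" using t by simp
    moreover from this have "mass (t\<^sup>2) > 0" using mass by linarith
    ultimately show ?thesis using mass by (intro divide_left_mono mult_pos_pos) auto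
  qed
  also have "\<dots> = 8 * 4 ^ k * real N / (ln t)\<^sup>2" by simp
  finally show ?thesis by (simp add: A_def k_def)
qed

lemma coeffs:
  assumes "v \<ge> 1" "h \<ge> 1"
  shows "a_coeff h v \<ge> 1" "b_coeff h v > a_coeff h v" "a_coeff h v * gcd v h = v"
    "b_coeff h v * gcd v h = v + h" "coprime (a_coeff h v) (b_coeff h v)"
    "(b_coeff h v - a_coeff h v) * gcd v h = h"
proof -
  define d where "d = gcd v h"
  have d: "d > 0" using assms by (simp add: d_def)
  show 1: "a_coeff h v * gcd v h = v" by (simp add: a_coeff_def)
  have "gcd v h dvd v + h" by simp
  thus 2: "b_coeff h v * gcd v h = v + h" unfolding b_coeff_def by (rule dvd_div_mult_self)
  show "a_coeff h v \<ge> 1" using 1 assms by (cases "a_coeff h v") auto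
  have "a_coeff h v * d < b_coeff h v * d" using 1 2 assms by (simp add: d_def)
  thus "b_coeff h v > a_coeff h v" by simp
  have "coprime (v div gcd v (v + h)) ((v + h) div gcd v (v + h))"
    using assms by (intro div_gcd_coprime) auto
  thus "coprime (a_coeff h v) (b_coeff h v)" by (simp add: a_coeff_def b_coeff_def)
  show "(b_coeff h v - a_coeff h v) * gcd v h = h" using 1 2 by (simp add: diff_mult_distrib)
qed

text \<open>For fixed v the admissible L satisfy L <= 2 h x / v^2. The sieve treats v <= x^(1/4),
  uniformly enough for the sum over v to converge. For larger v the trivial count suffices, as the
  tail over v saves a power of x.\<close>

lemma R_count_bound:
  assumes h: "h \<ge> 1"
  obtains C where "C \<ge> 0" "\<And>x. x > 1 \<Longrightarrow> R_count h x \<le> 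
     C * (x powr (1/2) + x / (ln x)\<^sup>2 + x powr (7/8))"
proof -
  obtain C1 where C1: "C1 \<ge> 1" "\<And>n. n > 0 \<Longrightarrow> real (tau n) \<le> C1 * real n powr (1/8)"
    using tau_bound[of "1/8"] by auto
  define H where "H = real h"
  have H1: "H \<ge> 1" using h by (simp add: H_def)
  define C2 where "C2 = C1\<^sup>2 * (6 * H * (1 + H)) powr (1/4)"
  have C2: "C2 \<ge> 0" by (simp add: C2_def)
  define C3 where "C3 = 8 * C2 * (2 * H + 1) * 1024"
  have C3: "C3 \<ge> 0" using C2 H1 by (simp add: C3_def)
  define C where "C = 3 + 3 * C3 + 6 * H"
  show ?thesis
  proof (rule that[of C])
    show "C \<ge> 0" using C3 H1 by (simp add: C_def)
    fix x :: real assume x: "x > 1"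
    \<comment> \<open>Then t^8 = x^(1/4), so the sieve errors over v <= x^(1/4) add up to O
      (x^(1/2)). The loss of 32^2 in \<open>(ln t)^2\<close> is the 1024 in
      \<open>C3\<close>.\<close>
    define t where "t = x powr (1/32)"
    have t: "t > 1" using x by (simp add: t_def)
    have lnt: "ln t = ln x / 32" using x by (simp add: t_def ln_powr)
    define NN where "NN = (\<lambda>v::nat. nat \<lfloor>2 * H * x / (real v)\<^sup>2\<rfloor> + 1)"
    define Ls where "Ls = (\<lambda>v. {L. 1 \<le> L \<and> L < NN v \<and> prime (a_coeff h v * L - 1) \<and> prime (b_coeff h v * L - 1)})"
    define VV where "VV = {2..nat \<lfloor>2 * H * x\<rfloor>}"
    have finL: "finite (Ls v)" for v by (rule finite_subset[of _ "{..<NN v}"]) (auto simp: Ls_def)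
    have sub: "{n \<in> R_set h. 1 \<le> n \<and> real n \<le> x} \<subseteq> (\<lambda>(v, L). (v + h) * p_val h v L) ` (SIGMA v:VV. Ls v)"
    proof
      fix n assume n: "n \<in> {n \<in> R_set h. 1 \<le> n \<and> real n \<le> x}"
      then obtain v L where vL: "n = (v + h) * p_val h v L" "v \<in> V_set h" "L \<ge> 1" 
         "prime (p_val h v L)" "prime (q_val h v L)" "real n \<le> x" by (auto simp: R_set_def)
      have v2: "v \<ge> 2" using vL by (simp add: V_set_def)
      let ?a = "a_coeff h v"
      note co = coeffs[of v h] 
      have p2: "?a * L - 1 \<ge> 2" using prime_ge_2_nat[OF vL(4)] by (simp add: p_val_def)
      \<comment> \<open>\<open>gcd v h\<close> is at most h, so a L >= v L / h; and a L <= 2 (a L -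
        1) because the prime is at least 2. Hence n >= v^2 L / (2 h).\<close>
      have "v * (v * L) = v * ((?a * gcd v h) * L)" using co(3) v2 h by simp
      also have "\<dots> \<le> v * ((?a * h) * L)" using h by (intro mult_left_mono mult_right_mono gcd_le2_nat) auto
      also have "\<dots> = h * (v * (?a * L))" by simp
      also have "\<dots> \<le> h * ((v + h) * (2 * (?a * L - 1)))"
      proof -
        have A: "?a * L \<le> 2 * (?a * L - 1)" using p2 by linarith
        show ?thesis by (rule mult_le_mono[OF le_refl mult_le_mono[OF le_add1 A]])
      qed
      also have "\<dots> = 2 * h * n" by (simp add: vL(1) p_val_def)
      finally have "v * (v * L) \<le> 2 * h * n" .
      hence "real v * (real v * real L) \<le> 2 * H * real n" unfolding H_def by (metis of_nat_le_iff of_nat_mult of_nat_numeral)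
      also have "\<dots> \<le> 2 * H * x" using vL H1 by (intro mult_left_mono) auto
      finally have *: "(real v)\<^sup>2 * real L \<le> 2 * H * x" by (simp add: power2_eq_square mult.assoc)
      hence "real L \<le> 2 * H * x / (real v)\<^sup>2" using v2 by (simp add: field_simps)
      hence "L < NN v" unfolding NN_def by (simp add: le_nat_floor less_Suc_eq_le)
      moreover have "real v * 1 \<le> (real v)\<^sup>2 * real L" using v2 vL(3)
        unfolding power2_eq_square mult.assoc by (intro mult_left_mono) (auto intro: order.trans[of _ "real v * 1"] simp: mult_ge1_I)
      hence "v \<in> VV" using * v2 by (simp add: VV_def le_nat_floor)
      ultimately show "n \<in> (\<lambda>(v, L). (v + h) * p_val h v L) ` (SIGMA v:VV. Ls v)"
        using vL by (auto simp: Ls_def p_val_def q_val_def image_iff intro!: bexI[of _ "(v, L)"])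
    qed
    have "R_count h x \<le> real (card (SIGMA v:VV. Ls v))"
      unfolding R_count_def count_upto_def
      using sub finL by (intro of_nat_mono surj_card_le[where f = "\<lambda>(v, L). (v + h) * p_val h v L"]) (auto simp: VV_def)
    also have "\<dots> = (\<Sum>v\<in>VV. real (card (Ls v)))" using finL by (simp add: VV_def)
    also have "\<dots> \<le> (\<Sum>v\<in>VV. (if real v \<le> x powr (1/4) then 3 * x powr (1/4) else 0)
        + (C3 * x / (ln x)\<^sup>2 + 2 * H * x powr (7/8)) * real v powr (-(1+1/2)))"
    proof (rule sum_mono)
      fix v assume "v \<in> VV"
      hence v2: "v \<ge> 2" by (simp add: VV_def)
      hence v0: "real v > 0" by simp
      show "real (card (Ls v)) \<le> (if real v \<le> x powr (1/4) then 3 * x powr (1/4) else 0)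
        + (C3 * x / (ln x)\<^sup>2 + 2 * H * x powr (7/8)) * real v powr (-(1+1/2))"
      proof (cases "real v \<le> x powr (1/4)")
        case True
        define a where "a = a_coeff h v"
        define b where "b = b_coeff h v"
        note co = coeffs[of v h, folded a_def b_def]
        \<comment> \<open>The factor 6 excludes 2 and 3; the others exclude the primes at which one
          of the two residue classes does not exist or both coincide.\<close>
        define M where "M = 6 * a * b * (b - a)"
        have M0: "M > 0" using co v2 h by (simp add: M_def)
        have "real (card (Ls v)) \<le> t + 1 + t ^ 8 + 8 * 4 ^ card (prime_factors M) * real (NN v) / (ln t)\<^sup>2"
          unfolding Ls_def a_def[symmetric] b_def[symmetric]
        proof (rule card_prime_pairs_le)
          show "a \<ge> 1" "b > a" "M > 0" "t > 1" using co v2 h M0 t by auto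
          fix p assume p: "prime p" "\<not> p dvd M"
          have nd: "\<not> p dvd 6" "\<not> p dvd a" "\<not> p dvd b" "\<not> p dvd (b - a)"
            using p(2) unfolding M_def by (meson dvd_mult dvd_mult2)+
          have "p \<ge> 5"
          proof (rule ccontr)
            assume "\<not> p \<ge> 5"
            hence "p = 0 \<or> p = 1 \<or> p = 2 \<or> p = 3 \<or> p = 4" by linarith
            thus False using p(1) nd(1) by (auto simp: prime_nat_iff dest: spec[of _ 2])
          qed
          thus "p \<ge> 5 \<and> \<not> p dvd a \<and> \<not> p dvd b \<and> \<not> p dvd (b - a)" using nd by blast
        qed
        also have "t + 1 + t ^ 8 \<le> 3 * x powr (1/4)"
        proof -
          have t8: "t ^ 8 = x powr (1/4)" using x by (simp add: t_def powr_powr flip: powr_realpow)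
          have "t ^ 1 \<le> t ^ 8" "t ^ 0 \<le> t ^ 8" using t by (intro power_increasing; simp)+
          thus ?thesis using t8 by simp
        qed
        also have "8 * 4 ^ card (prime_factors M) * real (NN v) / (ln t)\<^sup>2 \<le> 
             8 * (C2 * real v powr (1/2)) * ((2 * H + 1) * x / (real v)\<^sup>2) / (ln t)\<^sup>2"
        proof (intro divide_right_mono mult_mono mult_left_mono)
          have Mle: "real M \<le> 6 * H * (1 + H) * (real v)\<^sup>2"
          proof -
            have g1: "gcd v h \<ge> 1" using h by (simp add: Suc_leI)
            have "a \<le> v" "b \<le> v + h" "b - a \<le> h"
            proof -
              have le: "c \<le> c * gcd v h" for c using g1 by simp
              have v1: "v \<ge> 1" using v2 by simp
              show "a \<le> v" using le[of a] unfolding co(3)[OF v1 h] .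
              show "b \<le> v + h" using le[of b] unfolding co(4)[OF v1 h] .
              show "b - a \<le> h" using le[of "b - a"] unfolding co(6)[OF v1 h] .
            qed
            hence "M \<le> 6 * v * (v + h) * h" unfolding M_def by (intro mult_le_mono) auto
            also have "\<dots> \<le> 6 * v * (v * (1 + h)) * h" using v2 h by (intro mult_le_mono) auto
            finally have "real M \<le> real (6 * v * (v * (1 + h)) * h)" by (rule of_nat_mono)
            thus ?thesis by (simp add: H_def power2_eq_square algebra_simps)
          qed
          \<comment> \<open>The divisor bound with exponent 1/8, squared, and M = O (v^2) give O
            (v^(1/2)). With the range O (x / v^2) of L this leaves the convergent sum of
            v^(-3/2).\<close>
          have "(4::real) ^ card (prime_factors M) = (2 ^ card (prime_factors M))\<^sup>2" 
            by (simp add: power_even_eq[symmetric] power_mult)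
          also have "\<dots> \<le> (real (tau M))\<^sup>2"
          proof (rule power_mono)
            have "real (2 ^ card (prime_factors M)) \<le> real (tau M)"
              using two_pow_card_prime_factors_le_tau[OF M0] by (rule of_nat_mono)
            thus "2 ^ card (prime_factors M) \<le> real (tau M)" by simp
          qed simp
          also have "\<dots> \<le> (C1 * real M powr (1/8))\<^sup>2" using C1(2)[OF M0] by (intro power_mono) auto
          also have "\<dots> = C1\<^sup>2 * real M powr (1/4)" using M0 by (simp add: power_mult_distrib power2_eq_square powr_add[symmetric])
          also have "\<dots> \<le> C1\<^sup>2 * (6 * H * (1 + H) * (real v)\<^sup>2) powr (1/4)"
            using Mle M0 by (intro mult_left_mono powr_mono2) auto
          also have "\<dots> = C2 * real v powr (1/2)"
          proof -
            have "(real v)\<^sup>2 powr (1/4) = real v powr (1/2)" using v0 by (simp add: powr_powr flip: powr_numeral)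
            thus ?thesis using H1 by (simp only: powr_mult C2_def)
          qed
          finally show "4 ^ card (prime_factors M) \<le> C2 * real v powr (1/2)" .
          have "real (NN v) \<le> 2 * H * x / (real v)\<^sup>2 + 1"
            unfolding NN_def using H1 x by simp
          also have "1 \<le> x / (real v)\<^sup>2"
          proof -
            have "(real v)\<^sup>2 \<le> (x powr (1/4))\<^sup>2" using True by (intro power_mono) auto
            also have "\<dots> = x powr (1/2)" using x by (simp add: power2_eq_square powr_add[symmetric])
            also have "\<dots> \<le> x powr 1" using x by (intro powr_mono) auto
            finally show ?thesis using x v0 by (simp add: field_simps)
          qed
          finally have "real (NN v) \<le> 2 * H * x / (real v)\<^sup>2 + x / (real v)\<^sup>2" by simp
          also have "\<dots> = (2 * H + 1) * x / (real v)\<^sup>2"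
            by (simp only: add_divide_distrib[symmetric] distrib_right mult_1)
          finally show "real (NN v) \<le> (2 * H + 1) * x / (real v)\<^sup>2" .
        qed (use C2 in auto)
        also have "\<dots> = C3 * x / (ln x)\<^sup>2 * (real v powr (1/2) / (real v)\<^sup>2)"
          by (simp add: C3_def lnt power_divide mult_ac)
        also have "real v powr (1/2) / (real v)\<^sup>2 = real v powr (-(1+1/2))"
          using v0 by (simp add: powr_diff[symmetric] flip: powr_numeral)
        finally have "real (card (Ls v)) \<le> 3 * x powr (1/4) + C3 * x / (ln x)\<^sup>2 * real v powr (-(1+1/2))" by simp
        also have "\<dots> \<le> 3 * x powr (1/4) + (C3 * x / (ln x)\<^sup>2 + 2 * H * x powr (7/8)) * real v powr (-(1+1/2))"
          using H1 by (intro add_left_mono mult_right_mono) auto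
        finally show ?thesis using True by simp
      next
        case False
        have "card (Ls v) \<le> card {1..nat \<lfloor>2 * H * x / (real v)\<^sup>2\<rfloor>}"
          by (intro card_mono) (auto simp: Ls_def NN_def)
        hence "real (card (Ls v)) \<le> real (nat \<lfloor>2 * H * x / (real v)\<^sup>2\<rfloor>)" by simp
        also have "\<dots> \<le> 2 * H * x / (real v)\<^sup>2" using H1 x by (intro of_nat_floor) simp
        finally have "real (card (Ls v)) \<le> 2 * H * x / (real v)\<^sup>2" .
        also have "\<dots> = 2 * H * x * (real v powr (-(1/2)) * real v powr (-(1+1/2)))"
          using v0 by (simp add: powr_add[symmetric] powr_minus_divide)
        also have "\<dots> \<le> 2 * H * x * (x powr (-(1/8)) * real v powr (-(1+1/2)))"
        proof -
          have "real v powr (-(1/2)) \<le> (x powr (1/4)) powr (-(1/2))"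
            using False x by (intro powr_mono2') auto
          also have "\<dots> = x powr (-(1/8))" by (simp add: powr_powr)
          finally show ?thesis using H1 x by (intro mult_left_mono mult_right_mono) auto
        qed
        also have "\<dots> = 2 * H * (x powr 1 * x powr (-(1/8))) * real v powr (-(1+1/2))" using x by simp
        also have "x powr 1 * x powr (-(1/8)) = x powr (7/8)" by (simp only: powr_add[symmetric]) simp
        finally have "real (card (Ls v)) \<le> 2 * H * x powr (7/8) * real v powr (-(1+1/2))" .
        also have "\<dots> \<le> (C3 * x / (ln x)\<^sup>2 + 2 * H * x powr (7/8)) * real v powr (-(1+1/2))"
          using C3 x by (intro mult_right_mono) auto
        finally show ?thesis using False by simp
      qed
    qed
    also have "\<dots> = (\<Sum>v\<in>VV. if real v \<le> x powr (1/4) then 3 * x powr (1/4) else 0)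
        + (C3 * x / (ln x)\<^sup>2 + 2 * H * x powr (7/8)) * (\<Sum>v\<in>VV. real v powr (-(1+1/2)))"
      by (simp add: sum.distrib sum_distrib_left)
    also have "(\<Sum>v\<in>VV. if real v \<le> x powr (1/4) then 3 * x powr (1/4) else 0) \<le> 3 * x powr (1/2)"
    proof -
      have "(\<Sum>v\<in>VV. if real v \<le> x powr (1/4) then 3 * x powr (1/4) else 0) 
          = real (card {v \<in> VV. real v \<le> x powr (1/4)}) * (3 * x powr (1/4))"
        by (subst sum.If_cases) (auto simp: VV_def Int_def)
      also have "\<dots> \<le> x powr (1/4) * (3 * x powr (1/4))"
      proof (rule mult_right_mono)
        have "card {v \<in> VV. real v \<le> x powr (1/4)} \<le> card {1..nat \<lfloor>x powr (1/4)\<rfloor>}"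
          by (intro card_mono) (auto simp: VV_def le_nat_floor)
        also have "\<dots> = nat \<lfloor>x powr (1/4)\<rfloor>" by simp
        finally show "real (card {v \<in> VV. real v \<le> x powr (1/4)}) \<le> x powr (1/4)"
          by (smt (verit) of_nat_floor of_nat_mono powr_ge_zero)
      qed simp
      also have "\<dots> = 3 * (x powr (1/4) * x powr (1/4))" by simp
      also have "x powr (1/4) * x powr (1/4) = x powr (1/2)" by (simp add: powr_add[symmetric])
      finally show ?thesis .
    qed
    also have "(C3 * x / (ln x)\<^sup>2 + 2 * H * x powr (7/8)) * (\<Sum>v\<in>VV. real v powr (-(1+1/2)))
        \<le> (C3 * x / (ln x)\<^sup>2 + 2 * H * x powr (7/8)) * (1 + 1/(1/2))"
      using C3 H1 x by (intro mult_left_mono sum_powr_le) (auto simp: VV_def)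
    finally have "R_count h x \<le> 3 * x powr (1/2) + (3 * C3) * (x / (ln x)\<^sup>2) + (6 * H) * x powr (7/8)"
      by (simp add: algebra_simps)
    also have "\<dots> \<le> C * x powr (1/2) + C * (x / (ln x)\<^sup>2) + C * x powr (7/8)"
      using C3 H1 x by (intro add_mono mult_right_mono) (auto simp: C_def)
    finally show "R_count h x \<le> C * (x powr (1/2) + x / (ln x)\<^sup>2 + x powr (7/8))" by (simp add: algebra_simps)
  qed
qed

lemma R_count_bigo:
  assumes h: "h \<ge> 1"
  shows "R_count h \<in> O[at_top](\<lambda>x::real. x / (ln x)\<^sup>2)"
proof -
  obtain C where C: "C \<ge> 0" "\<And>x. x > 1 \<Longrightarrow> R_count h x \<le> C * (x powr (1/2) + x / (ln x)\<^sup>2 + x powr (7/8))"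
    using R_count_bound[OF h] by blast
  have "R_count h \<in> O[at_top](\<lambda>x::real. x powr (1/2) + x / (ln x)\<^sup>2 + x powr (7/8))"
  proof (rule bigoI[of _ C])
    show "\<forall>\<^sub>F x in at_top. norm (R_count h x) \<le> C * norm (x powr (1/2) + x / (ln x)\<^sup>2 + x powr (7/8))"
      using eventually_gt_at_top[of "1::real"]
    proof eventually_elim
      case (elim x)
      have "R_count h x \<ge> 0" by (simp add: R_count_def)
      moreover have "x powr (1/2) + x / (ln x)\<^sup>2 + x powr (7/8) \<ge> 0" using elim by (intro add_nonneg_nonneg) auto
      ultimately show ?case using C(2)[OF elim] by simp
    qed
  qed
  also have "(\<lambda>x::real. x powr (1/2) + x / (ln x)\<^sup>2 + x powr (7/8)) \<in> O[at_top](\<lambda>x. x / (ln x)\<^sup>2)"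
    by real_asymp
  finally show ?thesis .
qed


section \<open>The structure of \<open>B_set\<close>\<close>

text \<open>With d = \<open>gcd v h\<close>, both (v + h)(p + 1) and v (q + 1) equal a b d L; the
  first is n + h + v.\<close>

lemma prime_pair_of_coeffs:
  fixes v L h :: nat
  assumes v: "v \<ge> 1" "h \<ge> 1" and L: "L \<ge> 1" and n: "n = (v + h) * p_val h v L"
  shows "p_val h v L + 1 = a_coeff h v * L" "q_val h v L + 1 = b_coeff h v * L" "n + h = v * q_val h v L"
proof -
  note co = coeffs[OF v]
  have aL: "a_coeff h v * L \<ge> 1" "b_coeff h v * L \<ge> 1" using co L by (auto simp: Suc_le_eq)
  show 1: "p_val h v L + 1 = a_coeff h v * L" "q_val h v L + 1 = b_coeff h v * L"
    using aL by (auto simp: p_val_def q_val_def)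
  have "n + h + v = (v + h) * (p_val h v L + 1)" by (simp add: n algebra_simps)
  also have "\<dots> = (b_coeff h v * gcd v h) * (a_coeff h v * L)" by (simp only: 1 co(4))
  also have "\<dots> = (a_coeff h v * gcd v h) * (b_coeff h v * L)" by (simp only: mult_ac)
  also have "\<dots> = v * (b_coeff h v * L)" by (simp only: co(3))
  also have "\<dots> = v * q_val h v L + v" by (simp flip: 1)
  finally show "n + h = v * q_val h v L" by simp
qed

lemma abundancy_quotient_iff:
  assumes "v \<ge> 1" "m \<ge> 1"
  shows "abundancy v / abundancy m = real k \<longleftrightarrow> divisor_sum v * m = k * divisor_sum m * v"
proof -
  have "real (divisor_sum m) > 0" "real v > 0" "real m > 0" using assms divisor_sum_pos[of m] by auto
  hence "abundancy v / abundancy m = real k \<longleftrightarrow> real (divisor_sum v) * real m = real k * real (divisor_sum m) * real v"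
    by (simp add: abundancy_def field_simps)
  thus ?thesis by (metis of_nat_eq_iff of_nat_mult)
qed

text \<open>The divisor sums of n and n + h are sigma(v + h) a L and sigma(v) b L, and b / a = (v +
  h) / v. Their quotient is therefore exactly I(v) / I(v + h), an integer by the choice of
  v.\<close>

lemma R_subset_B:
  assumes h: "h \<ge> 1"
  shows "R_set h \<subseteq> B_set h"
proof
  fix n assume "n \<in> R_set h"
  then obtain v L where vL: "n = (v + h) * p_val h v L" "v \<in> V_set h" "L \<ge> 1" 
    "prime (p_val h v L)" "prime (q_val h v L)" "coprime (p_val h v L) (v + h)" "coprime (q_val h v L) v"
    by (auto simp: R_set_def)
  have v: "v \<ge> 1" using vL(2) by (simp add: V_set_def)
  obtain k where k: "abundancy v / abundancy (v + h) = real k" using vL(2) by (auto simp: V_set_def)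
  note co = coeffs[OF v h] and pq = prime_pair_of_coeffs[OF v h vL(3,1)]
  define d where "d = gcd v h"
  have d: "d > 0" using h by (simp add: d_def)
  have "divisor_sum v * (b_coeff h v * d) = k * divisor_sum (v + h) * (a_coeff h v * d)"
    using k abundancy_quotient_iff[of v "v + h" k] v co(3,4) by (simp add: d_def)
  hence "d * (divisor_sum v * b_coeff h v) = d * (k * divisor_sum (v + h) * a_coeff h v)" by (simp only: mult_ac)
  hence *: "divisor_sum v * b_coeff h v = k * divisor_sum (v + h) * a_coeff h v" using d by simp
  have p0: "p_val h v L > 0" "q_val h v L > 0" using vL prime_gt_0_nat by auto
  have "divisor_sum n = divisor_sum (v + h) * (a_coeff h v * L)"
    using vL v p0 by (simp add: divisor_sum_mult coprime_commute divisor_sum_prime flip: pq(1))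
  moreover have "divisor_sum (n + h) = divisor_sum v * (b_coeff h v * L)"
    unfolding pq(3) using vL v p0 by (simp add: divisor_sum_mult coprime_commute divisor_sum_prime flip: pq(2))
  ultimately have "divisor_sum (n + h) = k * divisor_sum n" using * by (metis mult.assoc)
  moreover have "n \<ge> 1" using vL(1) v p0 by (simp add: Suc_le_eq)
  ultimately show "n \<in> B_set h" by (simp add: B_set_def)
qed

text \<open>The two factorisations give m' (q + 1) = (m' + h)(p + 1), so the quotient k of the
  divisor sums equals I(m') / I(m' + h), which puts m' into \<open>V_set h\<close>. Coprimality of
  the coefficients a and b then produces L.\<close>

lemma R_setI:
  assumes h: "h \<ge> 1" and n: "n = (m' + h) * p" "n + h = m' * q" "m' \<ge> 1"
    and pq: "prime p" "prime q" "\<not> p dvd m' + h" "\<not> q dvd m'"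
    and k: "divisor_sum (n + h) = k * divisor_sum n"
  shows "n \<in> R_set h"
proof -
  have p0: "p > 0" "q > 0" using pq prime_gt_0_nat by auto
  have cop: "coprime p (m' + h)" "coprime q m'" using pq by (auto intro: prime_imp_coprime)
  have n0: "n > 0" using n p0 h by simp
  have k0: "k \<ge> 1" using k divisor_sum_pos[of "n + h"] n0 by (cases k) auto
  have eq1: "m' * (q + 1) = (m' + h) * (p + 1)" using n by (simp add: algebra_simps)
  have "divisor_sum n = divisor_sum (m' + h) * (p + 1)"
    using n cop p0 h pq by (simp add: divisor_sum_mult coprime_commute divisor_sum_prime)
  moreover have "divisor_sum (n + h) = divisor_sum m' * (q + 1)"
    unfolding n(2) using n(3) cop p0 pq by (simp add: divisor_sum_mult coprime_commute divisor_sum_prime)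
  ultimately have eq2: "divisor_sum m' * (q + 1) = k * (divisor_sum (m' + h) * (p + 1))" using k by simp
  have "(p + 1) * (divisor_sum m' * (m' + h)) = divisor_sum m' * (m' * (q + 1))" unfolding eq1 by (simp only: mult_ac)
  also have "\<dots> = m' * (k * (divisor_sum (m' + h) * (p + 1)))" unfolding eq2[symmetric] by (simp only: mult_ac)
  also have "\<dots> = (p + 1) * (k * divisor_sum (m' + h) * m')" by (simp only: mult_ac)
  finally have "(p + 1) * (divisor_sum m' * (m' + h)) = (p + 1) * (k * divisor_sum (m' + h) * m')" .
  hence key: "divisor_sum m' * (m' + h) = k * divisor_sum (m' + h) * m'"
    by (rule mult_left_cancel[THEN iffD1, rotated]) simp
  \<comment> \<open>\<open>V_set\<close> starts at 2. For m' = 1 the identity would read 1 + h = k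
    sigma(1 + h), but sigma(1 + h) >= h + 2.\<close>
  have "m' \<noteq> 1"
  proof
    assume "m' = 1"
    hence "1 + h = k * divisor_sum (1 + h)" using key by (simp add: divisor_sum_def)
    moreover have "1 * divisor_sum (1 + h) \<le> k * divisor_sum (1 + h)" using k0 by (intro mult_right_mono) auto
    moreover have "(\<Sum>d\<in>{1, 1 + h}. d) \<le> divisor_sum (1 + h)"
      unfolding divisor_sum_def by (intro sum_mono2) auto
    ultimately show False using h by simp
  qed
  hence m2: "m' \<ge> 2" using n(3) by simp
  have V: "m' \<in> V_set h"
    using m2 k0 abundancy_quotient_iff[of m' "m' + h" k] key by (auto simp: V_set_def)
  note co = coeffs[OF n(3) h]
  define d where "d = gcd m' h"
  have d: "d > 0" using h by (simp add: d_def)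
  have "d * (a_coeff h m' * (q + 1)) = d * (b_coeff h m' * (p + 1))"
  proof -
    have "d * (a_coeff h m' * (q + 1)) = (a_coeff h m' * gcd m' h) * (q + 1)" unfolding d_def by (simp only: mult_ac)
    also have "\<dots> = (b_coeff h m' * gcd m' h) * (p + 1)" unfolding co(3,4) by (rule eq1)
    also have "\<dots> = d * (b_coeff h m' * (p + 1))" unfolding d_def by (simp only: mult_ac)
    finally show ?thesis .
  qed
  hence ab: "a_coeff h m' * (q + 1) = b_coeff h m' * (p + 1)" using d by simp
  have "a_coeff h m' dvd b_coeff h m' * (p + 1)" by (metis ab dvd_triv_left)
  hence "a_coeff h m' dvd p + 1" by (simp only: coprime_dvd_mult_right_iff[OF co(5)])
  then obtain L where L: "p + 1 = a_coeff h m' * L" by auto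
  have "a_coeff h m' * (q + 1) = a_coeff h m' * (b_coeff h m' * L)" by (simp only: ab L mult_ac)
  hence L': "q + 1 = b_coeff h m' * L"
    by (rule mult_left_cancel[THEN iffD1, rotated]) (use co(1) in simp)
  have "p = p_val h m' L" "q = q_val h m' L" using L L' by (auto simp: p_val_def q_val_def simp flip: L L')
  moreover have "L \<ge> 1" using L by (cases L) auto
  ultimately show ?thesis using V n(1) pq cop unfolding R_set_def by blast
qed

text \<open>Both sets are used with \<open>N = n\<close>, \<open>H = h\<close> and with \<open>N = n + h\<close>, \<open>H = -h\<close>, so that the
  smaller prime \<open>p1\<close> always divides \<open>N\<close>.\<close>
definition exc_gcd :: "real \<Rightarrow> real \<Rightarrow> real \<Rightarrow> int \<Rightarrow> nat set" where
  "exc_gcd y w X H = {N. real N \<le> X \<and> (\<exists>m1 m2 p1 p2 d. prime p1 \<and> prime p2 \<and> y < real p1 \<and> p1 < p2 \<and>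
     m1 \<ge> 1 \<and> m2 \<ge> 1 \<and> N = m1 * p1 \<and> int N + H = int (m2 * p2) \<and> real (m2 * p2) \<le> X \<and>
     d dvd p1 + 1 \<and> d dvd divisor_sum m2 \<and> w < real d)}"

definition exc_div :: "real \<Rightarrow> real \<Rightarrow> real \<Rightarrow> int \<Rightarrow> nat set" where
  "exc_div y w X H = {N. real N \<le> X \<and> (\<exists>m1 m2 p1 p2 d e t. prime p1 \<and> prime p2 \<and> y < real p1 \<and> p1 < p2 \<and>
     m1 \<ge> 1 \<and> m2 \<ge> 1 \<and> N = m1 * p1 \<and> int N + H = int (m2 * p2) \<and> real (m2 * p2) \<le> X \<and>
     p1 + 1 = d * e \<and> real d \<le> w \<and> t \<ge> 1 \<and> int m1 = int m2 + H + int (e * t))}"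

text \<open>If \<open>m1 \<noteq> m2 + H\<close>, eliminating \<open>p2\<close> from the two equations for \<open>N1\<close> and \<open>N2\<close> shows that \<open>p1 + 1\<close>
  divides the nonzero number \<open>\<alpha> * divisor_sum m2 * (m2 + H - m1)\<close>.\<close>
lemma exceptional_cases:
  fixes H :: int and h :: nat and y w X K :: real
  assumes eq: "N1 = m1 * p1" "N2 = m2 * p2" "int N2 = int N1 + H" and m: "m1 \<ge> 1" "m2 \<ge> 1"
    and p: "prime p1" "prime p2" "y < real p1" "p1 < p2" "\<not> p1 dvd m1" "\<not> p2 dvd m2"
    and H: "\<bar>H\<bar> \<le> int h" and y: "w * real h \<le> y" "real h \<le> y" and w: "w > 0"
    and X: "real N1 \<le> X" "real N2 \<le> X"
    and ab: "\<alpha> * divisor_sum N2 = \<beta> * divisor_sum N1" "\<alpha> \<ge> 1" "real \<alpha> \<le> K"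
    and ne: "int m1 \<noteq> int m2 + H"
  shows "N1 \<in> exc_gcd y (w / K) X H \<union> exc_div y w X H"
proof -
  have p0: "p1 > 0" "p2 > 0" using p prime_gt_0_nat by auto
  have cop: "coprime m1 p1" "coprime m2 p2" using p prime_imp_coprime by (metis coprime_commute)+
  have s1: "divisor_sum N1 = divisor_sum m1 * (p1 + 1)"
    unfolding eq using cop m p p0 by (simp add: divisor_sum_mult divisor_sum_prime)
  have s2: "divisor_sum N2 = divisor_sum m2 * (p2 + 1)"
    unfolding eq using cop m p p0 by (simp add: divisor_sum_mult divisor_sum_prime)
  define z where "z = int m2 + H - int m1"
  have lin: "int m2 * int p2 = int m1 * int p1 + H" using eq by simp
  have "int \<alpha> * int (divisor_sum m2) * (int p2 + 1) = int \<beta> * int (divisor_sum m1) * (int p1 + 1)"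
    using arg_cong[OF ab(1), of int] unfolding s1 s2 by (simp only: of_nat_mult of_nat_add of_nat_1 mult.assoc)
  \<comment> \<open>The equation of divisor sums is multiplied by m2 so that this substitution
    removes p2; modulo p1 + 1 only the term with z survives.\<close>
  moreover have "int m2 * (int p2 + 1) = int m1 * (int p1 + 1) + z" using lin by (simp add: z_def algebra_simps)
  ultimately have "int \<alpha> * int (divisor_sum m2) * (int m1 * (int p1 + 1) + z) = int m2 * (int \<beta> * int (divisor_sum m1) * (int p1 + 1))"
    by (metis mult.left_commute)
  hence "int (\<alpha> * divisor_sum m2) * z = (int p1 + 1) * (int m2 * int \<beta> * int (divisor_sum m1) - int \<alpha> * int (divisor_sum m2) * int m1)"
    by (simp add: algebra_simps)
  hence dvd: "int (p1 + 1) dvd int (\<alpha> * divisor_sum m2) * z"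
    by (metis dvd_triv_left of_nat_Suc Suc_eq_plus1 add.commute)
  define D where "D = gcd (p1 + 1) (\<alpha> * divisor_sum m2)"
  have D0: "D > 0" by (simp add: D_def)
  obtain e where e: "p1 + 1 = D * e" unfolding D_def by (meson dvdE gcd_dvd1)
  obtain f where f: "\<alpha> * divisor_sum m2 = D * f" unfolding D_def by (meson dvdE gcd_dvd2)
  have "coprime e f"
  proof -
    have "D * gcd e f = D" using e f by (metis D_def gcd_mult_distrib_nat)
    thus ?thesis using D0 by (simp add: coprime_iff_gcd_eq_1)
  qed
  have "int D * int e dvd int D * (int f * z)" using dvd unfolding e f by (simp add: mult.assoc)
  hence "int e dvd int f * z" using D0 by simp
  hence "int e dvd z" using \<open>coprime e f\<close> by (simp add: coprime_dvd_mult_right_iff)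
  hence "int e dvd int m1 - int m2 - H" by (metis z_def dvd_minus_iff minus_diff_eq diff_diff_eq)
  then obtain t where t: "int m1 - int m2 - H = int e * t" by auto
  show ?thesis
  proof (cases "real D \<le> w")
    case True
    \<comment> \<open>p1 < p2 and h < p1 force m1 >= m2, so a negative t would give e <= h and p1 +
      1 = D e <= w h <= y, against p1 > y. The value t = 0 is the excluded case m1 = m2 + H.\<close>
    have tpos: "t \<ge> 1"
    proof (rule ccontr)
      assume "\<not> t \<ge> 1"
      moreover have "t \<noteq> 0" using t ne by auto
      ultimately have t1: "t \<le> -1" by linarith
      have hp: "int h < int p1" using y p by linarith
      have "int m2 * int p2 \<ge> int m2 * (int p1 + 1)" using p(4) by (intro mult_left_mono) auto
      hence "(int m1 - int m2) * int p1 \<ge> int m2 - H" using lin by (simp add: algebra_simps)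
      moreover have "int m2 - H > (-1) * int p1" using m(2) H hp by linarith
      ultimately have "(-1) * int p1 < (int m1 - int m2) * int p1" by linarith
      hence "int m1 - int m2 > -1" by (rule mult_right_less_imp_less) simp
      hence "int e * t \<ge> - int h" using t H by linarith
      moreover have "int e * t \<le> int e * (-1)" using t1 by (intro mult_left_mono) auto
      ultimately have eh: "e \<le> h" by linarith
      have "real p1 + 1 = real D * real e" using e by (metis of_nat_mult of_nat_Suc Suc_eq_plus1 add.commute)
      also have "\<dots> \<le> w * real h" using True eh w by (intro mult_mono) auto
      finally show False using y p by linarith
    qed
    have mt: "int m1 = int m2 + H + int (e * nat t)" using t tpos by simp
    have "nat t \<ge> 1" using tpos by simp
    have "N1 \<in> exc_div y w X H"
      unfolding exc_div_def
      by (rule CollectI, rule conjI, rule X(1), rule exI[of _ m1], rule exI[of _ m2], rule exI[of _ p1],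
          rule exI[of _ p2], rule exI[of _ D], rule exI[of _ e], rule exI[of _ "nat t"], intro conjI)
        (use eq lin m p X e True mt \<open>nat t \<ge> 1\<close> in \<open>simp_all\<close>)
    thus ?thesis by simp
  next
    case False
    define d where "d = gcd (p1 + 1) (divisor_sum m2)"
    \<comment> \<open>Replacing \<alpha> sigma(m2) by sigma(m2) loses at most the factor \<alpha> <=
      K in the gcd, whence the threshold w / K. After this \<alpha> disappears from the
      counting.\<close>
    have "D dvd \<alpha> * d" unfolding D_def d_def gcd_mult_distrib_nat
      by (rule gcd_greatest[OF dvd_mult[OF gcd_dvd1] gcd_dvd2])
    hence "D \<le> \<alpha> * d" using ab(2) by (intro dvd_imp_le) (auto simp: d_def)
    hence "real D \<le> real \<alpha> * real d" by (metis of_nat_le_iff of_nat_mult)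
    also have "\<dots> \<le> K * real d" using ab(3) by (intro mult_right_mono) auto
    finally have "w < K * real d" using False by linarith
    moreover have "K > 0" using ab by linarith
    ultimately have wd: "w / K < real d" by (simp add: field_simps)
    have d_dvd: "d dvd p1 + 1" "d dvd divisor_sum m2" unfolding d_def by (rule gcd_dvd1, rule gcd_dvd2)
    have "N1 \<in> exc_gcd y (w / K) X H"
      unfolding exc_gcd_def
      by (rule CollectI, rule conjI, rule X(1), rule exI[of _ m1], rule exI[of _ m2], rule exI[of _ p1],
          rule exI[of _ p2], rule exI[of _ d], intro conjI)
        (use eq lin m p X wd d_dvd in \<open>simp_all\<close>)
    thus ?thesis by simp
  qed
qed

text \<open>Outside the smooth and square-divisible cases there are primes p, q > y dividing n and n
  + h exactly once, and they differ because a common prime would divide h <= y. When q < p, the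
  roles of n and n + h are exchanged, which moves k to the other side: then \<alpha> = k, \<beta> =
  1 and H = -h.\<close>

lemma B_diff_R_cases:
  fixes y w X K :: real
  assumes h: "h \<ge> 1" and n: "n \<in> B_set h" "n \<notin> R_set h" "real n + real h \<le> X"
    and y: "w * real h \<le> y" "real h \<le> y" and w: "w > 0"
    and K: "(1 + real h) * (1 + ln X) \<le> K"
  shows "smooth y n \<or> smooth y (n + h) \<or> (\<exists>p. prime p \<and> y < real p \<and> (p\<^sup>2 dvd n \<or> p\<^sup>2 dvd n + h))
    \<or> n \<in> exc_gcd y (w / K) X (int h) \<union> exc_div y w X (int h)
    \<or> n + h \<in> exc_gcd y (w / K) X (- int h) \<union> exc_div y w X (- int h)"
proof (rule ccontr)
  assume neg: "\<not> ?thesis"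
  have n1: "n \<ge> 1" using n by (simp add: B_set_def)
  obtain p where p: "prime p" "p dvd n" "y < real p" using neg by (auto simp: smooth_def not_le)
  obtain q where q: "prime q" "q dvd n + h" "y < real q" using neg by (auto simp: smooth_def not_le)
  obtain m where m: "n = m * p" using p by (metis dvdE mult.commute)
  obtain m' where m': "n + h = m' * q" using q by (metis dvdE mult.commute)
  have m1: "m \<ge> 1" "m' \<ge> 1" using n1 m m' by (cases m; cases m'; simp)+
  have pm: "\<not> p dvd m"
  proof
    assume "p dvd m"
    hence "p\<^sup>2 dvd n" unfolding m power2_eq_square by (simp add: mult_dvd_mono)
    thus False using neg p by blast
  qed
  have qm: "\<not> q dvd m'"
  proof
    assume "q dvd m'"
    hence "q\<^sup>2 dvd n + h" unfolding m' power2_eq_square by (simp add: mult_dvd_mono)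
    thus False using neg q by blast
  qed
  have "p \<noteq> q"
  proof
    assume "p = q"
    hence "p dvd h" using p(2) q(2) by (simp add: dvd_add_right_iff)
    hence "p \<le> h" using h by (intro dvd_imp_le) auto
    thus False using y p by linarith
  qed
  have "divisor_sum n dvd divisor_sum (n + h)" using n by (simp add: B_set_def)
  then obtain k where k: "divisor_sum (n + h) = k * divisor_sum n" by (metis dvdE mult.commute)
  have k0: "k \<ge> 1" using k divisor_sum_pos[of "n + h"] n1 by (cases k) auto
  \<comment> \<open>From n <= sigma(n) and the logarithmic bound for sigma(n + h) / (n + h); the
    factor 1 + h bounds (n + h) / n.\<close>
  have kK: "real k \<le> K"
  proof -
    have "real k * real n \<le> real k * real (divisor_sum n)"
      using divisor_sum_ge[of n] n1 by (intro mult_left_mono) auto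
    also have "\<dots> = real (divisor_sum (n + h))" by (simp add: k)
    also have "\<dots> \<le> real (n + h) * (1 + ln (real (n + h)))" using n1 by (intro divisor_sum_le) auto
    also have "\<dots> \<le> (real n * (1 + real h)) * (1 + ln X)"
    proof (intro mult_mono add_left_mono)
      have "1 * real h \<le> real n * real h" using n1 by (intro mult_right_mono) auto
      thus "real (n + h) \<le> real n * (1 + real h)" by (simp add: algebra_simps)
      show "ln (real (n + h)) \<le> ln X" using n n1 by (intro ln_mono) auto
    qed (use n1 in auto)
    finally have "real n * real k \<le> real n * ((1 + real h) * (1 + ln X))" by (simp add: mult_ac)
    hence "real k \<le> (1 + real h) * (1 + ln X)" using n1 by simp
    thus ?thesis using K by linarith
  qed
  have K1: "1 \<le> K" using k0 kK by linarith
  have Xn: "real n \<le> X" "real (n + h) \<le> X" using n by auto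
  show False
  proof (cases "m = m' + h")
    case True
    have "n \<in> R_set h" using R_setI[OF h _ m' _ p(1) q(1) _ qm k] m m1 pm True by blast
    thus False using n by simp
  next
    case False
    consider "p < q" | "q < p" using \<open>p \<noteq> q\<close> by linarith
    thus False
    proof cases
      case 1
      have "n \<in> exc_gcd y (w / K) X (int h) \<union> exc_div y w X (int h)"
        by (rule exceptional_cases[OF m m' _ m1 p(1) q(1) p(3) 1 pm qm _ y w Xn, of "int h" 1 k])
          (use False k K1 in auto)
      thus False using neg by blast
    next
      case 2
      have "n + h \<in> exc_gcd y (w / K) X (- int h) \<union> exc_div y w X (- int h)"
        by (rule exceptional_cases[OF m' m _ m1(2,1) q(1) p(1) q(3) 2 qm pm _ y w Xn(2,1), of "- int h" k 1])
          (use False k k0 kK in auto)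
      thus False using neg by blast
    qed
  qed
qed


section \<open>Counting the exceptional integers\<close>

text \<open>If p does not divide m, the two conditions fix N modulo p m, and p m <= X makes the
  extra 1 at most the main term. If p divides m, then p would divide H, impossible for 0 < |H| <
  p.\<close>

lemma card_divisible_pair_le:
  fixes H :: int and X :: real
  assumes p: "prime p" "\<bar>H\<bar> < int p" "H \<noteq> 0" and m: "m \<ge> 1" "real p * real m \<le> X"
  shows "real (card {N. 1 \<le> N \<and> real N \<le> X \<and> p dvd N \<and> int m dvd int N + H}) \<le> 2 * X / (real p * real m)"
proof -
  let ?Z = "{N. 1 \<le> N \<and> real N \<le> X \<and> p dvd N \<and> int m dvd int N + H}"
  have p0: "real p > 0" using p prime_gt_0_nat by simp
  have pm0: "real p * real m > 0" using p0 m by simp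
  have X0: "X > 0" using m(2) pm0 by linarith
  show ?thesis
  proof (cases "p dvd m")
    case True
    have Z: "?Z = {}"
    proof (rule ccontr)
      assume "?Z \<noteq> {}"
      then obtain N where N: "p dvd N" "int m dvd int N + H" by auto
      have "int p dvd int N + H" using True N(2) by (meson dvd_trans of_nat_dvd_iff)
      hence "int p dvd H" using N(1) by (simp add: dvd_add_right_iff)
      hence "int p \<le> \<bar>H\<bar>" using p(3) by (metis abs_of_nat dvd_imp_le_int)
      thus False using p(2) by simp
    qed
    show ?thesis unfolding Z using X0 pm0 by simp
  next
    case False
    have cop: "coprime (int p) (int m)" using p(1) False by (simp add: prime_imp_coprime)
    have "real (card ?Z) \<le> X / real (p * m) + 1"
    proof (rule card_residue_class_le)
      show "1 \<le> p * m" using p m prime_gt_0_nat[OF p(1)] by (simp add: Suc_le_eq)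
      fix a b assume ab: "a \<in> ?Z" "b \<in> ?Z"
      have "int p dvd int a - int b" using ab by (auto intro: dvd_diff)
      moreover have "int m dvd (int a + H) - (int b + H)" using ab by (intro dvd_diff) auto
      ultimately have "int p * int m dvd int a - int b" using cop by (intro divides_mult) auto
      thus "int (p * m) dvd int a - int b" by simp
    qed (use X0 in auto)
    also have "1 \<le> X / real (p * m)" using m pm0 by simp
    finally show ?thesis by (simp add: mult.commute)
  qed
qed

text \<open>Writing p + 1 = d j turns 1 / p <= 2 / (p + 1) into 2 / (d j), and the j are distinct,
  so their sum is harmonic. In the application only the factor 1 / d matters; a logarithm is
  free.\<close>

lemma sum_inverse_primes_residue_le:
  fixes X :: real
  assumes d: "d \<ge> 1" and X: "X \<ge> 1" and A: "\<And>p. p \<in> A \<Longrightarrow> p \<ge> 1 \<and> d dvd p + 1 \<and> real p \<le> X"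
  shows "(\<Sum>p\<in>A. 1 / real p) \<le> 2 / real d * (1 + ln (X + 1))"
proof -
  have inj: "inj_on (\<lambda>p. (p + 1) div d) A"
  proof (rule inj_onI)
    fix p q assume pq: "p \<in> A" "q \<in> A" "(p + 1) div d = (q + 1) div d"
    have "p + 1 = q + 1" using A[OF pq(1)] A[OF pq(2)] pq(3) by (metis dvd_mult_div_cancel)
    thus "p = q" by simp
  qed
  have "(\<Sum>p\<in>A. 1 / real p) \<le> (\<Sum>p\<in>A. 2 / real d * (1 / real ((p + 1) div d)))"
  proof (rule sum_mono)
    fix p assume p: "p \<in> A"
    then obtain j where j: "p + 1 = d * j" using A by blast
    have q: "(p + 1) div d = j" using d j by simp
    have "j \<noteq> 0" using j by (intro notI) simp
    hence j0: "real j > 0" by simp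
    have "real d * real j = real p + 1" using j by (metis of_nat_mult of_nat_Suc Suc_eq_plus1 add.commute)
    also have "\<dots> \<le> 2 * real p" using A[OF p] by simp
    finally have "real d * real j \<le> 2 * real p" .
    thus "1 / real p \<le> 2 / real d * (1 / real ((p + 1) div d))"
      unfolding q using A[OF p] d j0 by (simp add: field_simps)
  qed
  also have "\<dots> = 2 / real d * (\<Sum>p\<in>A. 1 / real ((p + 1) div d))" by (simp only: sum_distrib_left)
  finally have 1: "(\<Sum>p\<in>A. 1 / real p) \<le> 2 / real d * (\<Sum>p\<in>A. 1 / real ((p + 1) div d))" .
  have "(\<Sum>p\<in>A. 1 / real ((p + 1) div d)) = (\<Sum>j\<in>(\<lambda>p. (p + 1) div d) ` A. 1 / real j)"
    by (subst sum.reindex[OF inj]) simp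
  also have "\<dots> \<le> 1 + ln (X + 1)"
  proof (rule harm_le_one_plus_ln_real)
    fix i assume "i \<in> (\<lambda>p. (p + 1) div d) ` A"
    then obtain p where p: "p \<in> A" "i = (p + 1) div d" by auto
    have "i \<le> p + 1" unfolding p(2) by (rule div_le_dividend)
    moreover have "i \<noteq> 0" using A[OF p(1)] p(2) d by (metis Suc_eq_plus1 dvd_div_eq_0_iff nat.distinct(1))
    ultimately show "1 \<le> i \<and> real i \<le> X + 1" using A[OF p(1)] by auto
  qed (use X in simp)
  finally have "2 / real d * (\<Sum>p\<in>A. 1 / real ((p + 1) div d)) \<le> 2 / real d * (1 + ln (X + 1))"
    by (intro mult_left_mono) auto
  with 1 show ?thesis by linarith
qed

text \<open>Sum over the cofactor m of the larger prime, the divisors d > w of sigma(m) and the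
  primes p = -1 modulo d; each choice allows at most 2 X / (p m) values of N. The primes contribute
  1 / d up to a logarithm, and 1 / d <= w^(-9/10) d^(-1/10) extracts the saving while leaving the
  decay that \<open>sigma_neg\<close> needs.\<close>

lemma card_exc_gcd_le:
  fixes H :: int and X y w :: real
  assumes H: "H \<noteq> 0" "\<bar>real_of_int H\<bar> \<le> y" and X: "X \<ge> 1" and w: "w > 0"
  shows "finite (exc_gcd y w X H)"
    "real (card (exc_gcd y w X H)) \<le> 4 * X * (1 + ln (X + 1)) * w powr (-(9/10)) *
       (\<Sum>m | m \<ge> 1 \<and> real m \<le> X. sigma_neg (1/10) (divisor_sum m) / real m)"
proof -
  define MM where "MM = {m::nat. m \<ge> 1 \<and> real m \<le> X}"
  define DD where "DD = (\<lambda>m. {d. d dvd divisor_sum m \<and> w < real d})"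
  define PP where "PP = (\<lambda>m d. {p::nat. (prime p \<and> d dvd p + 1 \<and> y < real p \<and> real p * real m \<le> X) \<and> real p \<le> X})"
  define Z where "Z = (\<lambda>m p. {N. 1 \<le> N \<and> real N \<le> X \<and> p dvd N \<and> int m dvd int N + H})"
  define U where "U = (\<Union>m\<in>MM. \<Union>d\<in>DD m. \<Union>p\<in>PP m d. Z m p)"
  have finM: "finite MM" unfolding MM_def by (rule finite_nat_le_real)
  have finD: "finite (DD m)" if "m \<in> MM" for m
    using that divisor_sum_pos[of m] by (auto simp: DD_def MM_def)
  have finP: "finite (PP m d)" for m d unfolding PP_def by (rule finite_nat_le_real)
  have finZ: "finite (Z m p)" for m p unfolding Z_def
    by (rule finite_subset[OF _ finite_nat_le_real[of "\<lambda>_. True" X]]) auto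
  have finU: "finite U" unfolding U_def using finM finD finP finZ by blast
  have sub: "exc_gcd y w X H \<subseteq> U"
  proof
    fix N assume "N \<in> exc_gcd y w X H"
    then obtain m1 m2 p1 p2 d where *: "real N \<le> X" "prime p1" "prime p2" "y < real p1" "p1 < p2"
      "m1 \<ge> 1" "m2 \<ge> 1" "N = m1 * p1" "int N + H = int (m2 * p2)" "real (m2 * p2) \<le> X"
      "d dvd p1 + 1" "d dvd divisor_sum m2" "w < real d" unfolding exc_gcd_def by blast
    have p0: "p1 \<ge> 1" "p2 \<ge> 1" using * prime_ge_1_nat by auto
    have N1: "N \<ge> 1" using *(6,8) p0 by simp
    \<comment> \<open>Here the smaller prime matters: the modulus p1 m2 is at most m2 p2 <= X, so a
      residue class never costs more than twice its density.\<close>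
    have "m2 * p1 \<le> m2 * p2" using *(5) by simp
    hence mp: "real m2 * real p1 \<le> X" using *(10) by (smt (verit) of_nat_le_iff of_nat_mult)
    have "real m2 * 1 \<le> real m2 * real p1" "1 * real p1 \<le> real m2 * real p1"
      using p0 *(7) by (intro mult_left_mono mult_right_mono; simp)+
    hence le: "real m2 \<le> X" "real p1 \<le> X" using mp by auto
    have "m2 \<in> MM" using le *(7) by (simp add: MM_def)
    moreover have "d \<in> DD m2" using * by (simp add: DD_def)
    moreover have "p1 \<in> PP m2 d" using * le mp by (simp add: PP_def mult.commute)
    moreover have "N \<in> Z m2 p1" using * N1 by (simp add: Z_def)
    ultimately show "N \<in> U" unfolding U_def by blast
  qed
  show "finite (exc_gcd y w X H)" using finite_subset[OF sub finU] .
  have cZ: "real (card (Z m p)) \<le> 2 * X / real m * (1 / real p)" if "m \<in> MM" "p \<in> PP m d" for m p d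
  proof -
    have "\<bar>H\<bar> < int p" using H(2) that(2) unfolding PP_def by (simp, linarith)
    hence "real (card (Z m p)) \<le> 2 * X / (real p * real m)"
      unfolding Z_def using that H(1) by (intro card_divisible_pair_le) (auto simp: PP_def MM_def)
    thus ?thesis by (simp add: mult.commute)
  qed
  have "real (card (exc_gcd y w X H)) \<le> real (card U)" by (intro of_nat_mono card_mono finU sub)
  also have "\<dots> \<le> real (\<Sum>m\<in>MM. card (\<Union>d\<in>DD m. \<Union>p\<in>PP m d. Z m p))"
    unfolding U_def by (intro of_nat_mono card_UN_le finM)
  also have "\<dots> = (\<Sum>m\<in>MM. real (card (\<Union>d\<in>DD m. \<Union>p\<in>PP m d. Z m p)))" by simp
  also have "\<dots> \<le> (\<Sum>m\<in>MM. 4 * X * (1 + ln (X + 1)) * w powr (-(9/10)) * (sigma_neg (1/10) (divisor_sum m) / real m))"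
  proof (rule sum_mono)
    fix m assume m: "m \<in> MM"
    have m0: "real m > 0" using m by (auto simp: MM_def)
    have "real (card (\<Union>d\<in>DD m. \<Union>p\<in>PP m d. Z m p)) \<le> real (\<Sum>d\<in>DD m. card (\<Union>p\<in>PP m d. Z m p))"
      by (intro of_nat_mono card_UN_le finD m)
    also have "\<dots> = (\<Sum>d\<in>DD m. real (card (\<Union>p\<in>PP m d. Z m p)))" by simp
    also have "\<dots> \<le> (\<Sum>d\<in>DD m. 2 * X / real m * (2 / real d * (1 + ln (X + 1))))"
    proof (rule sum_mono)
      fix d assume d: "d \<in> DD m"
      have d1: "d \<ge> 1" using d w by (cases d) (auto simp: DD_def)
      have "real (card (\<Union>p\<in>PP m d. Z m p)) \<le> real (\<Sum>p\<in>PP m d. card (Z m p))"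
        by (intro of_nat_mono card_UN_le finP)
      also have "\<dots> = (\<Sum>p\<in>PP m d. real (card (Z m p)))" by simp
      also have "\<dots> \<le> (\<Sum>p\<in>PP m d. 2 * X / real m * (1 / real p))" by (intro sum_mono cZ[OF m])
      also have "\<dots> = 2 * X / real m * (\<Sum>p\<in>PP m d. 1 / real p)" by (simp only: sum_distrib_left)
      also have "\<dots> \<le> 2 * X / real m * (2 / real d * (1 + ln (X + 1)))"
        using X m0 d1 prime_ge_1_nat by (intro mult_left_mono sum_inverse_primes_residue_le) (auto simp: PP_def)
      finally show "real (card (\<Union>p\<in>PP m d. Z m p)) \<le> 2 * X / real m * (2 / real d * (1 + ln (X + 1)))" .
    qed
    also have "\<dots> = 4 * X * (1 + ln (X + 1)) / real m * (\<Sum>d\<in>DD m. 1 / real d)"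
      unfolding sum_distrib_left by (intro sum.cong refl) (simp add: mult_ac)
    finally have 1: "real (card (\<Union>d\<in>DD m. \<Union>p\<in>PP m d. Z m p)) \<le>
      4 * X * (1 + ln (X + 1)) / real m * (\<Sum>d\<in>DD m. 1 / real d)" .
    have 2: "(\<Sum>d\<in>DD m. 1 / real d) \<le> w powr (-(9/10)) * sigma_neg (1/10) (divisor_sum m)"
    proof -
      have "(\<Sum>d\<in>DD m. 1 / real d) \<le> (\<Sum>d\<in>DD m. w powr (-(9/10)) * real d powr (-(1/10)))"
      proof (rule sum_mono)
        fix d assume d: "d \<in> DD m"
        have d0: "real d > 0" using d w by (auto simp: DD_def)
        have "1 / real d = real d powr (-(9/10)) * real d powr (-(1/10))"
          using d0 by (simp add: powr_add[symmetric] powr_minus_divide)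
        also have "\<dots> \<le> w powr (-(9/10)) * real d powr (-(1/10))"
          using d w by (intro mult_right_mono powr_mono2') (auto simp: DD_def)
        finally show "1 / real d \<le> w powr (-(9/10)) * real d powr (-(1/10))" .
      qed
      also have "\<dots> \<le> (\<Sum>d | d dvd divisor_sum m. w powr (-(9/10)) * real d powr (-(1/10)))"
        using m divisor_sum_pos[of m] by (intro sum_mono2) (auto simp: DD_def MM_def)
      finally show ?thesis by (simp add: sigma_neg_def sum_distrib_left)
    qed
    note 1
    also have "4 * X * (1 + ln (X + 1)) / real m * (\<Sum>d\<in>DD m. 1 / real d) \<le>
        4 * X * (1 + ln (X + 1)) / real m * (w powr (-(9/10)) * sigma_neg (1/10) (divisor_sum m))"
      using X m0 by (intro mult_left_mono 2) auto
    also have "\<dots> = 4 * X * (1 + ln (X + 1)) * w powr (-(9/10)) * (sigma_neg (1/10) (divisor_sum m) / real m)"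
      by simp
    finally show "real (card (\<Union>d\<in>DD m. \<Union>p\<in>PP m d. Z m p)) \<le>
        4 * X * (1 + ln (X + 1)) * w powr (-(9/10)) * (sigma_neg (1/10) (divisor_sum m) / real m)" .
  qed
  also have "\<dots> = 4 * X * (1 + ln (X + 1)) * w powr (-(9/10)) *
       (\<Sum>m | m \<ge> 1 \<and> real m \<le> X. sigma_neg (1/10) (divisor_sum m) / real m)"
    by (simp only: sum_distrib_left MM_def)
  finally show "real (card (exc_gcd y w X H)) \<le> 4 * X * (1 + ln (X + 1)) * w powr (-(9/10)) *
       (\<Sum>m | m \<ge> 1 \<and> real m \<le> X. sigma_neg (1/10) (divisor_sum m) / real m)" .
qed

section \<open>Exceptional integers with small gcd: divisors along arithmetic progressions\<close>

text \<open>One of d and n / d has square at most n. Using only small divisors keeps the moduli, in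
  the average over a progression, of at most the order of its length.\<close>

lemma tau_le_small_divisors:
  assumes "n > 0"
  shows "tau n \<le> 2 * card {r. r dvd n \<and> r\<^sup>2 \<le> n}"
proof -
  let ?S = "{r. r dvd n \<and> r\<^sup>2 \<le> n}"
  have fin: "finite ?S" using assms by simp
  have "{d. d dvd n} \<subseteq> ?S \<union> (\<lambda>r. n div r) ` ?S"
  proof
    fix d assume "d \<in> {d. d dvd n}"
    then obtain k where k: "n = d * k" by auto
    show "d \<in> ?S \<union> (\<lambda>r. n div r) ` ?S"
    proof (cases "d \<le> k")
      case True
      hence "d\<^sup>2 \<le> n" unfolding k power2_eq_square by (intro mult_left_mono) auto
      thus ?thesis using k by auto
    next
      case False
      hence "k\<^sup>2 \<le> n" unfolding k power2_eq_square by (intro mult_right_mono) auto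
      moreover have "d = n div k" "k dvd n" using k assms by auto
      ultimately show ?thesis by blast
    qed
  qed
  hence "tau n \<le> card (?S \<union> (\<lambda>r. n div r) ` ?S)" unfolding tau_def using fin by (intro card_mono) auto
  also have "\<dots> \<le> card ?S + card ((\<lambda>r. n div r) ` ?S)" by (rule card_Un_le)
  also have "\<dots> \<le> card ?S + card ?S" using fin by (intro add_left_mono card_image_le)
  finally show ?thesis by simp
qed

text \<open>Exchange the sums: for each r <= sqrt Y the t for which r divides \<open>W t\<close> lie
  in one class modulo r if p does not divide r, and there are none if p divides r, since 0 < |c| <
  p. The condition sqrt Y <= 2 B bounds the error terms, one for each r, by 2 B.\<close>

lemma sum_tau_progression_le:
  fixes W :: "nat \<Rightarrow> nat" and B Y :: real and c :: int
  assumes p: "prime p" and c: "c \<noteq> 0" "\<bar>c\<bar> < int p"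
    and W: "\<And>t. t \<ge> 1 \<Longrightarrow> int (W t) = int p * int t + c" 
    and Y: "Y \<ge> 1" "\<And>t. t \<ge> 1 \<Longrightarrow> real t \<le> B \<Longrightarrow> real (W t) \<le> Y" and B: "B \<ge> 0" "sqrt Y \<le> 2 * B"
  shows "(\<Sum>t | t \<ge> 1 \<and> real t \<le> B. real (tau (W t))) \<le> 2 * B * (3 + ln Y)"
proof -
  define T where "T = {t::nat. t \<ge> 1 \<and> real t \<le> B}"
  define R where "R = {1..nat \<lfloor>sqrt Y\<rfloor>}"
  have finT: "finite T" unfolding T_def by (rule finite_nat_le_real)
  have W0: "W t > 0" if "t \<ge> 1" for t
  proof -
    have "int p * 1 \<le> int p * int t" using that by (intro mult_left_mono) auto
    thus ?thesis using W[OF that] c by linarith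
  qed
  have "(\<Sum>t\<in>T. real (tau (W t))) \<le> (\<Sum>t\<in>T. 2 * (\<Sum>r\<in>R. if r dvd W t then 1 else 0))"
  proof (rule sum_mono)
    fix t assume t: "t \<in> T"
    have Wt: "W t > 0" "real (W t) \<le> Y" using t W0 Y by (auto simp: T_def)
    have "tau (W t) \<le> 2 * card {r. r dvd W t \<and> r\<^sup>2 \<le> W t}" by (rule tau_le_small_divisors[OF Wt(1)])
    also have "card {r. r dvd W t \<and> r\<^sup>2 \<le> W t} \<le> card {r \<in> R. r dvd W t}"
    proof (intro card_mono subsetI)
      fix r assume r: "r \<in> {r. r dvd W t \<and> r\<^sup>2 \<le> W t}"
      have "(real r)\<^sup>2 \<le> real (W t)" using r by (metis (mono_tags) mem_Collect_eq of_nat_le_iff of_nat_power)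
      hence "real r \<le> sqrt Y" using Wt(2) by (intro real_le_rsqrt) linarith
      moreover have "r \<noteq> 0" using r Wt(1) by (intro notI) simp
      ultimately show "r \<in> {r \<in> R. r dvd W t}" using r by (simp add: R_def le_nat_floor Suc_le_eq)
    qed (simp add: R_def)
    finally have "real (tau (W t)) \<le> 2 * real (card {r \<in> R. r dvd W t})" by linarith
    also have "real (card {r \<in> R. r dvd W t}) = (\<Sum>r\<in>R. if r dvd W t then 1 else 0)"
      by (subst sum.inter_filter[symmetric]) (auto simp: R_def)
    finally show "real (tau (W t)) \<le> 2 * (\<Sum>r\<in>R. if r dvd W t then 1 else 0)" .
  qed
  also have "\<dots> = 2 * (\<Sum>t\<in>T. \<Sum>r\<in>R. if r dvd W t then 1 else 0)" by (simp only: sum_distrib_left)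
  also have "(\<Sum>t\<in>T. \<Sum>r\<in>R. if r dvd W t then 1 else (0::real)) = (\<Sum>r\<in>R. \<Sum>t\<in>T. if r dvd W t then 1 else 0)"
    by (rule sum.swap)
  also have "\<dots> \<le> (\<Sum>r\<in>R. B * (1 / real r) + 1)"
  proof (rule sum_mono)
    fix r assume r: "r \<in> R"
    have r1: "r \<ge> 1" using r by (simp add: R_def)
    have "(\<Sum>t\<in>T. if r dvd W t then 1 else (0::real)) = real (card {t \<in> T. r dvd W t})"
      by (subst sum.inter_filter[symmetric]) (auto simp: finT)
    also have "\<dots> \<le> B / real r + 1"
    proof (cases "p dvd r")
      case True
      have empty: "{t \<in> T. r dvd W t} = {}"
      proof (rule ccontr)
        assume "{t \<in> T. r dvd W t} \<noteq> {}"
        then obtain t where t: "t \<ge> 1" "r dvd W t" by (auto simp: T_def)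
        have "int p dvd int (W t)" using True t(2) by (meson dvd_trans of_nat_dvd_iff)
        hence "int p dvd c" unfolding W[OF t(1)] by (simp add: dvd_add_right_iff)
        hence "int p \<le> \<bar>c\<bar>" using c(1) by (metis abs_of_nat dvd_imp_le_int)
        thus False using c(2) by simp
      qed
      show ?thesis unfolding empty using B r1 by simp
    next
      case False
      have cop: "coprime (int r) (int p)" using prime_imp_coprime[OF p False] by (simp add: coprime_commute)
      show ?thesis
      proof (rule card_residue_class_le[OF r1 B(1)])
        fix a b assume ab: "a \<in> {t \<in> T. r dvd W t}" "b \<in> {t \<in> T. r dvd W t}"
        hence "int r dvd int (W a) - int (W b)" by (intro dvd_diff) auto
        also have "int (W a) - int (W b) = int p * (int a - int b)"
          using ab W[of a] W[of b] by (simp add: T_def algebra_simps)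
        finally show "int r dvd int a - int b" using cop by (simp add: coprime_dvd_mult_right_iff)
      qed (auto simp: T_def)
    qed
    finally show "(\<Sum>t\<in>T. if r dvd W t then 1 else (0::real)) \<le> B * (1 / real r) + 1" by simp
  qed
  also have "\<dots> = B * (\<Sum>r\<in>R. 1 / real r) + real (card R)"
    by (simp add: sum.distrib sum_distrib_left)
  also have "\<dots> \<le> B * (1 + ln Y) + 2 * B"
  proof (intro add_mono mult_left_mono B harm_le_one_plus_ln_real Y)
    have "sqrt Y \<le> Y" using Y(1) by (intro real_le_lsqrt) (auto simp: power2_eq_square)
    fix i assume "i \<in> R"
    hence i: "1 \<le> i" "i \<le> nat \<lfloor>sqrt Y\<rfloor>" by (auto simp: R_def)
    have "real i \<le> real (nat \<lfloor>sqrt Y\<rfloor>)" using i by simp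
    also have "\<dots> \<le> sqrt Y" using Y by (intro of_nat_floor) simp
    finally show "1 \<le> i \<and> real i \<le> Y" using i \<open>sqrt Y \<le> Y\<close> by linarith
  next
    have "real (card R) \<le> sqrt Y" using Y by (simp add: R_def)
    thus "real (card R) \<le> 2 * B" using B by linarith
  qed
  finally have "(\<Sum>t\<in>T. real (tau (W t))) \<le> 2 * (B * (1 + ln Y) + 2 * B)" by simp
  also have "\<dots> = 2 * B * (3 + ln Y)" by (simp add: algebra_simps)
  finally show ?thesis by (simp add: T_def)
qed

text \<open>The weight e^(1/20) comes from tau(e). The exponent -2 + 1/20 is split as -9/10 - 21/20:
  the first part is evaluated at the lower bound E, the second is summed and gives 1 + 20 = 21. The
  sum over d is harmonic.\<close>

lemma sum_pairs_powr_le: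
  fixes E w :: real
  assumes fin: "finite A" and A: "\<And>d e. (d, e) \<in> A \<Longrightarrow> d \<ge> 1 \<and> real d \<le> w \<and> e \<ge> (1::nat) \<and> real e \<ge> E"
    and E: "E > 0" and w: "w \<ge> 1"
  shows "(\<Sum>(d, e)\<in>A. real e powr (1/20) / ((real e)\<^sup>2 * real d)) \<le> 21 * (1 + ln w) * E powr (-(9/10))"
proof -
  have finA: "finite (fst ` A)" "finite (snd ` A)" using fin by auto
  have "(\<Sum>(d, e)\<in>A. real e powr (1/20) / ((real e)\<^sup>2 * real d)) \<le>
      (\<Sum>(d, e)\<in>A. (1 / real d) * (E powr (-(9/10)) * real e powr (-(1+1/20))))"
  proof (rule sum_mono, safe)
    fix d e assume "(d, e) \<in> A"
    note de = A[OF this]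
    have e0: "real e > 0" using de by auto
    have "real e powr (1/20) / (real e)\<^sup>2 = real e powr (-(9/10)) * real e powr (-(1+1/20))"
      using e0 by (simp add: powr_add[symmetric] powr_diff[symmetric] flip: powr_numeral)
    also have "\<dots> \<le> E powr (-(9/10)) * real e powr (-(1+1/20))"
      using de E by (intro mult_right_mono powr_mono2') auto
    finally have "(1 / real d) * (real e powr (1/20) / (real e)\<^sup>2) \<le> (1 / real d) * (E powr (-(9/10)) * real e powr (-(1+1/20)))"
      by (intro mult_left_mono) auto
    thus "real e powr (1/20) / ((real e)\<^sup>2 * real d) \<le> (1 / real d) * (E powr (-(9/10)) * real e powr (-(1+1/20)))"
      by (simp add: mult.commute)
  qed
  also have "\<dots> \<le> (\<Sum>(d, e)\<in>fst ` A \<times> snd ` A. (1 / real d) * (E powr (-(9/10)) * real e powr (-(1+1/20))))"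
    using finA by (intro sum_mono2) (force simp: image_iff)+
  also have "\<dots> = (\<Sum>d\<in>fst ` A. 1 / real d) * (E powr (-(9/10)) * (\<Sum>e\<in>snd ` A. real e powr (-(1+1/20))))"
    unfolding sum_distrib_left[of "E powr (-(9/10))"] by (simp only: sum_product sum.cartesian_product)
  also have "\<dots> \<le> (1 + ln w) * (E powr (-(9/10)) * (1 + 1 / (1/20)))"
  proof (intro mult_mono mult_left_mono harm_le_one_plus_ln_real[OF w] sum_powr_le finA)
    show "0 \<notin> snd ` A" using A by force
  qed (use A w in \<open>auto intro!: sum_nonneg mult_nonneg_nonneg\<close>)
  also have "\<dots> = 21 * (1 + ln w) * E powr (-(9/10))" by simp
  finally show ?thesis .
qed


text \<open>H has either sign. The condition y >= (h + 2) w makes e > h + 2 in every factorisation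
  p1 + 1 = d e with d <= w, hence |H| d < p1. C is the constant of the divisor bound with exponent
  1/20.\<close>

locale exc_div_setting =
  fixes H :: int and h :: nat and X y w C :: real
  assumes H: "H \<noteq> 0" "\<bar>H\<bar> \<le> int h" and X: "X \<ge> 1" and w: "w \<ge> 1" and y: "(real h + 2) * w \<le> y"
    and C: "C \<ge> 0" "\<And>n. n > 0 \<Longrightarrow> real (tau n) \<le> C * real n powr (1/20)"
begin

definition Y :: real where "Y = (1 + real h) * X"

definition pr :: "nat \<Rightarrow> nat \<Rightarrow> nat" where "pr d e = d * e - 1"

definition DE :: "(nat \<times> nat) set" where
  "DE = {(d, e). prime (pr d e) \<and> y < real (pr d e) \<and> d \<ge> 1 \<and> real d \<le> w \<and> e \<ge> 1 \<and> real (pr d e) \<le> X}"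

text \<open>The length of the range of t: e t <= m1 + h together with m1 p1 <= X and p1 <= X gives e
  t p1 <= Y.\<close>

definition B :: "nat \<Rightarrow> nat \<Rightarrow> real" where "B d e = Y / (real e * real (pr d e))"

text \<open>From m2 p2 = m1 p1 + H and m1 = m2 + H + e t one gets m2 (p2 - p1) = H (p1 + 1) + e t p1
  = e (p1 t + H d); this is the second factor. For (d, e) in \<open>DE\<close> and t >= 1 it is
  positive since |H| d < p1, so \<open>nat\<close> does not truncate.\<close>

definition cofactor :: "nat \<Rightarrow> nat \<Rightarrow> nat \<Rightarrow> nat" where
  "cofactor d e t = nat (int (pr d e) * int t + H * int d)"

lemma Y1: "Y \<ge> 1"
proof -
  have "1 * 1 \<le> (1 + real h) * X" using X by (intro mult_mono) auto
  thus ?thesis by (simp add: Y_def)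
qed

lemma finite_DE: "finite DE"
proof (rule finite_subset)
  show "DE \<subseteq> {1..nat \<lfloor>X + 1\<rfloor>} \<times> {1..nat \<lfloor>X + 1\<rfloor>}"
  proof
    fix x assume "x \<in> DE"
    then obtain d e where x: "x = (d, e)" and de: "d \<ge> 1" "e \<ge> 1" "real (pr d e) \<le> X" by (auto simp: DE_def)
    have "d \<le> d * e" "e \<le> d * e" using de by auto
    moreover have "real (d * e) \<le> real (pr d e) + 1" unfolding pr_def by linarith
    hence "d * e \<le> nat \<lfloor>X + 1\<rfloor>" using de(3) by (intro le_nat_floor) linarith
    ultimately have "d \<le> nat \<lfloor>X + 1\<rfloor> \<and> e \<le> nat \<lfloor>X + 1\<rfloor>" by linarith
    thus "x \<in> {1..nat \<lfloor>X + 1\<rfloor>} \<times> {1..nat \<lfloor>X + 1\<rfloor>}" using x de by simp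
  qed
qed simp

lemma DE_facts:
  assumes "(d, e) \<in> DE"
  shows "prime (pr d e)" "pr d e \<ge> 1" "d * e = (pr d e) + 1" "e \<ge> h + 2" "h * d < pr d e"
    "d \<ge> 1" "real d \<le> w" "real e \<ge> y / w" "H * int d \<noteq> 0" "\<bar>H * int d\<bar> < int (pr d e)"
    "2 * B d e \<le> 4 * Y / ((real e)\<^sup>2 * real d)" "B d e \<ge> 0"
proof -
  have de: "prime (pr d e)" "y < real (pr d e)" "d \<ge> 1" "real d \<le> w" "e \<ge> 1" using assms by (auto simp: DE_def)
  show "prime (pr d e)" "d \<ge> 1" "real d \<le> w" by fact+
  show p1: "pr d e \<ge> 1" using prime_ge_1_nat[OF de(1)] .
  thus pe: "d * e = (pr d e) + 1" unfolding pr_def by linarith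
  have pe': "real d * real e = real (pr d e) + 1" by (metis pe of_nat_mult of_nat_Suc Suc_eq_plus1 add.commute)
  have "y < real d * real e" using de(2) pe' by linarith
  also have "\<dots> \<le> w * real e" using de by (intro mult_right_mono) auto
  finally have ywe: "y < w * real e" .
  thus "real e \<ge> y / w" using w by (simp add: field_simps)
  have "w * (real h + 2) < w * real e" using ywe y by (simp add: mult.commute)
  hence "real h + 2 < real e" using w by simp
  thus eh: "e \<ge> h + 2" by linarith
  have "(h + 2) * d \<le> e * d" using eh by (rule mult_le_mono1)
  thus hd: "h * d < pr d e" using de(3) pe by (simp add: mult.commute[of e d])
  show "H * int d \<noteq> 0" using H de by simp
  have "\<bar>H * int d\<bar> \<le> int h * int d" using H unfolding abs_mult by (intro mult_mono) auto
  also have "\<dots> < int (pr d e)" using hd by (metis of_nat_less_iff of_nat_mult)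
  finally show "\<bar>H * int d\<bar> < int (pr d e)" .
  show "B d e \<ge> 0" using Y1 by (simp add: B_def)
  have "real e * (real e * real d) \<le> real e * (2 * real (pr d e))"
    using pe' p1 by (intro mult_left_mono) (auto simp: mult.commute)
  \<comment> \<open>d e = p + 1 <= 2 p replaces p by d e / 2, so that the later sum over pairs
    separates into d and e.\<close>
  hence le: "(real e)\<^sup>2 * real d / 2 \<le> real e * real (pr d e)" by (simp add: power2_eq_square)
  have "B d e \<le> Y / ((real e)\<^sup>2 * real d / 2)"
  proof -
    have "real (pr d e) > 0" using p1 by simp
    thus ?thesis unfolding B_def using le Y1 de by (intro divide_left_mono mult_pos_pos) auto
  qed
  thus "2 * B d e \<le> 4 * Y / ((real e)\<^sup>2 * real d)" by simp
qed

lemma cofactor: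
  assumes "(d, e) \<in> DE" "t \<ge> 1"
  shows "int (cofactor d e t) = int (pr d e) * int t + H * int d" "cofactor d e t > 0"
    "real t \<le> B d e \<Longrightarrow> real e * real (cofactor d e t) \<le> 2 * Y" "real t \<le> B d e \<Longrightarrow> real (cofactor d e t) \<le> Y"
proof -
  note f = DE_facts[OF assms(1)]
  let ?p = "pr d e"
  have pt: "int ?p * 1 \<le> int ?p * int t" using assms(2) by (intro mult_left_mono) auto
  hence pos: "int ?p * int t + H * int d > 0" using f(10) by linarith
  thus eq: "int (cofactor d e t) = int ?p * int t + H * int d" by (simp add: cofactor_def)
  with pos show "cofactor d e t > 0" by linarith
  have "int (cofactor d e t) \<le> 2 * (int ?p * int t)" using eq pt f(10) by linarith
  hence "int (cofactor d e t) \<le> int (2 * (?p * t))" by simp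
  hence "real (cofactor d e t) \<le> 2 * (real ?p * real t)" by (metis of_nat_le_iff of_nat_mult of_nat_numeral)
  hence "real e * real (cofactor d e t) \<le> real e * (2 * (real ?p * real t))" by (intro mult_left_mono) auto
  also have "\<dots> = 2 * ((real e * real ?p) * real t)" by simp
  finally have 1: "real e * real (cofactor d e t) \<le> 2 * ((real e * real ?p) * real t)" .
  have ep: "real e * real ?p > 0" using f(2,4) by simp
  show 2: "real e * real (cofactor d e t) \<le> 2 * Y" if "real t \<le> B d e"
  proof -
    have "(real e * real ?p) * real t \<le> (real e * real ?p) * B d e" using that ep by (intro mult_left_mono) auto
    also have "\<dots> = Y"
    proof -
      have "c * (Y / c) = Y" if "c > 0" for c using that by simp
      from this[OF ep] show ?thesis by (simp only: B_def)
    qed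
    finally show ?thesis using 1 by linarith
  qed
  show "real (cofactor d e t) \<le> Y" if "real t \<le> B d e"
  proof -
    have "2 * real (cofactor d e t) \<le> real e * real (cofactor d e t)" using f(4) by (intro mult_right_mono) auto
    thus ?thesis using 2[OF that] by linarith
  qed
qed

text \<open>For p <= Y^(1/5) one has e p <= 2 p^2 <= 2 Y^(2/5), so the range of t has length at
  least Y^(3/5) / 2 and the average applies; only the fixed factor tau(e) is bounded pointwise. For
  larger p the whole divisor function is bounded by C (2 Y)^(1/20), which the size of e compensates
  later.\<close>

lemma sum_tau_cofactor_le:
  assumes de: "(d, e) \<in> DE"
  shows "(\<Sum>t | t \<ge> 1 \<and> real t \<le> B d e. real (tau (e * cofactor d e t))) \<le>
    4 * Y * C * (if real (pr d e) \<le> Y powr (1/5) then 3 + ln Y else (2 * Y) powr (1/20)) *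
       (real e powr (1/20) / ((real e)\<^sup>2 * real d))"
proof -
  note f = DE_facts[OF de]
  let ?p = "pr d e"
  let ?T = "{t::nat. t \<ge> 1 \<and> real t \<le> B d e}"
  have e1: "real e \<ge> 1" using f(4) by simp
  define q where "q = (if real ?p \<le> Y powr (1/5) then 3 + ln Y else (2 * Y) powr (1/20))"
  have "(\<Sum>t\<in>?T. real (tau (e * cofactor d e t))) \<le> C * real e powr (1/20) * q * (2 * B d e)"
  proof (cases "real ?p \<le> Y powr (1/5)")
    case True
    have "(\<Sum>t\<in>?T. real (tau (e * cofactor d e t))) \<le> (\<Sum>t\<in>?T. real (tau e) * real (tau (cofactor d e t)))"
    proof (rule sum_mono)
      fix t assume "t \<in> ?T"
      hence "tau (e * cofactor d e t) \<le> tau e * tau (cofactor d e t)"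
        using cofactor(2)[OF de] f(4) by (intro tau_mult_le) auto
      thus "real (tau (e * cofactor d e t)) \<le> real (tau e) * real (tau (cofactor d e t))"
        by (metis of_nat_le_iff of_nat_mult)
    qed
    also have "\<dots> = real (tau e) * (\<Sum>t\<in>?T. real (tau (cofactor d e t)))" by (simp only: sum_distrib_left)
    also have "\<dots> \<le> (C * real e powr (1/20)) * (2 * B d e * (3 + ln Y))"
    proof (intro mult_mono)
      show "real (tau e) \<le> C * real e powr (1/20)" using f(4) by (intro C) auto
      have "sqrt Y \<le> 2 * B d e"
      proof -
        have p0: "real ?p \<ge> 1" using f(2) by linarith
        have "e \<le> d * e" using f(6) by simp
        also have "\<dots> = ?p + 1" by (rule f(3))
        also have "\<dots> \<le> 2 * ?p" using f(2) by linarith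
        finally have "real e \<le> 2 * real ?p" by (metis of_nat_le_iff of_nat_mult of_nat_numeral)
        hence "real e * real ?p \<le> 2 * real ?p * real ?p" by (intro mult_right_mono) auto
        also have "\<dots> = 2 * (real ?p)\<^sup>2" by (simp add: power2_eq_square)
        also have "\<dots> \<le> 2 * (Y powr (1/5))\<^sup>2" using True by (intro mult_left_mono power_mono) auto
        also have "(Y powr (1/5))\<^sup>2 = Y powr (2/5)" using Y1 by (simp add: power2_eq_square powr_add[symmetric])
        finally have "Y / (2 * Y powr (2/5)) \<le> B d e"
          unfolding B_def using Y1 p0 e1 by (intro divide_left_mono) auto
        moreover have "Y / (2 * Y powr (2/5)) = Y powr (3/5) / 2"
        proof -
          have "Y = Y powr (3/5) * Y powr (2/5)" using Y1 by (simp add: powr_add[symmetric])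
          thus ?thesis using Y1 by (simp add: field_simps)
        qed
        moreover have "sqrt Y \<le> Y powr (3/5)"
          using Y1 powr_mono[of "1/2" "3/5" Y] by (simp add: powr_half_sqrt)
        ultimately show ?thesis by linarith
      qed
      thus "(\<Sum>t\<in>?T. real (tau (cofactor d e t))) \<le> 2 * B d e * (3 + ln Y)"
        by (intro sum_tau_progression_le[OF f(1,9,10)] cofactor(1)[OF de] cofactor(4)[OF de] Y1 f(12)) auto
    qed (use C(1) in \<open>auto intro: sum_nonneg\<close>)
    finally show ?thesis using True by (simp add: q_def mult_ac)
  next
    case False
    have "(\<Sum>t\<in>?T. real (tau (e * cofactor d e t))) \<le> (\<Sum>t\<in>?T. C * (2 * Y) powr (1/20))"
    proof (rule sum_mono)
      fix t assume t: "t \<in> ?T"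
      have c: "cofactor d e t > 0" "real e * real (cofactor d e t) \<le> 2 * Y" using t cofactor(2,3)[OF de, of t] by auto
      have "real (tau (e * cofactor d e t)) \<le> C * real (e * cofactor d e t) powr (1/20)"
        using c f(4) by (intro C) simp
      also have "\<dots> \<le> C * (2 * Y) powr (1/20)"
        using c C(1) by (intro mult_left_mono powr_mono2) auto
      finally show "real (tau (e * cofactor d e t)) \<le> C * (2 * Y) powr (1/20)" .
    qed
    also have "\<dots> = real (card ?T) * (C * (2 * Y) powr (1/20))" by simp
    also have "\<dots> \<le> B d e * (C * (2 * Y) powr (1/20))"
    proof (rule mult_right_mono)
      have "card ?T \<le> card {1..nat \<lfloor>B d e\<rfloor>}" by (intro card_mono) (auto simp: le_nat_floor)
      hence "real (card ?T) \<le> real (nat \<lfloor>B d e\<rfloor>)" by simp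
      also have "\<dots> \<le> B d e" using f(12) by (rule of_nat_floor)
      finally show "real (card ?T) \<le> B d e" .
    qed (use C in auto)
    also have "\<dots> \<le> (2 * B d e) * (C * (2 * Y) powr (1/20) * real e powr (1/20))"
    proof (rule mult_mono)
      \<comment> \<open>Inserted so that both ranges of p lead to the same sum over (d, e).\<close>
      have "1 \<le> real e powr (1/20)" using e1 by (simp add: ge_one_powr_ge_zero)
      hence "C * (2 * Y) powr (1/20) * 1 \<le> C * (2 * Y) powr (1/20) * real e powr (1/20)" using C by (intro mult_left_mono) auto
      thus "C * (2 * Y) powr (1/20) \<le> C * (2 * Y) powr (1/20) * real e powr (1/20)" by simp
    qed (use f(12) C in auto)
    finally show ?thesis using False by (simp add: q_def mult_ac)
  qed
  also have "\<dots> \<le> C * real e powr (1/20) * q * (4 * Y / ((real e)\<^sup>2 * real d))"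
    using f(11) C Y1 by (intro mult_left_mono) (auto simp: q_def)
  also have "\<dots> = 4 * Y * C * q * (real e powr (1/20) / ((real e)\<^sup>2 * real d))" by simp
  finally show ?thesis by (simp only: q_def)
qed

text \<open>The map \<open>F\<close> recovers N = (m2 + H + e t) p1 from the divisor m2, with p1 = d
  e - 1. Small p1 uses e >= y / w; for p1 > Y^(1/5) one has e >= Y^(1/5) / w, and (Y^(1/5))^(-9/10)
  outweighs Y^(1/20). The constant is 84 = 4 * 21.\<close>

lemma card_exc_div_le:
  "finite (exc_div y w X H)"
  "real (card (exc_div y w X H)) \<le> 84 * Y * C * (1 + ln w) *
     ((3 + ln Y) * (y / w) powr (-(9/10)) + (2 * Y) powr (1/20) * (Y powr (1/5) / w) powr (-(9/10)))"
proof -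
  define T where "T = (\<lambda>d e. {t::nat. t \<ge> 1 \<and> real t \<le> B d e})"
  define F where "F = (\<lambda>d e t m. nat ((int m + H + int (e * t)) * int (pr d e)))"
  define U where "U = (\<Union>(d, e)\<in>DE. \<Union>t\<in>T d e. F d e t ` {m. m dvd e * cofactor d e t})"
  have finT: "finite (T d e)" for d e unfolding T_def by (rule finite_nat_le_real)
  have finDv: "finite {m. m dvd e * cofactor d e t}" if "(d, e) \<in> DE" "t \<in> T d e" for d e t
    using that cofactor(2)[OF that(1), of t] DE_facts(4)[OF that(1)] by (auto simp: T_def)
  have finU: "finite U" unfolding U_def using finite_DE finT finDv by (auto intro!: finite_UN_I)
  have sub: "exc_div y w X H \<subseteq> U"
  proof
    fix N assume "N \<in> exc_div y w X H"
    then obtain m1 m2 p1 p2 d e t where *: "real N \<le> X" "prime p1" "prime p2" "y < real p1" "p1 < p2"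
      "m1 \<ge> 1" "m2 \<ge> 1" "N = m1 * p1" "int N + H = int (m2 * p2)" "real (m2 * p2) \<le> X"
      "p1 + 1 = d * e" "real d \<le> w" "t \<ge> 1" "int m1 = int m2 + H + int (e * t)" unfolding exc_div_def by blast
    have p1: "p1 = pr d e" unfolding pr_def using *(11) by linarith
    have de1: "d \<ge> 1" "e \<ge> 1" using *(11) by (cases d; cases e; simp)+
    have "1 * p1 \<le> m1 * p1" using *(6) by (rule mult_le_mono1)
    hence pX: "real p1 \<le> X" using *(1,8) by (smt (verit) mult_1 of_nat_le_iff)
    have DE: "(d, e) \<in> DE" using * de1 pX by (simp add: DE_def flip: p1)
    have ep: "real e * real p1 > 0" using de1 prime_gt_0_nat[OF *(2)] by simp
    have "int (e * t) \<le> int (m1 + h)" using *(14,7) H(2) by linarith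
    hence "real (e * t) \<le> real (m1 + h)" by linarith
    hence "real (e * t) * real p1 \<le> real (m1 + h) * real p1" by (intro mult_right_mono) auto
    also have "\<dots> = real N + real h * real p1" using *(8) by (simp add: algebra_simps)
    also have "\<dots> \<le> X + real h * X" using *(1) pX by (intro add_mono mult_left_mono) auto
    finally have "real e * real p1 * real t \<le> Y" by (simp add: Y_def algebra_simps)
    hence tT: "t \<in> T d e" using *(13) ep by (simp add: T_def B_def field_simps flip: p1)
    have "int (m2 * p2) = (int m2 + H + int (e * t)) * int p1 + H" using *(8,9,14) by (metis of_nat_mult)
    also have "\<dots> = int m2 * int p1 + (H * (int p1 + 1) + int (e * t) * int p1)" by (simp add: algebra_simps)
    also have "int p1 + 1 = int d * int e" using *(11) by (metis of_nat_mult of_nat_Suc Suc_eq_plus1 add.commute)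
    also have "H * (int d * int e) + int (e * t) * int p1 = int e * int (cofactor d e t)"
      unfolding cofactor(1)[OF DE *(13)] p1[symmetric] by (simp add: algebra_simps)
    finally have "int e * int (cofactor d e t) = int m2 * (int p2 - int p1)" by (simp add: algebra_simps)
    hence "int m2 dvd int (e * cofactor d e t)" by simp
    hence mdvd: "m2 dvd e * cofactor d e t" by (simp only: of_nat_dvd_iff)
    have "int N = (int m2 + H + int (e * t)) * int (pr d e)" using *(8,14) p1 by (metis of_nat_mult)
    hence "nat (int N) = F d e t m2" unfolding F_def by (rule arg_cong)
    hence "N = F d e t m2" by (simp only: nat_int)
    thus "N \<in> U" unfolding U_def using DE tT mdvd by blast
  qed
  show "finite (exc_div y w X H)" using finite_subset[OF sub finU] .
  define E1 where "E1 = {(d, e) \<in> DE. real (pr d e) \<le> Y powr (1/5)}"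
  define E2 where "E2 = {(d, e) \<in> DE. \<not> real (pr d e) \<le> Y powr (1/5)}"
  define G where "G = (\<lambda>d e::nat. real e powr (1/20) / ((real e)\<^sup>2 * real d))"
  have split: "DE = E1 \<union> E2" "E1 \<inter> E2 = {}" by (auto simp: E1_def E2_def)
  have finE: "finite E1" "finite E2" using finite_DE split(1) by auto
  have "real (card (exc_div y w X H)) \<le> real (card U)" by (intro of_nat_mono card_mono finU sub)
  also have "\<dots> \<le> real (\<Sum>(d, e)\<in>DE. \<Sum>t\<in>T d e. tau (e * cofactor d e t))"
  proof (rule of_nat_mono)
    have "card U \<le> (\<Sum>x\<in>DE. card (case x of (d, e) \<Rightarrow> \<Union>t\<in>T d e. F d e t ` {m. m dvd e * cofactor d e t}))"
      unfolding U_def by (rule card_UN_le[OF finite_DE])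
    also have "\<dots> \<le> (\<Sum>(d, e)\<in>DE. \<Sum>t\<in>T d e. tau (e * cofactor d e t))"
    proof (rule sum_mono, clarify)
      fix d e assume de: "(d, e) \<in> DE"
      have "card (\<Union>t\<in>T d e. F d e t ` {m. m dvd e * cofactor d e t}) \<le>
          (\<Sum>t\<in>T d e. card (F d e t ` {m. m dvd e * cofactor d e t}))" by (rule card_UN_le[OF finT])
      also have "\<dots> \<le> (\<Sum>t\<in>T d e. tau (e * cofactor d e t))"
        unfolding tau_def by (intro sum_mono card_image_le finDv de)
      finally show "card (\<Union>t\<in>T d e. F d e t ` {m. m dvd e * cofactor d e t}) \<le> (\<Sum>t\<in>T d e. tau (e * cofactor d e t))" .
    qed
    finally show "card U \<le> (\<Sum>(d, e)\<in>DE. \<Sum>t\<in>T d e. tau (e * cofactor d e t))" .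
  qed
  also have "\<dots> = (\<Sum>(d, e)\<in>DE. \<Sum>t\<in>T d e. real (tau (e * cofactor d e t)))"
    by (simp add: case_prod_unfold)
  also have "\<dots> \<le> (\<Sum>(d, e)\<in>DE. 4 * Y * C * (if real (pr d e) \<le> Y powr (1/5) then 3 + ln Y else (2 * Y) powr (1/20)) * G d e)"
    unfolding T_def G_def by (intro sum_mono) (clarify, rule sum_tau_cofactor_le)
  also have "\<dots> = (\<Sum>(d, e)\<in>E1. 4 * Y * C * (3 + ln Y) * G d e) + (\<Sum>(d, e)\<in>E2. 4 * Y * C * (2 * Y) powr (1/20) * G d e)"
    unfolding split(1) using finE split(2)
    by (subst sum.union_disjoint) (auto simp: E1_def E2_def intro!: arg_cong2[of _ _ _ _ "(+)"] sum.cong)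
  also have "\<dots> = 4 * Y * C * (3 + ln Y) * (\<Sum>(d, e)\<in>E1. G d e) + 4 * Y * C * (2 * Y) powr (1/20) * (\<Sum>(d, e)\<in>E2. G d e)"
    by (simp only: sum_distrib_left case_prod_unfold)
  also have "\<dots> \<le> 4 * Y * C * (3 + ln Y) * (21 * (1 + ln w) * (y / w) powr (-(9/10))) +
      4 * Y * C * (2 * Y) powr (1/20) * (21 * (1 + ln w) * (Y powr (1/5) / w) powr (-(9/10)))"
  proof (intro add_mono mult_left_mono)
    have y0: "y > 0" using y w by (smt (verit) mult_pos_pos of_nat_0_le_iff)
    show "(\<Sum>(d, e)\<in>E1. G d e) \<le> 21 * (1 + ln w) * (y / w) powr (-(9/10))"
      unfolding G_def
    proof (rule sum_pairs_powr_le[OF finE(1)])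
      fix d e assume "(d, e) \<in> E1"
      hence de: "(d, e) \<in> DE" by (simp add: E1_def)
      show "1 \<le> d \<and> real d \<le> w \<and> 1 \<le> e \<and> y / w \<le> real e" using DE_facts(4,6,7,8)[OF de] by linarith
    qed (use w y0 in auto)
    show "(\<Sum>(d, e)\<in>E2. G d e) \<le> 21 * (1 + ln w) * (Y powr (1/5) / w) powr (-(9/10))"
      unfolding G_def
    proof (rule sum_pairs_powr_le[OF finE(2)])
      fix d e assume "(d, e) \<in> E2"
      hence de: "(d, e) \<in> DE" and big: "Y powr (1/5) < real (pr d e)" by (auto simp: E2_def)
      have "real (pr d e) \<le> real (d * e)" unfolding pr_def by (intro of_nat_mono) simp
      also have "\<dots> \<le> w * real e" using DE_facts(7)[OF de] by (simp add: mult_right_mono)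
      finally have "Y powr (1/5) / w \<le> real e" using big w by (simp add: field_simps)
      thus "1 \<le> d \<and> real d \<le> w \<and> 1 \<le> e \<and> Y powr (1/5) / w \<le> real e" using DE_facts(4,6,7)[OF de] by linarith
    qed (use w Y1 in auto)
  qed (use Y1 C in auto)
  also have "\<dots> = 84 * Y * C * (1 + ln w) *
     ((3 + ln Y) * (y / w) powr (-(9/10)) + (2 * Y) powr (1/20) * (Y powr (1/5) / w) powr (-(9/10)))"
    by (simp add: algebra_simps)
  finally show "real (card (exc_div y w X H)) \<le> 84 * Y * C * (1 + ln w) *
     ((3 + ln Y) * (y / w) powr (-(9/10)) + (2 * Y) powr (1/20) * (Y powr (1/5) / w) powr (-(9/10)))" .
qed

end


section \<open>Large square divisors and the combined bound with free parameters\<close>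

text \<open>A square p^2 <= X has at most 2 X / p^2 multiples, and p^(-2) <= y^(-9/10) p^(-11/10)
  for p > y; the sum over p is at most 11.\<close>

lemma card_large_square_divisor_le:
  fixes X y :: real
  assumes X: "X \<ge> 1" and y: "y > 0"
  shows "real (card {N. 1 \<le> N \<and> real N \<le> X \<and> (\<exists>p. prime p \<and> y < real p \<and> p\<^sup>2 dvd N)}) \<le> 22 * X * y powr (-(9/10))"
proof -
  define P where "P = {p::nat. (prime p \<and> y < real p \<and> (real p)\<^sup>2 \<le> X) \<and> real p \<le> X}"
  define Z where "Z = (\<lambda>p. {N. 1 \<le> N \<and> real N \<le> X \<and> p\<^sup>2 dvd N})"
  have finP: "finite P" unfolding P_def by (rule finite_nat_le_real)
  have finZ: "finite (Z p)" for p unfolding Z_def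
    by (rule finite_subset[OF _ finite_nat_le_real[of "\<lambda>_. True" X]]) auto
  have sub: "{N. 1 \<le> N \<and> real N \<le> X \<and> (\<exists>p. prime p \<and> y < real p \<and> p\<^sup>2 dvd N)} \<subseteq> (\<Union>p\<in>P. Z p)"
  proof
    fix N assume "N \<in> {N. 1 \<le> N \<and> real N \<le> X \<and> (\<exists>p. prime p \<and> y < real p \<and> p\<^sup>2 dvd N)}"
    then obtain p where p: "prime p" "y < real p" "p\<^sup>2 dvd N" "1 \<le> N" "real N \<le> X" by auto
    have "p\<^sup>2 \<le> N" using p by (intro dvd_imp_le) auto
    hence "(real p)\<^sup>2 \<le> X" using p(5) by (metis of_nat_le_iff of_nat_power order.trans)
    moreover have "real p * 1 \<le> real p * real p" using prime_ge_1_nat[OF p(1)] by (intro mult_left_mono) auto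
    ultimately have "p \<in> P" using p by (simp add: P_def power2_eq_square)
    thus "N \<in> (\<Union>p\<in>P. Z p)" using p by (auto simp: Z_def)
  qed
  have "real (card {N. 1 \<le> N \<and> real N \<le> X \<and> (\<exists>p. prime p \<and> y < real p \<and> p\<^sup>2 dvd N)}) \<le> real (\<Sum>p\<in>P. card (Z p))"
    using finP finZ by (intro of_nat_mono order.trans[OF card_mono[OF _ sub] card_UN_le]) auto
  also have "\<dots> = (\<Sum>p\<in>P. real (card (Z p)))" by simp
  also have "\<dots> \<le> (\<Sum>p\<in>P. 2 * X * y powr (-(9/10)) * real p powr (-(1+1/10)))"
  proof (rule sum_mono)
    fix p assume p: "p \<in> P"
    have p0: "real p > 0" using p y by (auto simp: P_def)
    have "real (card (Z p)) \<le> X / real (p\<^sup>2) + 1"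
    proof (rule card_residue_class_le)
      show "1 \<le> p\<^sup>2" using p0 by simp
      fix a b assume "a \<in> Z p" "b \<in> Z p"
      hence "int (p\<^sup>2) dvd int a" "int (p\<^sup>2) dvd int b" by (auto simp: Z_def simp del: of_nat_power)
      thus "int (p\<^sup>2) dvd int a - int b" by (rule dvd_diff)
    qed (use X in \<open>auto simp: Z_def\<close>)
    also have "1 \<le> X / real (p\<^sup>2)" using p p0 by (simp add: P_def)
    finally have "real (card (Z p)) \<le> 2 * X / (real p)\<^sup>2" by simp
    also have "\<dots> = 2 * X * (real p powr (-(9/10)) * real p powr (-(1+1/10)))"
      using p0 by (simp add: powr_add[symmetric] powr_minus_divide)
    also have "\<dots> \<le> 2 * X * (y powr (-(9/10)) * real p powr (-(1+1/10)))"
      using p y X by (intro mult_left_mono mult_right_mono powr_mono2') (auto simp: P_def)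
    finally show "real (card (Z p)) \<le> 2 * X * y powr (-(9/10)) * real p powr (-(1+1/10))" by simp
  qed
  also have "\<dots> = 2 * X * y powr (-(9/10)) * (\<Sum>p\<in>P. real p powr (-(1+1/10)))" by (simp only: sum_distrib_left)
  also have "\<dots> \<le> 2 * X * y powr (-(9/10)) * (1 + 1 / (1/10))"
    using X finP by (intro mult_left_mono sum_powr_le) (auto simp: P_def)
  finally show ?thesis by simp
qed

text \<open>X = 2 x bounds both n and n + h, Y is (1 + h) X, and the outer factor 2 comes from the
  two signs of H. The parameters y, w and \<eta> stay free, so that only real asymptotics remain
  afterwards.\<close>

lemma card_B_diff_R_le:
  fixes h :: nat and x y w C D \<eta> :: real
  defines "X \<equiv> 2 * x" and "Y \<equiv> 2 * (1 + real h) * x" and "K \<equiv> (1 + real h) * (1 + ln (2 * x))"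
  assumes h: "h \<ge> 1" and x: "x \<ge> real h" "x \<ge> exp 1" and w: "w \<ge> 1" and y: "y > 1" "(real h + 2) * w \<le> y"
    and eta: "0 \<le> \<eta>" "\<eta> \<le> 1/2"
    and C: "C \<ge> 0" "\<And>n. n > 0 \<Longrightarrow> real (tau n) \<le> C * real n powr (1/20)"
    and D: "D \<ge> 0" "\<And>X. X \<ge> exp 1 \<Longrightarrow> 
       (\<Sum>m | m \<ge> 1 \<and> real m \<le> X. sigma_neg (1/10) (divisor_sum m) / real m) \<le> exp (D * sqrt (ln X))"
  shows "B_count h x - R_count h x \<le> 2 * (
     X powr (1 - \<eta>) * exp (20 * y powr \<eta> * ln (1 + ln y)) + 22 * X * y powr (-(9/10)) +
     4 * X * (1 + ln (X + 1)) * (w / K) powr (-(9/10)) * exp (D * sqrt (ln X)) +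
     84 * Y * C * (1 + ln w) * ((3 + ln Y) * (y / w) powr (-(9/10)) + (2 * Y) powr (1/20) * (Y powr (1/5) / w) powr (-(9/10))))"
proof -
  have x1: "x \<ge> 1" using x(2) by (smt (verit) exp_ge_add_one_self)
  have X1: "X \<ge> 1" "X \<ge> exp 1" using x x1 by (auto simp: X_def)
  have K0: "K > 0" using x1 by (simp add: K_def add_pos_nonneg)
  have yh: "w * real h \<le> y" "real h \<le> y"
  proof -
    have "w * real h \<le> (real h + 2) * w" using w by (simp add: algebra_simps)
    thus 1: "w * real h \<le> y" using y by linarith
    have "1 * real h \<le> w * real h" using w by (intro mult_right_mono) auto
    thus "real h \<le> y" using 1 by linarith
  qed
  define S where "S = {n. n \<ge> 1 \<and> smooth y n \<and> real n \<le> X}"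
  define Q where "Q = {N. 1 \<le> N \<and> real N \<le> X \<and> (\<exists>p. prime p \<and> y < real p \<and> p\<^sup>2 dvd N)}"
  \<comment> \<open>One set for each sign of H, read at N = n for H = h and at N = n + h for H = -h.
    The smooth numbers and the multiples of large squares go into both.\<close>
  define T where "T = (\<lambda>H. S \<union> Q \<union> exc_gcd y (w / K) X H \<union> exc_div y w X H)"
  define M where "M = X powr (1 - \<eta>) * exp (20 * y powr \<eta> * ln (1 + ln y)) + 22 * X * y powr (-(9/10)) +
     4 * X * (1 + ln (X + 1)) * (w / K) powr (-(9/10)) * exp (D * sqrt (ln X)) +
     84 * Y * C * (1 + ln w) * ((3 + ln Y) * (y / w) powr (-(9/10)) + (2 * Y) powr (1/20) * (Y powr (1/5) / w) powr (-(9/10)))"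
  have finS: "finite S" "finite Q" unfolding S_def Q_def
    by (rule finite_subset[OF _ finite_nat_le_real[of "\<lambda>_. True" X]]; auto)+
  have T: "finite (T H) \<and> real (card (T H)) \<le> M" if H: "H \<noteq> 0" "\<bar>H\<bar> = int h" for H
  proof -
    have Hy: "\<bar>real_of_int H\<bar> \<le> y" using H yh(2) by linarith
    interpret E: exc_div_setting H h X y w C
      by unfold_locales (use H X1 w y C in auto)
    have Y_eq: "E.Y = Y" unfolding E.Y_def by (simp add: Y_def X_def)
    note g = card_exc_gcd_le[OF H(1) Hy X1(1), of "w / K"]
    have wK: "w / K > 0" using w K0 by simp
    have fin: "finite (T H)" unfolding T_def using finS g(1)[OF wK] E.card_exc_div_le(1) by blast
    have "card (T H) \<le> card S + card Q + card (exc_gcd y (w / K) X H) + card (exc_div y w X H)"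
      unfolding T_def by (meson add_le_mono1 card_Un_le order.trans)
    hence "real (card (T H)) \<le> real (card S) + real (card Q) + real (card (exc_gcd y (w / K) X H)) + real (card (exc_div y w X H))"
      by linarith
    also have "\<dots> \<le> M" unfolding M_def
    proof (intro add_mono)
      show "real (card S) \<le> X powr (1 - \<eta>) * exp (20 * y powr \<eta> * ln (1 + ln y))"
        unfolding S_def by (rule card_smooth_le[OF X1(1) y(1) eta])
      show "real (card Q) \<le> 22 * X * y powr (-(9/10))"
        unfolding Q_def using y by (intro card_large_square_divisor_le X1) auto
      have "real (card (exc_gcd y (w / K) X H)) \<le> 4 * X * (1 + ln (X + 1)) * (w / K) powr (-(9/10)) *
       (\<Sum>m | m \<ge> 1 \<and> real m \<le> X. sigma_neg (1/10) (divisor_sum m) / real m)" by (rule g(2)[OF wK])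
      also have "\<dots> \<le> 4 * X * (1 + ln (X + 1)) * (w / K) powr (-(9/10)) * exp (D * sqrt (ln X))"
        using X1 by (intro mult_left_mono D) auto
      finally show "real (card (exc_gcd y (w / K) X H)) \<le> 4 * X * (1 + ln (X + 1)) * (w / K) powr (-(9/10)) * exp (D * sqrt (ln X))" .
      show "real (card (exc_div y w X H)) \<le> 84 * Y * C * (1 + ln w) * ((3 + ln Y) * (y / w) powr (-(9/10)) + (2 * Y) powr (1/20) * (Y powr (1/5) / w) powr (-(9/10)))"
        using E.card_exc_div_le(2) unfolding Y_eq .
    qed
    finally show ?thesis using fin by blast
  qed
  have T1: "finite (T (int h))" "real (card (T (int h))) \<le> M" using T[of "int h"] h by auto
  have T2: "finite (T (- int h))" "real (card (T (- int h))) \<le> M" using T[of "- int h"] h by auto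
  define Bx where "Bx = {n \<in> B_set h. 1 \<le> n \<and> real n \<le> x}"
  define Rx where "Rx = {n \<in> R_set h. 1 \<le> n \<and> real n \<le> x}"
  have finB: "finite Bx" unfolding Bx_def
    by (rule finite_subset[OF _ finite_nat_le_real[of "\<lambda>_. True" x]]) auto
  have RB: "Rx \<subseteq> Bx" using R_subset_B[OF h] by (auto simp: Rx_def Bx_def)
  have sub: "Bx - Rx \<subseteq> T (int h) \<union> {n. n + h \<in> T (- int h)}"
  proof
    fix n assume n: "n \<in> Bx - Rx"
    hence n': "n \<in> B_set h" "n \<notin> R_set h" "1 \<le> n" "real n \<le> x" by (auto simp: Bx_def Rx_def)
    have nX: "real n + real h \<le> X" using n' x by (simp add: X_def)
    consider "smooth y n" | "smooth y (n + h)" | p where "prime p" "y < real p" "p\<^sup>2 dvd n"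
      | p where "prime p" "y < real p" "p\<^sup>2 dvd n + h"
      | "n \<in> exc_gcd y (w / K) X (int h) \<union> exc_div y w X (int h)"
      | "n + h \<in> exc_gcd y (w / K) X (- int h) \<union> exc_div y w X (- int h)"
      using B_diff_R_cases[OF h n'(1,2) nX yh, of K] w by (auto simp: K_def X_def)
    thus "n \<in> T (int h) \<union> {n. n + h \<in> T (- int h)}"
      by cases (use n' nX in \<open>auto simp: T_def S_def Q_def\<close>)
  qed
  have fin2: "finite {n. n + h \<in> T (- int h)}" "card {n. n + h \<in> T (- int h)} \<le> card (T (- int h))"
    using T2(1) by (auto intro!: card_inj_on_le[of "\<lambda>n. n + h"] finite_inverse_image[of _ "\<lambda>n. n + h", simplified] simp: inj_on_def)
  have "B_count h x - R_count h x = real (card (Bx - Rx))"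
    unfolding B_count_def R_count_def count_upto_def Bx_def[symmetric] Rx_def[symmetric]
    using card_Diff_subset[OF finite_subset[OF RB finB] RB] card_mono[OF finB RB] by simp
  also have "\<dots> \<le> real (card (T (int h) \<union> {n. n + h \<in> T (- int h)}))"
    using T1 fin2 by (intro of_nat_mono card_mono sub) auto
  also have "\<dots> \<le> real (card (T (int h))) + real (card {n. n + h \<in> T (- int h)})"
    by (metis card_Un_le of_nat_add of_nat_le_iff)
  also have "\<dots> \<le> M + M" using T1 T2 fin2 by linarith
  finally have "B_count h x - R_count h x \<le> 2 * M" by simp
  thus ?thesis by (simp only: M_def)
qed


section \<open>Choice of the parameters and conclusion\<close>

theorem theorem3p6:
  fixes h :: nat
  assumes "h \<ge> 1"
  shows "R_set h \<subseteq> B_set h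
    \<and> R_count h \<in> O[at_top](\<lambda>x::real. x / (ln x)\<^sup>2)
    \<and> (\<exists>\<epsilon> :: real \<Rightarrow> real. (\<epsilon> \<longlongrightarrow> 0) at_top \<and>
         (\<forall>\<^sub>F x in at_top.
            0 \<le> B_count h x - R_count h x \<and>
            B_count h x - R_count h x
              \<le> x * exp (- ((1 / sqrt 6 + \<epsilon> x) * sqrt (ln x * ln (ln x))))))"
proof -
  obtain C :: real where C: "C \<ge> 1" "\<And>n. n > 0 \<Longrightarrow> real (tau n) \<le> C * real n powr (1/20)"
    using tau_bound[of "1/20"] by auto
  obtain D0 where D0: "D0 \<ge> 0" "\<And>X. X \<ge> exp 1 \<Longrightarrow> 
       (\<Sum>m | m \<ge> 1 \<and> real m \<le> X. sigma_neg (1/10) (divisor_sum m) / real m) \<le> exp (D0 * sqrt (ln X))"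
    using sum_sigma_neg_divisor_sum_le[of "1/10"] by auto
  \<comment> \<open>A strictly positive constant settles its sign in the asymptotic comparison
    below.\<close>
  define D where "D = D0 + 1"
  have D: "D > 0" "\<And>X. X \<ge> exp 1 \<Longrightarrow> 
       (\<Sum>m | m \<ge> 1 \<and> real m \<le> X. sigma_neg (1/10) (divisor_sum m) / real m) \<le> exp (D * sqrt (ln X))"
  proof -
    show "D > 0" using D0 by (simp add: D_def)
    fix X :: real assume X: "X \<ge> exp 1"
    have "X > 0" using X by (rule less_le_trans[OF exp_gt_zero])
    hence "ln X \<ge> 1" using X by (simp add: ln_ge_iff)
    hence "exp (D0 * sqrt (ln X)) \<le> exp (D * sqrt (ln X))" by (simp add: D_def mult_right_mono)
    with D0(2)[OF X] show "(\<Sum>m | m \<ge> 1 \<and> real m \<le> X. sigma_neg (1/10) (divisor_sum m) / real m) \<le> exp (D * sqrt (ln X))"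
      by linarith
  qed
  define H where "H = 1 + real h"
  have H: "H > 0" by (simp add: H_def)
  define s where "s = (\<lambda>x::real. sqrt (ln x * ln (ln x)))"
  \<comment> \<open>Then \<eta> ln x = (9/20) s(x) is the Rankin saving, while y^\<eta> = (ln
    x)^(9/20), even times ln (1 + s(x)), remains o(s(x)). The coefficient 9/20 has to lie below 1/2
    for the latter and above 42/100 for the result.\<close>
  define \<eta> where "\<eta> = (\<lambda>x::real. 9/20 * ln (ln x) / s x)"
  \<comment> \<open>One fifth of the target, because five terms are bounded separately.\<close>
  define E where "E = (\<lambda>x::real. x * exp (- (42/100) * s x) / 5)"
  have ev1: "\<forall>\<^sub>F x in at_top. 2 * ((2 * x) powr (1 - \<eta> x) * exp (20 * exp (s x) powr \<eta> x * ln (1 + ln (exp (s x))))) \<le> E x"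
  proof -
    have "\<forall>\<^sub>F x in at_top. ln 10 + (1 - \<eta> x) * ln (2 * x) + 20 * exp (9/20 * ln (ln x)) * ln (1 + s x) \<le> ln x - 42/100 * s x"
      unfolding \<eta>_def s_def by real_asymp
    moreover have "\<forall>\<^sub>F x in at_top. s x > 0" unfolding s_def by real_asymp
    ultimately show ?thesis using eventually_gt_at_top[of "0::real"]
    proof eventually_elim
      case (elim x)
      have "exp (s x) powr \<eta> x = exp (9/20 * ln (ln x))"
        using elim(2) by (simp add: exp_powr_real \<eta>_def mult.commute)
      hence "5 * (2 * ((2 * x) powr (1 - \<eta> x) * exp (20 * exp (s x) powr \<eta> x * ln (1 + ln (exp (s x))))))
          = exp (ln 10) * (exp ((1 - \<eta> x) * ln (2 * x)) * exp (20 * exp (9/20 * ln (ln x)) * ln (1 + s x)))"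
        using elim(3) by (simp add: powr_def)
      also have "\<dots> = exp (ln 10 + (1 - \<eta> x) * ln (2 * x) + 20 * exp (9/20 * ln (ln x)) * ln (1 + s x))"
        by (simp only: exp_add mult.assoc)
      also have "\<dots> \<le> exp (ln x - 42/100 * s x)" using elim(1) by simp
      also have "\<dots> = exp (ln x) * exp (- (42/100) * s x)" unfolding exp_add[symmetric] by simp
      also have "exp (ln x) = x" using elim(3) by simp
      finally show ?case by (simp add: E_def)
    qed
  qed
  have ev2: "\<forall>\<^sub>F x in at_top. 2 * (22 * (2 * x) * exp (s x) powr (-(9/10))) \<le> E x"
    unfolding E_def s_def by real_asymp
  \<comment> \<open>w = exp (s(x) / 2), the square root of y: (w / K)^(-9/10) saves exp ((9/20)
    s(x)) up to logarithms, and exp (D sqrt (ln (2 x))) is exp (o (s(x))).\<close>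
  have ev3: "\<forall>\<^sub>F x in at_top. 2 * (4 * (2 * x) * (1 + ln (2 * x + 1)) * (exp (s x / 2) / (H * (1 + ln (2 * x)))) powr (-(9/10)) *
      exp (D * sqrt (ln (2 * x)))) \<le> E x"
    unfolding E_def s_def using D(1) H by real_asymp
  have ev4: "\<forall>\<^sub>F x in at_top. 2 * (84 * (2 * H * x) * C * (1 + ln (exp (s x / 2))) * ((3 + ln (2 * H * x)) * (exp (s x) / exp (s x / 2)) powr (-(9/10)))) \<le> E x"
    unfolding E_def s_def using C(1) H by real_asymp
  \<comment> \<open>Y^(1/20 - 9/50) = Y^(-13/100) saves a power of x, so w^(9/10) and the logarithm
    are harmless.\<close>
  have ev5: "\<forall>\<^sub>F x in at_top. 2 * (84 * (2 * H * x) * C * (1 + ln (exp (s x / 2))) * 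
      ((2 * (2 * H * x)) powr (1/20) * ((2 * H * x) powr (1/5) / exp (s x / 2)) powr (-(9/10)))) \<le> E x"
    unfolding E_def s_def using C(1) H by real_asymp
  have ev6: "\<forall>\<^sub>F x in at_top. s x > 0" unfolding s_def by real_asymp
  have ev7: "\<forall>\<^sub>F x in at_top. (real h + 2) * exp (s x / 2) \<le> exp (s x)" unfolding s_def by real_asymp
  have ev8: "\<forall>\<^sub>F x in at_top. 0 \<le> \<eta> x" unfolding \<eta>_def s_def by real_asymp
  have ev9: "\<forall>\<^sub>F x in at_top. \<eta> x \<le> 1/2" unfolding \<eta>_def s_def by real_asymp
  have sum5: "2 * (a + b + c + (d + e)) \<le> 5 * z" if "2 * a \<le> z" "2 * b \<le> z" "2 * c \<le> z" "2 * d \<le> z" "2 * e \<le> z"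
    for a :: real and b :: real and c :: real and d :: real and e :: real and z :: real
  proof -
    have "2 * (a + b + c + (d + e)) = 2 * a + 2 * b + 2 * c + 2 * d + 2 * e" by (simp add: distrib_left)
    also have "\<dots> \<le> z + z + z + z + z" by (intro add_mono that)
    finally show ?thesis by simp
  qed
  have upper: "\<forall>\<^sub>F x in at_top. B_count h x - R_count h x \<le> x * exp (- (1 / sqrt 6 * s x))"
    using ev1 ev2 ev3 ev4 ev5 ev6 ev7 ev8 ev9 eventually_ge_at_top[of "real h"] eventually_ge_at_top[of "exp 1 :: real"]
  proof eventually_elim
    case (elim x)
    have x0: "x > 0" using elim(11) by (rule less_le_trans[OF exp_gt_zero])
    have "B_count h x - R_count h x \<le> 2 * (
     (2 * x) powr (1 - \<eta> x) * exp (20 * exp (s x) powr \<eta> x * ln (1 + ln (exp (s x)))) + 22 * (2 * x) * exp (s x) powr (-(9/10)) +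
     4 * (2 * x) * (1 + ln (2 * x + 1)) * (exp (s x / 2) / (H * (1 + ln (2 * x)))) powr (-(9/10)) * exp (D * sqrt (ln (2 * x))) +
     84 * (2 * H * x) * C * (1 + ln (exp (s x / 2))) * ((3 + ln (2 * H * x)) * (exp (s x) / exp (s x / 2)) powr (-(9/10)) +
        (2 * (2 * H * x)) powr (1/20) * ((2 * H * x) powr (1/5) / exp (s x / 2)) powr (-(9/10))))"
      unfolding H_def
      by (rule card_B_diff_R_le) (use assms elim(6-11) C D in auto)
    also have "\<dots> \<le> 5 * E x"
      unfolding distrib_left[of "84 * (2 * H * x) * C * (1 + ln (exp (s x / 2)))"]       by (rule sum5[OF elim(1-5)])
    also have "\<dots> = x * exp (- (42/100) * s x)" by (simp add: E_def)
    also have "\<dots> \<le> x * exp (- (1 / sqrt 6 * s x))"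
    proof -
      \<comment> \<open>(12/5)^2 = 144/25 < 6, and 5/12 < 42/100.\<close>
      have "12/5 \<le> sqrt (6::real)" by (rule real_le_rsqrt) (simp add: power2_eq_square)
      hence "1 / sqrt 6 \<le> 42/100" by (simp add: field_simps)
      hence "1 / sqrt 6 * s x \<le> 42/100 * s x" using elim(6) by (intro mult_right_mono) auto
      thus ?thesis using x0 by simp
    qed
    finally show ?case .
  qed
  have lower: "0 \<le> B_count h x - R_count h x" for x
  proof -
    have fin: "finite {n \<in> B_set h. 1 \<le> n \<and> real n \<le> x}"
      by (rule finite_subset[OF _ finite_nat_le_real[of "\<lambda>_. True" x]]) auto
    have "count_upto (R_set h) x \<le> count_upto (B_set h) x"
      unfolding count_upto_def using R_subset_B[OF assms] by (intro card_mono fin) auto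
    thus ?thesis by (simp add: B_count_def R_count_def)
  qed
  show ?thesis
  proof (intro conjI exI[of _ "\<lambda>_. 0"])
    show "\<forall>\<^sub>F x in at_top. 0 \<le> B_count h x - R_count h x \<and>
            B_count h x - R_count h x \<le> x * exp (- ((1 / sqrt 6 + 0) * sqrt (ln x * ln (ln x))))"
      using upper by eventually_elim (simp add: lower[simplified] s_def)
  qed (use R_subset_B[OF assms] R_count_bigo[OF assms] in auto)
qed

end
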